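(* Let $D\subset\mathbb{R}^n$ and $K\subset\mathbb{R}^m$ be closed sets, $g:\mathbb{R}^n\to\mathbb{R}^m$, $\bar x\in D$ and $g(\bar x)\in K$. Suppose that either $D$ is directionally regular at $\bar x$ or $K$ is directionally regular at $g(\bar x)$, and that $g$ is continuously differentiable near $\bar x$. Let $F:\mathbb{R}^n\rightrightarrows\mathbb{R}^m$ be defined by $F(x)=K-g(x)$ if $x\in D$ and $F(x)=\emptyset$ otherwise. Then $$\inf\{\max\{\|u^*\|_*,\|v\|\}\mid u^*+\nabla g(\bar x)^Tv^*\in\overline N_D(\bar x;u),\ -v^*\in\overline N_K(g(\bar x);v+\nabla g(\bar x)u),\ \|u\|=\|v^*\|_*=1\}$$ $$\le\ \mathrm{rad[SR]}_{Lip}F(\bar x\,|\,0)\ \le$$ $$\inf\{\|u^*\|_*+\|v\|\mid u^*+\nabla g(\bar x)^Tv^*\in\overline N_D(\bar x;u),\ -v^*\in\overline N_K(g(\bar x);v+\nabla g(\bar x)u),\ \|u\|=\|v^*\|_*=1\},$$ and $$\mathrm{rad[SR]}_{ss}F(\bar x\,|\,0)=\mathrm{rad[SR]}_{C^1}F(\bar x\,|\,0)=\inf\{\|B\|\mid B\in L(\mathbb{R}^n,\mathbb{R}^m),\ (B+\nabla g(\bar x))^Tv^*\in\overline N_D(\bar x;u),\ -v^*\in\overline N_K(g(\bar x);(B+\nabla g(\bar x))u),\ \|u\|=\|v^*\|_*=1\}.$$ Here the infima are over all $u\in\mathbb{R}^n$, $v\in\mathbb{R}^m$, $u^*\in(\mathbb{R}^n)^*$,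 $v^*\in(\mathbb{R}^m)^*$ (respectively all $B$, $u$, $v^*$) satisfying the listed conditions.
   Context: Norms: $\mathbb{R}^n$ and $\mathbb{R}^m$ carry arbitrary norms, both written $\|\cdot\|$, with dual norms $\|\cdot\|_*$. Starred vectors are elements of the dual spaces, identified with column vectors. $L(\mathbb{R}^n,\mathbb{R}^m)$ is the set of $m\times n$ matrices, with the operator norm. Infima over the empty set are $+\infty$. Normal cones: For a set $A\subset\mathbb{R}^d$ and $z\in A$, $T_A(z)=\{w\mid \exists w_i\to w,\ t_i\searrow0,\ z+t_iw_i\in A\ \forall i\}$ and $N_A(z)=\{z^*\mid \langle z^*,w\rangle\le0\ \forall w\in T_A(z)\}$; $N_A(z)=\emptyset$ if $z\notin A$. For $w\in\mathbb{R}^d$, $\overline N_A(z;w)=\{z^*\mid\exists t_i\searrow0,\ w_i\to w,\ z_i^*\to z^*,\ z_i^*\in N_A(z+t_iw_i)\ \forall i\}$. The set $A$ is directionally regular at $z$ in direction $w$ if $\overline N_A(z;w)=\{z^*\mid\forall t_i\searrow0\ \exists w_i\to w,\ z_i^*\to z^*\text{ such that } z_i^*\in N_A(z+t_iw_i)\ \forall i\}$, and directionally regular at $z$ if this holds for all directions $w$. Metric subregularity: $G:\mathbb{R}^n\rightrightarrows\mathbb{R}^m$ is metrically subregular at $\bar x$ for $\bar y$ if $\bar y\in G(\bar x)$ and there are $\kappa\ge0$ and a neighborhood $U$ of $\bar x$ with $d(x,G^{-1}(\bar y))\le\kappa\, d(\bar y,G(x))$ for all $x\in U$, where $G^{-1}(y)=\{x\mid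 y\in G(x)\}$, $d(x,C)=\inf_{c\in C}\|x-c\|$ and $d(\cdot,\emptyset)=+\infty$. Radii: $\operatorname{lip}(h;\bar x)=\limsup_{x,x'\to\bar x,\,x\ne x'}\|h(x)-h(x')\|/\|x-x'\|$. Consider the classes of functions $h:\mathbb{R}^n\to\mathbb{R}^m$ with $h(\bar x)=0$: $\mathcal F_{Lip}$ (Lipschitz continuous around $\bar x$), $\mathcal F_{ss}$ (semismooth at $\bar x$), $\mathcal F_{C^1}$ ($C^1$ around $\bar x$). Here $h$ is semismooth at $\bar x$ if it is Lipschitz continuous around $\bar x$ and for every $u\in\mathbb{R}^n$ the limit of $Vu'$, over $V\in\partial_Ch(\bar x+tu')$, $u'\to u$, $t\searrow0$, exists; $\partial_Ch(x)$ is the Clarke generalized Jacobian (the convex hull of all limits of $\nabla h(x_k)$, $x_k\to x$, $h$ differentiable at $x_k$). For $\mathcal P\in\{Lip,ss,C^1\}$, $$\mathrm{rad[SR]}_{\mathcal P}F(\bar x\,|\,\bar y)=\inf_{h\in\mathcal F_{\mathcal P}}\{\operatorname{lip}(h;\bar x)\mid F+h\text{ is not metrically subregular at }\bar x\text{ for }\bar y\}.$$ *)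

theory Defs
  imports "HOL-Analysis.Analysis"
begin

text \<open>The norms on \<open>real ^ 'n\<close> and \<open>real ^ 'm\<close> are arbitrary, hence they are passed around as
  functions. All norms on such a space are equivalent, so purely topological notions (limits,
  neighbourhoods, continuity, differentiability, local Lipschitz continuity) are those of the
  library, and only distances, moduli and dual or operator norms refer to the given norms.\<close>

definition is_norm :: "('a::real_vector \<Rightarrow> real) \<Rightarrow> bool" where
  "is_norm N \<longleftrightarrow> (\<forall>x. 0 \<le> N x) \<and> (\<forall>x. N x = 0 \<longleftrightarrow> x = 0) \<and>
     (\<forall>c x. N (c *\<^sub>R x) = \<bar>c\<bar> * N x) \<and> (\<forall>x y. N (x + y) \<le> N x + N y)"

definition dual_norm :: "('a::real_inner \<Rightarrow> real) \<Rightarrow> 'a \<Rightarrow> real" where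
  "dual_norm N z = (SUP x\<in>{x. N x \<le> 1}. z \<bullet> x)"

definition op_norm ::
  "(real^'n \<Rightarrow> real) \<Rightarrow> (real^'m \<Rightarrow> real) \<Rightarrow> real^'n^'m \<Rightarrow> real" where
  "op_norm N M B = (SUP x\<in>{x. N x \<le> 1}. M (B *v x))"

text \<open>\<open>t \<searrow> 0\<close> means convergence to 0 through positive values; monotonicity is not required.\<close>

definition down0 :: "(nat \<Rightarrow> real) \<Rightarrow> bool" where
  "down0 t \<longleftrightarrow> (\<forall>i. 0 < t i) \<and> t \<longlonglongrightarrow> 0"

definition tangent_cone :: "'a::real_inner set \<Rightarrow> 'a \<Rightarrow> 'a set" where
  "tangent_cone A z =
     {w. \<exists>W t. W \<longlonglongrightarrow> w \<and> down0 t \<and> (\<forall>i. z + t i *\<^sub>R W i \<in> A)}"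

definition normal_cone :: "'a::real_inner set \<Rightarrow> 'a \<Rightarrow> 'a set" where
  "normal_cone A z = (if z \<in> A then {zs. \<forall>w\<in>tangent_cone A z. zs \<bullet> w \<le> 0} else {})"

definition dir_normal_cone :: "'a::real_inner set \<Rightarrow> 'a \<Rightarrow> 'a \<Rightarrow> 'a set" where
  "dir_normal_cone A z w =
     {zs. \<exists>t W Z. down0 t \<and> W \<longlonglongrightarrow> w \<and> Z \<longlonglongrightarrow> zs \<and>
            (\<forall>i. Z i \<in> normal_cone A (z + t i *\<^sub>R W i))}"

definition dir_regular_in :: "'a::real_inner set \<Rightarrow> 'a \<Rightarrow> 'a \<Rightarrow> bool" where
  "dir_regular_in A z w \<longleftrightarrow> dir_normal_cone A z w =
     {zs. \<forall>t. down0 t \<longrightarrow> (\<exists>W Z. W \<longlonglongrightarrow> w \<and> Z \<longlonglongrightarrow> zs \<and>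
            (\<forall>i. Z i \<in> normal_cone A (z + t i *\<^sub>R W i)))}"

definition dir_regular :: "'a::real_inner set \<Rightarrow> 'a \<Rightarrow> bool" where
  "dir_regular A z \<longleftrightarrow> (\<forall>w. dir_regular_in A z w)"

text \<open>Distances are extended reals; the infimum over the empty set is \<open>\<infinity>\<close>.\<close>

definition set_dist :: "('a::real_vector \<Rightarrow> real) \<Rightarrow> 'a \<Rightarrow> 'a set \<Rightarrow> ereal" where
  "set_dist N x C = (INF c\<in>C. ereal (N (x - c)))"

text \<open>Here \<open>0 * \<infinity> = 0\<close>. This convention is immaterial, as \<open>\<kappa> = 0\<close> can always be replaced
  by a positive constant.\<close>

definition metrically_subregular ::
  "('a::{real_vector,topological_space} \<Rightarrow> real) \<Rightarrow> ('b::real_vector \<Rightarrow> real) \<Rightarrow>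
     ('a \<Rightarrow> 'b set) \<Rightarrow> 'a \<Rightarrow> 'b \<Rightarrow> bool" where
  "metrically_subregular N M G x0 y0 \<longleftrightarrow> y0 \<in> G x0 \<and>
     (\<exists>\<kappa>\<ge>0. \<exists>U. open U \<and> x0 \<in> U \<and>
        (\<forall>x\<in>U. set_dist N x {x'. y0 \<in> G x'} \<le> ereal \<kappa> * set_dist M y0 (G x)))"

definition lip :: "(real^'n \<Rightarrow> real) \<Rightarrow> (real^'m \<Rightarrow> real) \<Rightarrow> (real^'n \<Rightarrow> real^'m) \<Rightarrow>
    real^'n \<Rightarrow> ereal" where
  "lip N M h x0 = Limsup (at (x0, x0) within {(x, x'). x \<noteq> x'})
     (\<lambda>(x, x'). ereal (M (h x - h x') / N (x - x')))"

definition lipschitz_around :: "(real^'n \<Rightarrow> real^'m) \<Rightarrow> real^'n \<Rightarrow> bool" where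
  "lipschitz_around h x0 \<longleftrightarrow> (\<exists>U L. open U \<and> x0 \<in> U \<and> L-lipschitz_on U h)"

definition C1_around :: "(real^'n \<Rightarrow> real^'m) \<Rightarrow> real^'n \<Rightarrow> bool" where
  "C1_around h x0 \<longleftrightarrow> (\<exists>U. open U \<and> x0 \<in> U \<and> (\<forall>x\<in>U. h differentiable (at x)) \<and>
     continuous_on U (\<lambda>x. jacobian h (at x)))"

definition clarke_jacobian :: "(real^'n \<Rightarrow> real^'m) \<Rightarrow> real^'n \<Rightarrow> (real^'n^'m) set" where
  "clarke_jacobian h x = convex hull
     {V. \<exists>X. X \<longlonglongrightarrow> x \<and> (\<forall>k. h differentiable (at (X k))) \<and>
            (\<lambda>k. jacobian h (at (X k))) \<longlonglongrightarrow> V}"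

definition semismooth_at :: "(real^'n \<Rightarrow> real^'m) \<Rightarrow> real^'n \<Rightarrow> bool" where
  "semismooth_at h x0 \<longleftrightarrow> lipschitz_around h x0 \<and>
     (\<forall>u. \<exists>l. \<forall>t W V. down0 t \<and> W \<longlonglongrightarrow> u \<and>
          (\<forall>i. V i \<in> clarke_jacobian h (x0 + t i *\<^sub>R W i)) \<longrightarrow>
        (\<lambda>i. V i *v W i) \<longlonglongrightarrow> l)"

definition F_Lip :: "real^'n \<Rightarrow> (real^'n \<Rightarrow> real^'m) set" where
  "F_Lip x0 = {h. h x0 = 0 \<and> lipschitz_around h x0}"

definition F_ss :: "real^'n \<Rightarrow> (real^'n \<Rightarrow> real^'m) set" where
  "F_ss x0 = {h. h x0 = 0 \<and> semismooth_at h x0}"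

definition F_C1 :: "real^'n \<Rightarrow> (real^'n \<Rightarrow> real^'m) set" where
  "F_C1 x0 = {h. h x0 = 0 \<and> C1_around h x0}"

definition rad_SR :: "(real^'n \<Rightarrow> real) \<Rightarrow> (real^'m \<Rightarrow> real) \<Rightarrow> (real^'n \<Rightarrow> real^'m) set \<Rightarrow>
    (real^'n \<Rightarrow> (real^'m) set) \<Rightarrow> real^'n \<Rightarrow> real^'m \<Rightarrow> ereal" where
  "rad_SR N M P F x0 y0 =
     (INF h\<in>{h\<in>P. \<not> metrically_subregular N M (\<lambda>x. (\<lambda>y. y + h x) ` F x) x0 y0}. lip N M h x0)"

end

theory Submission
  imports Defs
begin

text \<open>Put \<open>f = g - h\<close>. Then \<open>F + h\<close> is subregular at \<open>xb\<close> for 0 iff the distance of \<open>x \<in> D\<close> to the solutions of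
  \<open>f x \<in> K\<close> in \<open>D\<close> is bounded by a multiple of the residual, the distance from \<open>f x\<close> to \<open>K\<close>
  (\<open>not_metrically_subregular_iff\<close>). The norms only influence the values of the radii, not
  subregularity itself, so Euclidean distances are used wherever possible.

  \<^emph>\<open>Lower estimates.\<close> Suppose that subregularity fails. A variational principle with penalised
  decoupling of the constraints (\<open>nonsubregular_proximal_point\<close>) yields points of \<open>D\<close> and \<open>K\<close> with
  normals, linked by a first-order inequality for \<open>f\<close>. In the limit
  (\<open>directional_normals_of_nonsubregular\<close>) they become directional normals as in the formulas, where \<open>v\<close>
  is a limit of difference quotients of \<open>- h\<close>, and \<open>us\<close> a limit of subgradients of \<open>- vs \<bullet> h\<close>. Each of them
  is bounded by the Lipschitz modulus of \<open>h\<close>, which is the estimate by the maximum. If \<open>h\<close> is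
  semismooth, the subgradients come from Clarke Jacobians (\<open>clarke_subgradient\<close>), whose limit is one
  matrix that produces both \<open>v\<close> and \<open>us\<close>. This step is the reason for the first sections: the Clarke
  Jacobian is defined by points of differentiability, so relating it to the increments of \<open>h\<close> needs
  Rademacher's theorem and a mean value inequality on almost all parallel segments.

  \<^emph>\<open>Upper estimates.\<close> Conversely, directional regularity of one of the sets provides normals at points of \<open>D\<close>
  and \<open>K\<close> with the same step sizes (\<open>synchronized_normals\<close>). A perturbation with the right values
  and derivatives at these points, up to errors \<open>o(t)\<close> and \<open>o(1)\<close>, can be corrected by a
  function of class C1 with derivative 0 at \<open>xb\<close>, so that the solutions are
  pushed away from the points (\<open>C1_perturbation_destroys_subregularity\<close>). The correction costs nothing. It
  remains to choose the main part: the linear map \<open>- B\<close> in class C1, and a Lipschitz function with independently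
  prescribed values and slopes otherwise, whose modulus is the sum of both contributions.

  Functions of class C1 are semismooth, so the lower estimate for semismooth and the upper estimate for C1
  perturbations show that these two radii coincide.\<close>

section \<open>Arbitrary norms, dual norms and Lipschitz moduli\<close>

lemma
  assumes "is_norm N"
  shows is_norm_nonneg: "0 \<le> N x"
    and is_norm_zero: "N 0 = 0"
    and is_norm_scale: "N (c *\<^sub>R x) = \<bar>c\<bar> * N x"
    and is_norm_triangle: "N (x + y) \<le> N x + N y"
    and is_norm_uminus: "N (- x) = N x"
    and is_norm_commute: "N (x - y) = N (y - x)"
    and is_norm_triangle_diff: "N x - N y \<le> N (x - y)"
    and is_norm_pos: "x \<noteq> 0 \<Longrightarrow> 0 < N x"
proof -
  have z: "N x = 0 \<longleftrightarrow> x = 0" for x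
    using assms by (auto simp: is_norm_def)
  show nn: "0 \<le> N x" and "N 0 = 0" and sc: "N (c *\<^sub>R x) = \<bar>c\<bar> * N x"
    and tr: "N (x + y) \<le> N x + N y" for c x y
    using assms by (auto simp: is_norm_def)
  show mi: "N (- x) = N x" for x
    using sc[of "-1" x] by simp
  show "N (x - y) = N (y - x)"
    using mi[of "x - y"] by simp
  show "N x - N y \<le> N (x - y)"
    using tr[of "x - y" y] by simp
  show "x \<noteq> 0 \<Longrightarrow> 0 < N x"
    using nn[of x] z by (simp add: order_less_le)
qed

lemma is_norm_upper:
  fixes N :: "'a::euclidean_space \<Rightarrow> real"
  assumes N: "is_norm N"
  obtains C where "C > 0" "\<And>x. N x \<le> C * norm x"
proof
  define C where "C = (\<Sum>b\<in>Basis. N b)"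
  have sum_le: "N (\<Sum>b\<in>S. f b) \<le> (\<Sum>b\<in>S. N (f b))" if "finite S" for S and f :: "'a \<Rightarrow> 'a"
    using that
  proof (induction S)
    case (insert b S)
    then show ?case using is_norm_triangle[OF N, of "f b" "\<Sum>b\<in>S. f b"] by simp
  qed (simp add: is_norm_zero[OF N])
  have C0: "0 \<le> C" unfolding C_def by (intro sum_nonneg is_norm_nonneg[OF N])
  show "0 < C + 1" using C0 by simp
  show "N x \<le> (C + 1) * norm x" for x
  proof -
    have "N x = N (\<Sum>b\<in>Basis. (x \<bullet> b) *\<^sub>R b)" by (simp add: euclidean_representation)
    also have "\<dots> \<le> (\<Sum>b\<in>Basis. N ((x \<bullet> b) *\<^sub>R b))" by (rule sum_le) simp
    also have "\<dots> = (\<Sum>b\<in>Basis. \<bar>x \<bullet> b\<bar> * N b)" by (simp add: is_norm_scale[OF N])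
    also have "\<dots> \<le> (\<Sum>b\<in>Basis. norm x * N b)"
      by (intro sum_mono mult_right_mono Basis_le_norm is_norm_nonneg[OF N])
    also have "\<dots> = C * norm x" by (simp add: C_def sum_distrib_left mult.commute)
    also have "\<dots> \<le> (C + 1) * norm x" by (simp add: mult_right_mono)
    finally show ?thesis .
  qed
qed

lemma is_norm_continuous:
  fixes N :: "'a::euclidean_space \<Rightarrow> real"
  assumes N: "is_norm N"
  shows "continuous_on S N"
proof -
  obtain C where C: "C > 0" "\<And>x. N x \<le> C * norm x" using is_norm_upper[OF N] by metis
  have "\<bar>N x - N y\<bar> \<le> C * norm (x - y)" for x y
    using is_norm_triangle_diff[OF N, of x y] is_norm_triangle_diff[OF N, of y x]
      is_norm_commute[OF N, of x y] C(2)[of "x - y"] by linarith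
  then have "C-lipschitz_on S N"
    using C(1) by (intro lipschitz_onI) (auto simp: dist_norm)
  then show ?thesis by (rule lipschitz_on_continuous_on)
qed

lemma is_norm_tendsto:
  fixes N :: "'a::euclidean_space \<Rightarrow> real"
  assumes "is_norm N" "(f \<longlongrightarrow> l) F"
  shows "((\<lambda>x. N (f x)) \<longlongrightarrow> N l) F"
  using is_norm_continuous[OF assms(1), of UNIV] assms(2)
  by (metis UNIV_I continuous_on_eq_continuous_at isCont_tendsto_compose open_UNIV)

lemma is_norm_lower:
  fixes N :: "'a::euclidean_space \<Rightarrow> real"
  assumes N: "is_norm N"
  obtains c where "c > 0" "\<And>x. c * norm x \<le> N x"
proof -
  have "compact (sphere (0::'a) 1)" "sphere (0::'a) 1 \<noteq> {}" by auto
  then obtain z where z: "z \<in> sphere 0 1" "\<And>x. x \<in> sphere 0 1 \<Longrightarrow> N z \<le> N x"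
    using continuous_attains_inf[OF _ _ is_norm_continuous[OF N]] by metis
  have "N z * norm x \<le> N x" for x
  proof (cases "x = 0")
    case True then show ?thesis by (simp add: is_norm_zero[OF N])
  next
    case False
    then have "N z \<le> N (inverse (norm x) *\<^sub>R x)" by (intro z) simp
    then show ?thesis using False by (simp add: is_norm_scale[OF N] field_simps)
  qed
  moreover have "N z > 0" using z(1) by (intro is_norm_pos[OF N]) auto
  ultimately show thesis using that by blast
qed

lemma is_norm_unit_ball_compact:
  fixes N :: "'a::euclidean_space \<Rightarrow> real"
  assumes N: "is_norm N"
  shows "compact {x. N x \<le> 1}"
proof -
  obtain c where c: "c > 0" "\<And>x. c * norm x \<le> N x" using is_norm_lower[OF N] by metis
  have "norm x \<le> 1 / c" if "N x \<le> 1" for x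
    using c(1) order_trans[OF c(2)[of x] that] by (simp add: field_simps)
  then have "bounded {x. N x \<le> 1}" by (auto simp: bounded_iff)
  moreover have "closed {x. N x \<le> 1}"
    by (intro closed_Collect_le is_norm_continuous[OF N] continuous_intros)
  ultimately show ?thesis by (simp add: compact_eq_bounded_closed)
qed

lemma dual_norm_bdd:
  fixes N :: "'a::euclidean_space \<Rightarrow> real"
  assumes N: "is_norm N"
  shows "bdd_above ((\<lambda>x. z \<bullet> x) ` {x. N x \<le> 1})"
  by (intro bounded_imp_bdd_above compact_imp_bounded compact_continuous_image
      is_norm_unit_ball_compact[OF N] continuous_intros)

lemma dual_norm_inner:
  fixes N :: "'a::euclidean_space \<Rightarrow> real"
  assumes N: "is_norm N"
  shows "z \<bullet> x \<le> dual_norm N z * N x"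
proof (cases "x = 0")
  case True then show ?thesis by (simp add: is_norm_zero[OF N])
next
  case False
  then have p: "N x > 0" by (rule is_norm_pos[OF N])
  then have "N (inverse (N x) *\<^sub>R x) \<le> 1" by (simp add: is_norm_scale[OF N])
  then have "z \<bullet> (inverse (N x) *\<^sub>R x) \<le> dual_norm N z"
    unfolding dual_norm_def by (intro cSUP_upper dual_norm_bdd[OF N]) auto
  then show ?thesis using p by (simp add: field_simps)
qed

lemma dual_norm_least:
  fixes N :: "'a::euclidean_space \<Rightarrow> real"
  assumes N: "is_norm N" and le: "\<And>x. z \<bullet> x \<le> r * N x" and r: "0 \<le> r"
  shows "dual_norm N z \<le> r"
  unfolding dual_norm_def
proof (rule cSUP_least)
  show "{x. N x \<le> 1} \<noteq> {}" using is_norm_zero[OF N] by (auto intro!: exI[of _ 0])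
  fix x assume "x \<in> {x. N x \<le> 1}"
  then have "r * N x \<le> r * 1" using r by (intro mult_left_mono) auto
  then show "z \<bullet> x \<le> r" using le[of x] by simp
qed

lemma dual_norm_nonneg:
  fixes N :: "'a::euclidean_space \<Rightarrow> real"
  assumes N: "is_norm N"
  shows "0 \<le> dual_norm N z"
  using cSUP_upper[OF _ dual_norm_bdd[OF N], of 0 z] is_norm_zero[OF N] by (simp add: dual_norm_def)

lemma dual_norm_pos:
  fixes N :: "'a::euclidean_space \<Rightarrow> real"
  assumes N: "is_norm N" and "z \<noteq> 0"
  shows "0 < dual_norm N z"
proof -
  have "0 < z \<bullet> z" using assms(2) by simp
  also have "\<dots> \<le> dual_norm N z * N z" by (rule dual_norm_inner[OF N])
  finally show ?thesis using is_norm_pos[OF N assms(2)] by (simp add: zero_less_mult_iff)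
qed

lemma dual_norm_scale:
  fixes N :: "'a::euclidean_space \<Rightarrow> real"
  assumes N: "is_norm N" and c: "0 < c"
  shows "dual_norm N (c *\<^sub>R z) = c * dual_norm N z"
proof (rule antisym)
  show "dual_norm N (c *\<^sub>R z) \<le> c * dual_norm N z"
    using dual_norm_inner[OF N, of z] c dual_norm_nonneg[OF N, of z]
    by (intro dual_norm_least[OF N]) (auto simp: mult.assoc)
  have "dual_norm N z \<le> dual_norm N (c *\<^sub>R z) / c"
    using dual_norm_inner[OF N, of "c *\<^sub>R z"] c dual_norm_nonneg[OF N, of "c *\<^sub>R z"]
    by (intro dual_norm_least[OF N]) (auto simp: field_simps)
  then show "c * dual_norm N z \<le> dual_norm N (c *\<^sub>R z)"
    using c by (simp add: field_simps)
qed

lemma dual_norm_attained: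
  fixes N :: "'a::euclidean_space \<Rightarrow> real"
  assumes N: "is_norm N"
  obtains w where "N w \<le> 1" "z \<bullet> w = dual_norm N z"
proof -
  have ne: "{x. N x \<le> 1} \<noteq> {}" using is_norm_zero[OF N] by (auto intro!: exI[of _ 0])
  have "continuous_on {x. N x \<le> 1} (\<lambda>x. z \<bullet> x)" by (intro continuous_intros)
  then obtain w where w: "w \<in> {x. N x \<le> 1}" "\<And>x. x \<in> {x. N x \<le> 1} \<Longrightarrow> z \<bullet> x \<le> z \<bullet> w"
    using continuous_attains_sup[OF is_norm_unit_ball_compact[OF N] ne, of "\<lambda>x. z \<bullet> x"]
    by blast
  have "dual_norm N z = z \<bullet> w"
    unfolding dual_norm_def using w by (intro cSup_eq_maximum) auto
  then show thesis using that w by auto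
qed

lemma op_norm_bdd:
  fixes N :: "real^'n \<Rightarrow> real" and M :: "real^'m \<Rightarrow> real"
  assumes N: "is_norm N" and M: "is_norm M"
  shows "bdd_above ((\<lambda>x. M (B *v x)) ` {x. N x \<le> 1})"
  by (intro bounded_imp_bdd_above compact_imp_bounded compact_continuous_image
      is_norm_unit_ball_compact[OF N] continuous_on_compose2[OF is_norm_continuous[OF M, of UNIV]]
      linear_continuous_on matrix_vector_mul_bounded_linear) auto

lemma op_norm_apply:
  assumes N: "is_norm N" and M: "is_norm M"
  shows "M (B *v x) \<le> op_norm N M B * N x"
proof (cases "x = 0")
  case True then show ?thesis by (simp add: is_norm_zero[OF N] is_norm_zero[OF M])
next
  case False
  then have p: "N x > 0" by (rule is_norm_pos[OF N])
  then have "N (inverse (N x) *\<^sub>R x) \<le> 1" by (simp add: is_norm_scale[OF N])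
  then have "M (B *v (inverse (N x) *\<^sub>R x)) \<le> op_norm N M B"
    unfolding op_norm_def by (intro cSUP_upper op_norm_bdd[OF N M]) auto
  then show ?thesis using p by (simp add: matrix_vector_mult_scaleR is_norm_scale[OF M] field_simps)
qed

lemma op_norm_least:
  assumes N: "is_norm N" and le: "\<And>x. M (B *v x) \<le> r * N x" and r: "0 \<le> r"
  shows "op_norm N M B \<le> r"
  unfolding op_norm_def
proof (rule cSUP_least)
  show "{x. N x \<le> 1} \<noteq> {}" using is_norm_zero[OF N] by (auto intro!: exI[of _ 0])
  fix x assume "x \<in> {x. N x \<le> 1}"
  then have "r * N x \<le> r * 1" using r by (intro mult_left_mono) auto
  then show "M (B *v x) \<le> r" using le[of x] by simp
qed

lemma lip_lessD:
  assumes N: "is_norm N" and M: "is_norm M" and "lip N M h x0 < ereal l"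
  obtains r where "r > 0" "\<And>x x'. x \<in> ball x0 r \<Longrightarrow> x' \<in> ball x0 r \<Longrightarrow> M (h x - h x') \<le> l * N (x - x')"
proof -
  have "\<forall>\<^sub>F z in at (x0, x0) within {(x, x'). x \<noteq> x'}. (case z of (x, x') \<Rightarrow> ereal (M (h x - h x') / N (x - x'))) < ereal l"
    using assms(3) unfolding lip_def by (rule Limsup_lessD)
  then obtain d where d: "d > 0" "\<And>x x'. x \<noteq> x' \<Longrightarrow> (x, x') \<noteq> (x0, x0) \<Longrightarrow> dist (x, x') (x0, x0) < d
      \<Longrightarrow> M (h x - h x') / N (x - x') < l"
    unfolding eventually_at by auto
  have "M (h x - h x') \<le> l * N (x - x')" if "x \<in> ball x0 (d/2)" "x' \<in> ball x0 (d/2)" for x x'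
  proof (cases "x = x'")
    case True then show ?thesis by (simp add: is_norm_zero[OF M] is_norm_zero[OF N])
  next
    case False
    have "dist (x, x') (x0, x0) \<le> dist x x0 + dist x' x0"
      unfolding dist_prod_def by (rule order_trans[OF sqrt_sum_squares_le_sum]) auto
    also have "\<dots> < d" using that by (simp add: dist_commute)
    finally have "M (h x - h x') / N (x - x') < l" using False by (intro d) auto
    then show ?thesis using is_norm_pos[OF N, of "x - x'"] False by (simp add: field_simps)
  qed
  then show thesis using that[of "d/2"] d(1) by simp
qed

lemma lip_leI:
  assumes N: "is_norm N" and "r > 0"
    and "\<And>x x'. x \<in> ball x0 r \<Longrightarrow> x' \<in> ball x0 r \<Longrightarrow> M (h x - h x') \<le> l * N (x - x')"
  shows "lip N M h x0 \<le> ereal l"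
  unfolding lip_def
proof (rule Limsup_bounded)
  show "\<forall>\<^sub>F z in at (x0, x0) within {(x, x'). x \<noteq> x'}. (case z of (x, x') \<Rightarrow> ereal (M (h x - h x') / N (x - x'))) \<le> ereal l"
    unfolding eventually_at
  proof (intro exI[of _ r] conjI ballI impI \<open>r > 0\<close>)
    fix z assume z: "z \<in> {(x, x'). x \<noteq> x'}" and d: "z \<noteq> (x0, x0) \<and> dist z (x0, x0) < r"
    obtain x x' where xx: "z = (x, x')" by (cases z)
    have "dist x x0 < r" "dist x' x0 < r"
      using d dist_fst_le[of z "(x0,x0)"] dist_snd_le[of z "(x0,x0)"] by (auto simp: xx)
    then have "M (h x - h x') \<le> l * N (x - x')" by (intro assms) (auto simp: dist_commute)
    moreover have "N (x - x') > 0" using z by (intro is_norm_pos[OF N]) (auto simp: xx)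
    ultimately show "(case z of (x, x') \<Rightarrow> ereal (M (h x - h x') / N (x - x'))) \<le> ereal l"
      by (simp add: xx field_simps)
  qed
qed

section \<open>The fundamental theorem of calculus for Lipschitz functions of one variable\<close>

text \<open>The inverse of \<open>\<theta>\<close> pushes Lebesgue measure forward to the measure that gives \<open>{a..b}\<close> the mass
  \<open>\<theta> b - \<theta> a\<close>. Lipschitz maps preserve null sets, so this measure is absolutely continuous, and
  \<open>G\<close> is its Radon-Nikodym density. The lower bound on the slopes makes \<open>\<theta>\<close> invertible.\<close>

lemma strictly_expanding_lipschitz_density:
  fixes \<theta> :: "real \<Rightarrow> real"
  assumes lo: "\<And>x y. x \<le> y \<Longrightarrow> y - x \<le> \<theta> y - \<theta> x"
    and hi: "\<And>x y. x \<le> y \<Longrightarrow> \<theta> y - \<theta> x \<le> C * (y - x)"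
  obtains G :: "real \<Rightarrow> real" where "\<And>a b. a \<le> b \<Longrightarrow> (G has_integral (\<theta> b - \<theta> a)) {a..b}"
proof -
  have strict: "x < y \<longleftrightarrow> \<theta> x < \<theta> y" for x y
    using lo[of x y] lo[of y x] by (cases x y rule: linorder_cases) auto
  have inj: "inj \<theta>"
    by (metis injI linorder_less_linear order_less_irrefl strict)
  have lip: "\<bar>\<theta> y - \<theta> x\<bar> \<le> C * \<bar>y - x\<bar>" for x y
    using hi[of x y] hi[of y x] lo[of x y] lo[of y x] by (cases "x \<le> y") auto
  have "0 \<le> C" using lip[of 1 0] by simp
  then have "C-lipschitz_on UNIV \<theta>"
    using lip by (intro lipschitz_onI) (auto simp: dist_real_def)
  then have cont: "continuous_on UNIV \<theta>"
    by (rule lipschitz_on_continuous_on)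
  have surj: "\<exists>x. \<theta> x = y" for y
  proof -
    define r where "r = \<bar>y\<bar> + \<bar>\<theta> 0\<bar>"
    have "\<theta> (- r) \<le> y" "y \<le> \<theta> r"
      using lo[of 0 r] lo[of "-r" 0] abs_ge_self[of y] abs_ge_minus_self[of y]
        abs_ge_self[of "\<theta> 0"] abs_ge_minus_self[of "\<theta> 0"] unfolding r_def by linarith+
    then show ?thesis
      using IVT'[of \<theta> "-r" y r] cont continuous_on_subset by (fastforce simp: r_def)
  qed
  define \<psi> where "\<psi> = inv \<theta>"
  have \<psi>\<theta>: "\<psi> (\<theta> x) = x" and \<theta>\<psi>: "\<theta> (\<psi> y) = y" for x y
    using inj surj by (auto simp: \<psi>_def surj_f_inv_f surj_def) (metis f_inv_into_f rangeI)
  have "\<bar>\<psi> y - \<psi> x\<bar> \<le> \<bar>y - x\<bar>" for x y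
    using lo[of "\<psi> x" "\<psi> y"] lo[of "\<psi> y" "\<psi> x"] \<theta>\<psi> by (cases "\<psi> x \<le> \<psi> y") auto
  then have "1-lipschitz_on UNIV \<psi>"
    by (intro lipschitz_onI) (auto simp: dist_real_def)
  then have "continuous_on UNIV \<psi>"
    by (rule lipschitz_on_continuous_on)
  then have meas: "\<psi> \<in> measurable lborel lborel"
    by (simp add: borel_measurable_continuous_onI)
  have vimage: "\<psi> -` A = \<theta> ` A" for A
    using \<psi>\<theta> \<theta>\<psi> by (auto simp: image_iff) metis
  define \<mu> where "\<mu> = distr lborel lborel \<psi>"
  have em: "emeasure \<mu> A = emeasure lborel (\<theta> ` A)" if "A \<in> sets borel" for A
    using that meas by (simp add: \<mu>_def emeasure_distr vimage)
  have "absolutely_continuous lborel \<mu>"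
    unfolding absolutely_continuous_def
  proof
    fix A :: "real set" assume A: "A \<in> null_sets lborel"
    then have "negligible A"
      using negligible_iff_null_sets null_sets_completionI by blast
    then have "negligible (\<theta> ` A)"
    proof (rule negligible_locally_Lipschitz_image[rotated])
      show "\<exists>T B. open T \<and> x \<in> T \<and> (\<forall>y\<in>A \<inter> T. norm (\<theta> y - \<theta> x) \<le> B * norm (y - x))" for x
        using lip by (intro exI[of _ UNIV] exI[of _ C]) auto
    qed simp
    moreover have "\<theta> ` A \<in> sets borel"
      using measurable_sets[OF meas, of A] A vimage by auto
    ultimately have "emeasure lborel (\<theta> ` A) = 0"
      using null_sets_completion_iff[of "\<theta> ` A" lborel]
      by (auto simp: negligible_iff_null_sets)
    then show "A \<in> null_sets \<mu>"
      using A em by (auto simp: null_sets_def \<mu>_def)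
  qed
  then obtain f where f: "f \<in> borel_measurable lborel" and dens: "density lborel f = \<mu>"
    using sigma_finite_measure.Radon_Nikodym[OF sigma_finite_lborel, of \<mu>] by (auto simp: \<mu>_def)
  have img: "\<theta> ` {a..b} = {\<theta> a..\<theta> b}" if "a \<le> b" for a b
  proof
    show "\<theta> ` {a..b} \<subseteq> {\<theta> a..\<theta> b}"
      using strict by (force simp: not_less[symmetric])
    show "{\<theta> a..\<theta> b} \<subseteq> \<theta> ` {a..b}"
    proof
      fix y assume "y \<in> {\<theta> a..\<theta> b}"
      then have "\<psi> y \<in> {a..b}"
        using strict[of "\<psi> y" a] strict[of b "\<psi> y"] \<theta>\<psi> by (auto simp: not_less[symmetric])
      then show "y \<in> \<theta> ` {a..b}" by (metis \<theta>\<psi> imageI)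
    qed
  qed
  have nn: "(\<integral>\<^sup>+x. f x * indicator {a..b} x \<partial>lborel) = ennreal (\<theta> b - \<theta> a)" if "a \<le> b" for a b
  proof -
    have "(\<integral>\<^sup>+x. f x * indicator {a..b} x \<partial>lborel) = emeasure \<mu> {a..b}"
      using f by (simp add: dens[symmetric] emeasure_density)
    also have "\<dots> = ennreal (\<theta> b - \<theta> a)"
      using that lo[OF that] by (simp add: em img)
    finally show ?thesis .
  qed
  define G where "G x = enn2real (f x)" for x
  have "(G has_integral (\<theta> b - \<theta> a)) {a..b}" if ab: "a \<le> b" for a b
  proof -
    have "AE x in lborel. f x * indicator {a..b} x \<noteq> \<infinity>"
      using f nn[OF ab] by (intro nn_integral_PInf_AE) auto
    then have "AE x in lborel. ennreal (G x * indicator {a..b} x) = f x * indicator {a..b} x"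
      by eventually_elim (auto simp: G_def indicator_def ennreal_enn2real_if)
    then have "(\<integral>\<^sup>+x. ennreal (G x * indicator {a..b} x) \<partial>lborel) = ennreal (\<theta> b - \<theta> a)"
      using nn[OF ab] by (simp cong: nn_integral_cong_AE)
    then have "has_bochner_integral lborel (\<lambda>x. G x * indicator {a..b} x) (\<theta> b - \<theta> a)"
      using f lo[OF ab] ab by (intro has_bochner_integral_nn_integral) (auto simp: G_def)
    then have "((\<lambda>x. G x * indicator {a..b} x) has_integral (\<theta> b - \<theta> a)) UNIV"
      using has_integral_integral_lborel[of "\<lambda>x. G x * indicator {a..b} x"]
      by (simp add: has_bochner_integral_iff)
    then have "((\<lambda>x. if x \<in> {a..b} then G x else 0) has_integral (\<theta> b - \<theta> a)) UNIV"
      by (rule has_integral_eq[rotated]) (auto simp: indicator_def)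
    then show ?thesis
      by (simp only: has_integral_restrict_UNIV)
  qed
  then show thesis using that by blast
qed

text \<open>Cubes with corner \<open>x\<close> are the right shape for later use: on the line they produce the difference
  quotients to the right of \<open>x\<close>.\<close>

lemma lebesgue_differentiation_cubes:
  fixes f :: "'a::euclidean_space \<Rightarrow> 'b::euclidean_space"
  assumes "\<And>a b. f integrable_on cbox a b"
  obtains N where "negligible N"
    "\<And>x. x \<notin> N \<Longrightarrow> ((\<lambda>h. integral (cbox x (x + h *\<^sub>R One)) f /\<^sub>R h ^ DIM('a)) \<longlongrightarrow> f x) (at_right 0)"
proof -
  have "\<exists>N. negligible N \<and> (\<forall>x e. x \<notin> N \<longrightarrow> 0 < e \<longrightarrow> (\<exists>d>0. \<forall>h. 0 < h \<and> h < d \<longrightarrow>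
      norm (integral (cbox x (x + h *\<^sub>R One)) f /\<^sub>R h ^ DIM('a) - f x) < e))"
    by (rule integrable_ccontinuous_explicit[OF assms]) blast
  then obtain N where N: "negligible N" and lim: "\<And>x e. x \<notin> N \<Longrightarrow> 0 < e \<Longrightarrow> \<exists>d>0. \<forall>h. 0 < h \<and> h < d \<longrightarrow>
      norm (integral (cbox x (x + h *\<^sub>R One)) f /\<^sub>R h ^ DIM('a) - f x) < e"
    by blast
  have "((\<lambda>h. integral (cbox x (x + h *\<^sub>R One)) f /\<^sub>R h ^ DIM('a)) \<longlongrightarrow> f x) (at_right 0)"
    if "x \<notin> N" for x
    unfolding tendsto_iff eventually_at_right_field dist_norm using lim[OF that] by blast
  then show thesis using that N by blast
qed

text \<open>The averages over \<open>[x, x + h]\<close> are the right difference quotients; the left ones are obtained by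
  applying the differentiation theorem to the reflected function \<open>G (- x)\<close>.\<close>

lemma indefinite_integral_real_differentiable_ae:
  fixes \<phi> :: "real \<Rightarrow> real" and G :: "real \<Rightarrow> real"
  assumes int: "\<And>a b. a \<le> b \<Longrightarrow> (G has_integral (\<phi> b - \<phi> a)) {a..b}"
  obtains N where "negligible N" "\<And>x. x \<notin> N \<Longrightarrow> (\<phi> has_real_derivative G x) (at x)"
proof -
  have "G integrable_on cbox a b" for a b
    using int[of a b] by (cases "a \<le> b") (auto simp: has_integral_integrable)
  then obtain N1 where N1: "negligible N1"
    "\<And>x. x \<notin> N1 \<Longrightarrow> ((\<lambda>h. integral (cbox x (x + h *\<^sub>R One)) G /\<^sub>R h ^ DIM(real)) \<longlongrightarrow> G x) (at_right 0)"
    using lebesgue_differentiation_cubes[of G thesis] by blast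
  have refl: "((\<lambda>x. G (- x)) has_integral (\<phi> (- a) - \<phi> (- b))) {a..b}" if "a \<le> b" for a b
  proof -
    have "((\<lambda>x. G (- x)) has_integral (\<phi> (- a) - \<phi> (- b))) {- (- a)..- (- b)}"
      unfolding has_integral_reflect_real using int[of "-b" "-a"] that by linarith
    then show ?thesis by (simp only: minus_minus)
  qed
  have "(\<lambda>x. G (- x)) integrable_on cbox a b" for a b
  proof (cases "a \<le> b")
    case True then show ?thesis using refl[of a b] by (auto simp: has_integral_integrable)
  qed auto
  then obtain N2 where N2: "negligible N2"
    "\<And>x. x \<notin> N2 \<Longrightarrow> ((\<lambda>h. integral (cbox x (x + h *\<^sub>R One)) (\<lambda>x. G (-x)) /\<^sub>R h ^ DIM(real))
       \<longlongrightarrow> G (-x)) (at_right 0)"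
    using lebesgue_differentiation_cubes[of "\<lambda>x. G (-x)" thesis] by blast
  show thesis
  proof
    have "negligible (uminus ` N2)"
      by (rule negligible_differentiable_image_negligible)
        (auto simp: N2(1) intro!: derivative_intros differentiable_on_minus)
    then show "negligible (N1 \<union> uminus ` N2)"
      using N1(1) by simp
  next
    fix x assume x: "x \<notin> N1 \<union> uminus ` N2"
    then have x1: "x \<notin> N1" and "x \<notin> uminus ` N2" by auto
    then have x2: "- x \<notin> N2" by (metis add.inverse_inverse imageI)
    have pos: "eventually (\<lambda>h::real. 0 < h) (at_right 0)"
      by (simp add: eventually_at_right_less)
    have "((\<lambda>h. (\<phi> (x + h) - \<phi> x) / h) \<longlongrightarrow> G x) (at_right 0)"
    proof (rule Lim_transform_eventually[OF N1(2)[OF x1]])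
      show "\<forall>\<^sub>F h in at_right 0. integral (cbox x (x + h *\<^sub>R One)) G /\<^sub>R h ^ DIM(real) = (\<phi> (x + h) - \<phi> x) / h"
        using pos
      proof eventually_elim
        case (elim h)
        then have "integral (cbox x (x + h)) G = \<phi> (x + h) - \<phi> x"
          using int[of x "x + h"] by (simp add: integral_unique)
        then show ?case by (simp add: divide_inverse_commute)
      qed
    qed
    moreover have "((\<lambda>h. (\<phi> (x + h) - \<phi> x) / h) \<longlongrightarrow> G x) (at_left 0)"
      unfolding filterlim_at_left_to_right minus_zero
    proof (rule Lim_transform_eventually)
      show "((\<lambda>h. integral (cbox (-x) (-x + h *\<^sub>R One)) (\<lambda>x. G (-x)) /\<^sub>R h ^ DIM(real)) \<longlongrightarrow> G x) (at_right 0)"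
        using N2(2)[OF x2] by simp
      show "\<forall>\<^sub>F h in at_right 0. integral (cbox (-x) (-x + h *\<^sub>R One)) (\<lambda>x. G (-x)) /\<^sub>R h ^ DIM(real)
          = (\<phi> (x + (- h)) - \<phi> x) / (- h)"
        using pos
      proof eventually_elim
        case (elim h)
        then have "integral (cbox (-x) (-x + h)) (\<lambda>x. G (-x)) = \<phi> x - \<phi> (x - h)"
          using refl[of "-x" "-x + h"] by (simp add: integral_unique)
        then show ?case using elim by (simp add: field_simps)
      qed
    qed
    ultimately show "(\<phi> has_real_derivative G x) (at x)"
      unfolding DERIV_def by (simp add: filterlim_at_split)
  qed
qed

text \<open>Adding a linear function whose slope exceeds the Lipschitz constant turns \<open>\<phi>\<close> into a strictly
  expanding function, which is the integral of its density; the linear function is then subtracted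
  again.\<close>

lemma lipschitz_real_ftc:
  fixes \<phi> :: "real \<Rightarrow> real"
  assumes L: "L-lipschitz_on UNIV \<phi>"
  obtains G :: "real \<Rightarrow> real" and N where "negligible N" "\<And>x. x \<notin> N \<Longrightarrow> (\<phi> has_real_derivative G x) (at x)"
    "\<And>a b. a \<le> b \<Longrightarrow> (G has_integral (\<phi> b - \<phi> a)) {a..b}"
proof -
  define \<theta> where "\<theta> x = \<phi> x + (L + 1) * x" for x
  have b: "\<bar>\<phi> y - \<phi> x\<bar> \<le> L * (y - x)" if "x \<le> y" for x y
    using lipschitz_onD[OF L, of y x] that by (simp add: dist_real_def)
  have lo: "y - x \<le> \<theta> y - \<theta> x" if "x \<le> y" for x y
      using b[OF that] by (simp add: \<theta>_def algebra_simps)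
  have hi: "\<theta> y - \<theta> x \<le> (2 * L + 1) * (y - x)" if "x \<le> y" for x y
      using b[OF that] by (simp add: \<theta>_def algebra_simps)
  obtain G0 :: "real \<Rightarrow> real" where G0: "\<And>a b. a \<le> b \<Longrightarrow> (G0 has_integral (\<theta> b - \<theta> a)) {a..b}"
    using strictly_expanding_lipschitz_density[OF lo hi] by blast
  define G where "G x = G0 x - (L + 1)" for x
  have G: "(G has_integral (\<phi> b - \<phi> a)) {a..b}" if "a \<le> b" for a b
    using has_integral_diff[OF G0[OF that] has_integral_const_real[of "L+1" a b]] that
    by (simp add: G_def[abs_def] \<theta>_def algebra_simps)
  then obtain N where "negligible N" "\<And>x. x \<notin> N \<Longrightarrow> (\<phi> has_real_derivative G x) (at x)"
    using indefinite_integral_real_differentiable_ae[of G \<phi>] by metis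
  then show thesis using that G by blast
qed

section \<open>Rademacher's theorem\<close>

lemma borel_negligible_iff:
  "N \<in> sets borel \<Longrightarrow> negligible N \<longleftrightarrow> emeasure lborel N = 0"
  using null_sets_completion_iff[of N lborel] by (auto simp: negligible_iff_null_sets null_sets_def)

text \<open>Fubini's theorem in the form needed for lines of an arbitrary direction \<open>s\<close>. In the product of the
  space with the real line consider the pairs \<open>(x, \<sigma>)\<close> with \<open>x + \<sigma> s \<in> N\<close>. By translation invariance
  every section at fixed \<open>\<sigma>\<close> has the measure of \<open>N\<close>, so that \<open>N\<close> is null exactly if almost every
  section at fixed \<open>x\<close> is null.\<close>

lemma negligible_iff_parallel_lines:
  fixes N :: "'a::euclidean_space set"
  assumes [measurable]: "N \<in> sets borel"
  shows "negligible N \<longleftrightarrow> (AE x in lborel. negligible {\<sigma>::real. x + \<sigma> *\<^sub>R s \<in> N})"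
proof -
  have [measurable]: "{\<sigma>::real. x + \<sigma> *\<^sub>R s \<in> N} \<in> sets borel" for x
    by measurable
  have [measurable]: "{x. x + \<sigma> *\<^sub>R s \<in> N} \<in> sets borel" for \<sigma> :: real
    by measurable
  have shift: "emeasure lborel {x. x + \<sigma> *\<^sub>R s \<in> N} = emeasure lborel N" for \<sigma> :: real
  proof -
    have "emeasure lborel N = emeasure (distr lborel borel ((+) (\<sigma> *\<^sub>R s))) N"
      by (simp add: lborel_distr_plus)
    also have "\<dots> = emeasure lborel {x. x + \<sigma> *\<^sub>R s \<in> N}"
      by (subst emeasure_distr) (auto simp: vimage_def add.commute)
    finally show ?thesis by simp
  qed
  define J where "J x \<sigma> = (indicator N (x + \<sigma> *\<^sub>R s) :: ennreal)" for x and \<sigma> :: real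
  have Jm [measurable]: "case_prod J \<in> borel_measurable (lborel \<Otimes>\<^sub>M lborel)"
    unfolding J_def by measurable
  have Jx: "(\<integral>\<^sup>+\<sigma>. J x \<sigma> \<partial>lborel) = emeasure lborel {\<sigma>::real. x + \<sigma> *\<^sub>R s \<in> N}" for x
  proof -
    have "(\<lambda>\<sigma>. J x \<sigma>) = indicator {\<sigma>::real. x + \<sigma> *\<^sub>R s \<in> N}"
      by (auto simp: J_def indicator_def)
    then show ?thesis by simp
  qed
  have Js: "(\<integral>\<^sup>+x. J x \<sigma> \<partial>lborel) = emeasure lborel N" for \<sigma>
  proof -
    have "(\<lambda>x. J x \<sigma>) = indicator {x. x + \<sigma> *\<^sub>R s \<in> N}"
      by (auto simp: J_def indicator_def)
    then show ?thesis by (simp add: shift)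
  qed
  have "(\<integral>\<^sup>+x. (\<integral>\<^sup>+\<sigma>. J x \<sigma> \<partial>lborel) \<partial>lborel) = (\<integral>\<^sup>+\<sigma>. emeasure lborel N \<partial>(lborel :: real measure))"
    using lborel_pair.Fubini'[OF Jm] by (simp add: Js)
  then have "emeasure lborel N = 0 \<longleftrightarrow> (\<integral>\<^sup>+x. (\<integral>\<^sup>+\<sigma>. J x \<sigma> \<partial>lborel) \<partial>lborel) = 0"
    by (simp add: ennreal_mult_eq_top_iff)
  also have "\<dots> \<longleftrightarrow> (AE x in lborel. (\<integral>\<^sup>+\<sigma>. J x \<sigma> \<partial>lborel) = 0)"
    by (rule nn_integral_0_iff_AE) measurable
  finally show ?thesis
    by (simp add: borel_negligible_iff Jx)
qed

text \<open>By the Cauchy criterion the limit exists iff for every \<open>n\<close> there is an \<open>m\<close> such that any two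
  quotients with increments below \<open>1 / (m + 1)\<close> differ by at most \<open>1 / (n + 1)\<close>. For fixed \<open>n\<close> and
  \<open>m\<close> this is an intersection, over all increments, of closed conditions on \<open>x\<close>, hence closed.\<close>

lemma borel_directional_differentiability:
  fixes h :: "'a::euclidean_space \<Rightarrow> real"
  assumes "continuous_on UNIV h"
  shows "{x. \<exists>l. ((\<lambda>\<tau>. (h (x + \<tau> *\<^sub>R s) - h x) / \<tau>) \<longlongrightarrow> l) (at 0)} \<in> sets borel"
proof -
  define q where "q \<tau> x = (h (x + \<tau> *\<^sub>R s) - h x) / \<tau>" for \<tau> x
  define C where "C n m = {x. \<forall>\<tau> \<tau>'. 0 < \<bar>\<tau>\<bar> \<longrightarrow> \<bar>\<tau>\<bar> < 1 / real (Suc m) \<longrightarrow> 0 < \<bar>\<tau>'\<bar> \<longrightarrow>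
     \<bar>\<tau>'\<bar> < 1 / real (Suc m) \<longrightarrow> \<bar>q \<tau> x - q \<tau>' x\<bar> \<le> 1 / real (Suc n)}" for n m :: nat
  have qc: "continuous_on UNIV (q \<tau>)" if "\<tau> \<noteq> 0" for \<tau>
    unfolding q_def[abs_def] using assms that
    by (auto intro!: continuous_intros continuous_on_compose2[OF assms])
  have closed: "closed (C n m)" for n m
  proof -
    have "C n m = (\<Inter>\<tau>\<in>{\<tau>. 0 < \<bar>\<tau>\<bar> \<and> \<bar>\<tau>\<bar> < 1 / real (Suc m)}.
       \<Inter>\<tau>'\<in>{\<tau>. 0 < \<bar>\<tau>\<bar> \<and> \<bar>\<tau>\<bar> < 1 / real (Suc m)}. {x. \<bar>q \<tau> x - q \<tau>' x\<bar> \<le> 1 / real (Suc n)})"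
      by (auto simp: C_def)
    also have "closed \<dots>"
      by (intro closed_INT ballI closed_Collect_le continuous_intros qc) auto
    finally show ?thesis .
  qed
  have "{x. \<exists>l. ((\<lambda>\<tau>. q \<tau> x) \<longlongrightarrow> l) (at 0)} = (\<Inter>n. \<Union>m. C n m)"
  proof (intro equalityI subsetI)
    fix x assume "x \<in> {x. \<exists>l. ((\<lambda>\<tau>. q \<tau> x) \<longlongrightarrow> l) (at 0)}"
    then obtain l where l: "((\<lambda>\<tau>. q \<tau> x) \<longlongrightarrow> l) (at 0)" by auto
    have "\<exists>m. x \<in> C n m" for n
    proof -
      define e where "e = 1 / real (Suc n)"
      have "0 < e / 2" by (simp add: e_def)
      then obtain d where d: "d > 0" "\<And>\<tau>. \<tau> \<noteq> 0 \<Longrightarrow> \<bar>\<tau>\<bar> < d \<Longrightarrow> \<bar>q \<tau> x - l\<bar> < e / 2"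
        using l unfolding LIM_eq by (metis diff_zero real_norm_def)
      obtain m where m: "1 / real (Suc m) < d"
        using d(1) nat_approx_posE by blast
      have "\<bar>q \<tau> x - q \<tau>' x\<bar> \<le> 1 / real (Suc n)"
        if "0 < \<bar>\<tau>\<bar>" "\<bar>\<tau>\<bar> < 1 / real (Suc m)" "0 < \<bar>\<tau>'\<bar>" "\<bar>\<tau>'\<bar> < 1 / real (Suc m)" for \<tau> \<tau>'
      proof -
        have "\<bar>q \<tau> x - l\<bar> < e / 2" "\<bar>q \<tau>' x - l\<bar> < e / 2"
          using d(2) m that by auto
        then show ?thesis unfolding e_def[symmetric] by linarith
      qed
      then show ?thesis by (auto simp: C_def)
    qed
    then show "x \<in> (\<Inter>n. \<Union>m. C n m)" by auto
  next
    fix x assume x: "x \<in> (\<Inter>n. \<Union>m. C n m)"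
    have "\<exists>m. x \<in> C n m" for n using x by auto
    then obtain m where m: "\<And>n. x \<in> C n (m n)" by metis
    have near: "\<bar>q \<tau> x - q \<tau>' x\<bar> \<le> 1 / real (Suc n)"
      if "0 < \<bar>\<tau>\<bar>" "\<bar>\<tau>\<bar> < 1 / real (Suc (m n))" "0 < \<bar>\<tau>'\<bar>" "\<bar>\<tau>'\<bar> < 1 / real (Suc (m n))" for \<tau> \<tau>' n
      using m[of n] that by (auto simp: C_def)
    define t where "t k = 1 / real (Suc (Suc k))" for k
    have t: "0 < \<bar>t k\<bar>" "k \<ge> j \<Longrightarrow> \<bar>t k\<bar> < 1 / real (Suc j)" for j k
      by (auto simp: t_def field_simps)
    have "Cauchy (\<lambda>k. q (t k) x)"
      unfolding Cauchy_altdef2 dist_real_def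
    proof (intro allI impI)
      fix e :: real assume "e > 0"
      then obtain n where n: "1 / real (Suc n) < e" using nat_approx_posE by blast
      show "\<exists>N. \<forall>k\<ge>N. \<bar>q (t k) x - q (t N) x\<bar> < e"
      proof (intro exI[of _ "m n"] allI impI)
        fix k assume "m n \<le> k"
        then have "\<bar>q (t k) x - q (t (m n)) x\<bar> \<le> 1 / real (Suc n)"
          by (intro near t) auto
        then show "\<bar>q (t k) x - q (t (m n)) x\<bar> < e" using n by linarith
      qed
    qed
    then obtain l where l: "(\<lambda>k. q (t k) x) \<longlonglongrightarrow> l"
      using Cauchy_convergent convergent_def by blast
    have "((\<lambda>\<tau>. q \<tau> x) \<longlongrightarrow> l) (at 0)"
      unfolding LIM_eq
    proof (intro allI impI)
      fix e :: real assume "e > 0"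
      then obtain n where n: "1 / real (Suc n) < e" using nat_approx_posE by blast
      show "\<exists>s>0. \<forall>\<tau>. \<tau> \<noteq> 0 \<and> norm (\<tau> - 0) < s \<longrightarrow> norm (q \<tau> x - l) < e"
      proof (intro exI[of _ "1 / real (Suc (m n))"] conjI allI impI)
        fix \<tau> :: real assume \<tau>: "\<tau> \<noteq> 0 \<and> norm (\<tau> - 0) < 1 / real (Suc (m n))"
        have "(\<lambda>k. \<bar>q \<tau> x - q (t k) x\<bar>) \<longlonglongrightarrow> \<bar>q \<tau> x - l\<bar>"
          by (intro tendsto_intros l)
        moreover have "\<forall>\<^sub>F k in sequentially. \<bar>q \<tau> x - q (t k) x\<bar> \<le> 1 / real (Suc n)"
          using \<tau> t by (intro eventually_sequentiallyI[of "m n"] near) auto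
        ultimately have "\<bar>q \<tau> x - l\<bar> \<le> 1 / real (Suc n)"
          using tendsto_upperbound by fastforce
        then show "norm (q \<tau> x - l) < e" using n by simp
      qed auto
    qed
    then show "x \<in> {x. \<exists>l. ((\<lambda>\<tau>. q \<tau> x) \<longlongrightarrow> l) (at 0)}" by auto
  qed
  moreover have "(\<Inter>n. \<Union>m. C n m) \<in> sets borel"
    using closed by (intro sets.countable_INT' sets.countable_UN') auto
  ultimately show ?thesis by (simp add: q_def)
qed

text \<open>Along each line of direction \<open>s\<close> the function is a Lipschitz function of one variable and so is
  differentiable almost everywhere; Fubini's theorem collects the exceptional points of all lines.\<close>

lemma lipschitz_directionally_differentiable_ae:
  fixes h :: "'a::euclidean_space \<Rightarrow> real"
  assumes L: "L-lipschitz_on UNIV h"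
  shows "AE x in lborel. \<exists>l. ((\<lambda>\<tau>. (h (x + \<tau> *\<^sub>R s) - h x) / \<tau>) \<longlongrightarrow> l) (at 0)"
proof -
  define E where "E = {x. \<exists>l. ((\<lambda>\<tau>. (h (x + \<tau> *\<^sub>R s) - h x) / \<tau>) \<longlongrightarrow> l) (at 0)}"
  have E: "- E \<in> sets borel"
    using borel_directional_differentiability[OF lipschitz_on_continuous_on[OF L], of s]
    unfolding E_def by (rule borel_comp)
  have "negligible {\<sigma>::real. x + \<sigma> *\<^sub>R s \<in> - E}" for x
  proof -
    have "(L * norm s)-lipschitz_on UNIV (\<lambda>\<sigma>::real. h (x + \<sigma> *\<^sub>R s))"
    proof (rule lipschitz_onI)
      fix \<sigma> \<sigma>' :: real
      have "dist (h (x + \<sigma> *\<^sub>R s)) (h (x + \<sigma>' *\<^sub>R s)) \<le> L * dist (x + \<sigma> *\<^sub>R s) (x + \<sigma>' *\<^sub>R s)"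
        by (rule lipschitz_onD[OF L]) auto
      also have "dist (x + \<sigma> *\<^sub>R s) (x + \<sigma>' *\<^sub>R s) = norm s * dist \<sigma> \<sigma>'"
        by (simp add: dist_norm flip: scaleR_diff_left)
      finally show "dist (h (x + \<sigma> *\<^sub>R s)) (h (x + \<sigma>' *\<^sub>R s)) \<le> L * norm s * dist \<sigma> \<sigma>'"
        by (simp add: mult.assoc)
    qed (use lipschitz_on_nonneg[OF L] in auto)
    then obtain G N where N: "negligible N"
      "\<And>\<sigma>. \<sigma> \<notin> N \<Longrightarrow> ((\<lambda>\<sigma>. h (x + \<sigma> *\<^sub>R s)) has_real_derivative G \<sigma>) (at \<sigma>)"
      by (rule lipschitz_real_ftc) blast
    have "{\<sigma>. x + \<sigma> *\<^sub>R s \<in> - E} \<subseteq> N"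
      using N(2) by (auto simp: E_def DERIV_def algebra_simps)
    then show ?thesis using N(1) negligible_subset by blast
  qed
  then have "negligible (- E)"
    using negligible_iff_parallel_lines[OF E, of s] by simp
  then have "- E \<in> null_sets lborel"
    using E by (simp add: borel_negligible_iff null_sets_def)
  then show ?thesis
    by (rule AE_I') (auto simp: E_def)
qed

lemma zero_ae_if_box_integrals_zero:
  fixes f :: "'a::euclidean_space \<Rightarrow> real"
  assumes "\<And>a b. (f has_integral 0) (cbox a b)"
  shows "negligible {x. f x \<noteq> 0}"
proof -
  have "f integrable_on cbox a b" for a b
    using assms by blast
  then obtain N where N: "negligible N"
    "\<And>x. x \<notin> N \<Longrightarrow> ((\<lambda>h. integral (cbox x (x + h *\<^sub>R One)) f /\<^sub>R h ^ DIM('a)) \<longlongrightarrow> f x) (at_right 0)"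
    by (rule lebesgue_differentiation_cubes) blast
  have "f x = 0" if "x \<notin> N" for x
    using N(2)[OF that] by (simp add: integral_unique[OF assms] tendsto_const_iff)
  then have "{x. f x \<noteq> 0} \<subseteq> N" by auto
  then show ?thesis
    using N(1) by (rule negligible_subset[rotated])
qed

text \<open>Write the quotient in direction \<open>s + s'\<close> at \<open>x\<close> as the quotient in direction \<open>s\<close> at \<open>x\<close> plus the
  quotient in direction \<open>s'\<close> at the shifted point \<open>x + \<tau> s\<close>. Integrated over a box, the shift only
  moves the box, and dominated convergence shows that it has no effect in the limit. So both sides
  have the same integral over every box, and hence agree almost everywhere.\<close>

lemma directional_derivative_additive_ae:
  fixes h :: "'a::euclidean_space \<Rightarrow> real"
  assumes L: "L-lipschitz_on UNIV h"
  shows "AE x in lborel. \<forall>l l' l''.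
     ((\<lambda>\<tau>. (h (x + \<tau> *\<^sub>R s) - h x) / \<tau>) \<longlongrightarrow> l) (at 0) \<longrightarrow>
     ((\<lambda>\<tau>. (h (x + \<tau> *\<^sub>R s') - h x) / \<tau>) \<longlongrightarrow> l') (at 0) \<longrightarrow>
     ((\<lambda>\<tau>. (h (x + \<tau> *\<^sub>R (s + s')) - h x) / \<tau>) \<longlongrightarrow> l'') (at 0) \<longrightarrow> l'' = l + l'"
proof -
  define \<tau> where "\<tau> k = 1 / real (Suc k)" for k
  define q where "q s k x = (h (x + \<tau> k *\<^sub>R s) - h x) / \<tau> k" for s k x
  define D where "D s x = lim (\<lambda>k. q s k x)" for s x
  have \<tau>: "0 < \<tau> k" "\<tau> k \<le> 1" for k by (auto simp: \<tau>_def)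
  have \<tau>0: "\<tau> \<longlonglongrightarrow> 0"
    unfolding \<tau>_def using LIMSEQ_inverse_real_of_nat by (simp add: divide_inverse)
  have \<tau>at0: "filterlim \<tau> (at 0) sequentially"
    using \<tau>0 by (intro filterlim_atI) (auto simp: \<tau>_def)
  have [simp]: "0 \<le> L * norm s" for s :: 'a
    using lipschitz_on_nonneg[OF L] by simp
  have hc: "continuous_on UNIV h" using L by (rule lipschitz_on_continuous_on)
  have [measurable]: "h \<in> borel_measurable borel"
    using hc by (rule borel_measurable_continuous_onI)
  have q_le: "\<bar>q s k x\<bar> \<le> L * norm s" for s k x
  proof -
    have "\<bar>h (x + \<tau> k *\<^sub>R s) - h x\<bar> \<le> L * (\<tau> k * norm s)"
      using lipschitz_onD[OF L, of "x + \<tau> k *\<^sub>R s" x] \<tau>(1)[of k] by (simp add: dist_norm)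
    then show ?thesis using \<tau>(1)[of k] by (simp add: q_def field_simps)
  qed
  have [measurable]: "q s k \<in> borel_measurable borel" for s k
    unfolding q_def by measurable
  have [measurable]: "D s \<in> borel_measurable borel" for s
    unfolding D_def by measurable
  have q_D: "(\<lambda>k. q s k x) \<longlonglongrightarrow> l \<and> D s x = l"
    if "((\<lambda>\<tau>. (h (x + \<tau> *\<^sub>R s) - h x) / \<tau>) \<longlongrightarrow> l) (at 0)" for s x l
    using filterlim_compose[OF that \<tau>at0] by (auto simp: D_def q_def limI)
  have q_ae: "AE x in lborel. (\<lambda>k. q s k x) \<longlonglongrightarrow> D s x" for s
    using lipschitz_directionally_differentiable_ae[OF L, of s] q_D by (auto elim!: eventually_mono)
  have D_le: "AE x in lborel. \<bar>D s x\<bar> \<le> L * norm s" for s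
    using q_ae[of s]
  proof eventually_elim
    case (elim x)
    then have "(\<lambda>k. \<bar>q s k x\<bar>) \<longlonglongrightarrow> \<bar>D s x\<bar>" by (rule tendsto_rabs)
    then show ?case by (rule LIMSEQ_le_const2) (use q_le in auto)
  qed
  have box: "(\<integral>x. indicator (cbox a b) x * D (s + s') x \<partial>lborel)
      = (\<integral>x. indicator (cbox a b) x * D s x \<partial>lborel) + (\<integral>x. indicator (cbox a b) x * D s' x \<partial>lborel)"
    for a b :: 'a
  proof -
    define A where "A = cbox a b"
    obtain R where R: "\<And>x. x \<in> A \<Longrightarrow> norm x \<le> R"
      using bounded_cbox[of a b] unfolding A_def bounded_iff by blast
    define W where "W = cball (0::'a) (R + norm s)"
    have [measurable]: "A \<in> sets borel" "W \<in> sets borel" by (auto simp: A_def W_def)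
    have W: "x \<in> W" if "x - \<tau> k *\<^sub>R s \<in> A" for x k
    proof -
      have "norm x \<le> norm (x - \<tau> k *\<^sub>R s) + norm (\<tau> k *\<^sub>R s)"
        by (metis add.commute norm_triangle_sub)
      also have "\<dots> \<le> R + norm s"
        using R[OF that] \<tau>[of k] by (intro add_mono) (auto intro!: mult_left_le_one_le)
      finally show ?thesis by (simp add: W_def)
    qed
    have AW: "A \<subseteq> W"
      using R by (force simp: W_def intro: add_increasing2)
    have intW: "integrable lborel (\<lambda>x. c * indicator W x :: real)" for c
      unfolding W_def by (intro integrable_mult_right integrable_real_indicator) (use emeasure_bounded_finite[OF bounded_cball] in auto)
    have conv: "(\<lambda>k. \<integral>x. indicator A x * q s k x \<partial>lborel) \<longlonglongrightarrow> (\<integral>x. indicator A x * D s x \<partial>lborel)" for s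
    proof (rule integral_dominated_convergence[where w = "\<lambda>x. (L * norm s) * indicator W x"])
      show "AE x in lborel. (\<lambda>k. indicator A x * q s k x) \<longlonglongrightarrow> indicator A x * D s x"
        using q_ae[of s] by eventually_elim (intro tendsto_intros)
      show "AE x in lborel. norm (indicator A x * q s k x) \<le> L * norm s * indicator W x" for k
        using q_le AW by (auto simp: indicator_def)
    qed (use intW in auto)
    \<comment> \<open>the indicator of the shifted box converges off the frontier of the box, which is negligible\<close>
    have ae_bd: "AE x in lborel. x \<notin> frontier A"
    proof -
      have "negligible (frontier A)" unfolding A_def by (intro negligible_convex_frontier) simp
      then have "frontier A \<in> null_sets lborel"
        using borel_negligible_iff[of "frontier A"] by (auto simp: null_sets_def)
      then show ?thesis by (rule AE_not_in)
    qed
    have shifted: "(\<lambda>k. \<integral>x. indicator A x * q s' k (x + \<tau> k *\<^sub>R s) \<partial>lborel)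
        \<longlonglongrightarrow> (\<integral>x. indicator A x * D s' x \<partial>lborel)"
    proof -
      have "(\<integral>x. indicator A x * q s' k (x + \<tau> k *\<^sub>R s) \<partial>lborel)
          = (\<integral>x. indicator A (x - \<tau> k *\<^sub>R s) * q s' k x \<partial>lborel)" for k
      proof -
        have "(\<integral>x. indicator A (x - \<tau> k *\<^sub>R s) * q s' k x \<partial>lborel)
          = (\<integral>x. indicator A (x - \<tau> k *\<^sub>R s) * q s' k x \<partial>(distr lborel borel ((+) (\<tau> k *\<^sub>R s))))"
          by (simp add: lborel_distr_plus)
        also have "\<dots> = (\<integral>x. indicator A x * q s' k (x + \<tau> k *\<^sub>R s) \<partial>lborel)"
          by (subst integral_distr) (auto simp: add.commute)
        finally show ?thesis by simp
      qed
      moreover have "(\<lambda>k. \<integral>x. indicator A (x - \<tau> k *\<^sub>R s) * q s' k x \<partial>lborel)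
        \<longlonglongrightarrow> (\<integral>x. indicator A x * D s' x \<partial>lborel)"
      proof (rule integral_dominated_convergence[where w = "\<lambda>x. (L * norm s') * indicator W x"])
        show "AE x in lborel. (\<lambda>k. indicator A (x - \<tau> k *\<^sub>R s) * q s' k x) \<longlonglongrightarrow> indicator A x * D s' x"
          using q_ae[of s'] ae_bd
        proof eventually_elim
          case (elim x)
          have lim: "(\<lambda>k. x - \<tau> k *\<^sub>R s) \<longlonglongrightarrow> x"
            using tendsto_diff[OF tendsto_const[of x] tendsto_scaleR[OF \<tau>0 tendsto_const[of s]]] by simp
          have "\<forall>\<^sub>F k in sequentially. indicator A (x - \<tau> k *\<^sub>R s) = (indicator A x :: real)"
          proof (cases "x \<in> A")
            case True
            then have "x \<in> interior A" using elim(2) closure_subset[of A] by (auto simp: frontier_def)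
            then have "\<forall>\<^sub>F k in sequentially. x - \<tau> k *\<^sub>R s \<in> interior A"
              using lim by (intro topological_tendstoD) auto
            then show ?thesis
              by eventually_elim (use True interior_subset in \<open>auto simp: indicator_def\<close>)
          next
            case False
            then have "\<forall>\<^sub>F k in sequentially. x - \<tau> k *\<^sub>R s \<in> - A"
              using lim by (intro topological_tendstoD) (auto simp: A_def open_Compl)
            then show ?thesis
              by eventually_elim (use False in \<open>auto simp: indicator_def\<close>)
          qed
          then have "(\<lambda>k. indicator A (x - \<tau> k *\<^sub>R s)) \<longlonglongrightarrow> (indicator A x :: real)"
            by (rule tendsto_eventually)
          then show ?case using elim(1) by (rule tendsto_mult)
        qed
        show "AE x in lborel. norm (indicator A (x - \<tau> k *\<^sub>R s) * q s' k x) \<le> L * norm s' * indicator W x" for k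
          using q_le W by (auto simp: indicator_def)
      qed (use intW in auto)
      ultimately show ?thesis by simp
    qed
    have split: "(\<integral>x. indicator A x * q (s + s') k x \<partial>lborel)
        = (\<integral>x. indicator A x * q s k x \<partial>lborel) + (\<integral>x. indicator A x * q s' k (x + \<tau> k *\<^sub>R s) \<partial>lborel)" for k
    proof -
      have "integrable lborel (\<lambda>x. indicator A x * q s k x)"
        by (rule Bochner_Integration.integrable_bound[OF intW[of "L * norm s"]])
          (use q_le AW in \<open>auto simp: indicator_def intro!: order_trans[OF _ abs_ge_self]\<close>)
      moreover have "integrable lborel (\<lambda>x. indicator A x * q s' k (x + \<tau> k *\<^sub>R s))"
        by (rule Bochner_Integration.integrable_bound[OF intW[of "L * norm s'"]])
          (use q_le AW in \<open>auto simp: indicator_def intro!: order_trans[OF _ abs_ge_self]\<close>)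
      moreover have "q (s + s') k x = q s k x + q s' k (x + \<tau> k *\<^sub>R s)" for x
        by (simp add: q_def scaleR_add_right add.assoc add_divide_distrib[symmetric])
      ultimately show ?thesis by (simp add: distrib_left)
    qed
    show ?thesis
      using LIMSEQ_unique[OF conv[of "s + s'", unfolded split] tendsto_add[OF conv[of s] shifted]]
      by (simp add: A_def)
  qed
  define f where "f x = D (s + s') x - D s x - D s' x" for x
  have "(f has_integral 0) (cbox a b)" for a b
  proof -
    have int: "integrable lborel (\<lambda>x. indicator (cbox a b) x * D s x)" for s
    proof (rule Bochner_Integration.integrable_bound)
      show "integrable lborel (\<lambda>x. (L * norm s) * indicator (cbox a b) x :: real)"
        by (intro integrable_mult_right integrable_real_indicator) (auto simp: emeasure_lborel_cbox_eq)
      show "AE x in lborel. norm (indicator (cbox a b) x * D s x) \<le> norm (L * norm s * indicator (cbox a b) x)"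
        using D_le[of s] by eventually_elim (auto simp: indicator_def)
    qed auto
    have ind: "indicator (cbox a b) x * f x = indicator (cbox a b) x * D (s + s') x
        - indicator (cbox a b) x * D s x - indicator (cbox a b) x * D s' x" for x
      by (simp add: f_def algebra_simps)
    have "integrable lborel (\<lambda>x. indicator (cbox a b) x * f x)"
      unfolding ind using int by auto
    moreover have "(\<integral>x. indicator (cbox a b) x * f x \<partial>lborel) = 0"
      unfolding ind using int box[of a b] by simp
    ultimately have "((\<lambda>x. indicator (cbox a b) x * f x) has_integral 0) UNIV"
      using has_integral_integral_lborel[of "\<lambda>x. indicator (cbox a b) x * f x"] by simp
    then have "((\<lambda>x. if x \<in> cbox a b then f x else 0) has_integral 0) UNIV"
      by (rule has_integral_eq[rotated]) (auto simp: indicator_def)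
    then show ?thesis by (simp only: has_integral_restrict_UNIV)
  qed
  then have "negligible {x. f x \<noteq> 0}"
    by (rule zero_ae_if_box_integrals_zero)
  moreover have "{x. f x \<noteq> 0} \<in> sets borel"
    unfolding f_def by measurable
  ultimately have "{x. f x \<noteq> 0} \<in> null_sets lborel"
    using borel_negligible_iff by (auto simp: null_sets_def)
  then have "AE x in lborel. f x = 0"
    by (rule AE_I') auto
  then show ?thesis
  proof eventually_elim
    case (elim x)
    then show ?case using q_D by (fastforce simp: f_def)
  qed
qed

text \<open>Finitely many directions of the dense set \<open>Q\<close> approximate all unit vectors; the difference quotients
  converge uniformly on them, and the Lipschitz bound transfers this to all directions.\<close>

lemma lipschitz_differentiable_if_directional:
  fixes h :: "'a::euclidean_space \<Rightarrow> real"
  assumes L: "L-lipschitz_on UNIV h" and \<Lambda>: "linear \<Lambda>"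
    and Q: "\<And>U. open U \<Longrightarrow> U \<noteq> {} \<Longrightarrow> \<exists>s\<in>Q. s \<in> U"
    and dir: "\<And>s. s \<in> Q \<Longrightarrow> ((\<lambda>\<tau>. (h (x + \<tau> *\<^sub>R s) - h x) / \<tau>) \<longlongrightarrow> \<Lambda> s) (at 0)"
  shows "(h has_derivative \<Lambda>) (at x)"
proof -
  obtain C where C: "C > 0" "\<And>s. \<bar>\<Lambda> s\<bar> \<le> C * norm s"
    using linear_bounded_pos[OF \<Lambda>] by (auto simp: mult.commute)
  have L0: "0 \<le> L" using L by (rule lipschitz_on_nonneg)
  show ?thesis
    unfolding has_derivative_at_alt
  proof (intro conjI allI impI)
    show "bounded_linear \<Lambda>" using \<Lambda> by (simp add: linear_conv_bounded_linear)
    fix e :: real assume "e > 0"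
    \<comment> \<open>replacing a unit vector by one at distance \<open>d\<close> changes quotient and derivative by at most \<open>(L + C) d = e / 2\<close>\<close>
    define d where "d = e / (2 * (L + C))"
    have "d > 0" using \<open>e > 0\<close> C L0 by (simp add: d_def)
    have "sphere 0 1 \<subseteq> (\<Union>s\<in>Q. ball s d)"
    proof
      fix z :: 'a
      obtain s where "s \<in> Q" "s \<in> ball z d" using Q[of "ball z d"] \<open>d > 0\<close> by auto
      then show "z \<in> (\<Union>s\<in>Q. ball s d)" by (auto simp: dist_commute)
    qed
    then obtain T where T: "T \<subseteq> Q" "finite T" "sphere 0 1 \<subseteq> (\<Union>s\<in>T. ball s d)"
      using compactE_image[OF compact_sphere, of Q "\<lambda>s. ball s d" 0 1] by auto
    have "\<forall>\<^sub>F \<tau> in at 0. \<forall>s\<in>T. dist ((h (x + \<tau> *\<^sub>R s) - h x) / \<tau>) (\<Lambda> s) < e / 2"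
      using T dir \<open>e > 0\<close> by (intro eventually_ball_finite ballI tendstoD) auto
    then obtain r where r: "r > 0"
      "\<And>\<tau> s. \<tau> \<noteq> 0 \<Longrightarrow> \<bar>\<tau>\<bar> < r \<Longrightarrow> s \<in> T \<Longrightarrow> \<bar>(h (x + \<tau> *\<^sub>R s) - h x) / \<tau> - \<Lambda> s\<bar> < e / 2"
      unfolding eventually_at by (auto simp: dist_real_def)
    show "\<exists>d>0. \<forall>y. norm (y - x) < d \<longrightarrow> norm (h y - h x - \<Lambda> (y - x)) \<le> e * norm (y - x)"
    proof (intro exI[of _ r] conjI allI impI \<open>r > 0\<close>)
      fix y assume y: "norm (y - x) < r"
      show "norm (h y - h x - \<Lambda> (y - x)) \<le> e * norm (y - x)"
      proof (cases "y = x")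
        case True then show ?thesis using linear_0[OF \<Lambda>] by simp
      next
        case False
        define \<tau> where "\<tau> = norm (y - x)"
        define z where "z = (y - x) /\<^sub>R \<tau>"
        have \<tau>: "\<tau> > 0" "\<tau> < r" using False y by (auto simp: \<tau>_def)
        have yz: "y = x + \<tau> *\<^sub>R z" using \<tau> by (simp add: z_def)
        have "z \<in> sphere 0 1" using \<tau> by (simp add: z_def \<tau>_def)
        then obtain s where s: "s \<in> T" "norm (z - s) < d"
          using T(3) by (auto simp: dist_norm norm_minus_commute)
        have "\<bar>(h (x + \<tau> *\<^sub>R s) - h x) / \<tau> - \<Lambda> s\<bar> < e / 2"
          using r(2)[of \<tau> s] \<tau> s by simp
        then have a: "\<bar>h (x + \<tau> *\<^sub>R s) - h x - \<tau> * \<Lambda> s\<bar> \<le> e / 2 * \<tau>"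
          using \<tau> by (simp add: abs_le_iff abs_less_iff field_simps)
        have b: "\<bar>h y - h (x + \<tau> *\<^sub>R s)\<bar> \<le> L * (\<tau> * d)"
        proof -
          have "\<bar>h y - h (x + \<tau> *\<^sub>R s)\<bar> \<le> L * norm (\<tau> *\<^sub>R (z - s))"
            using lipschitz_onD[OF L, of y "x + \<tau> *\<^sub>R s"] by (simp add: yz dist_norm scaleR_diff_right)
          also have "\<dots> \<le> L * (\<tau> * d)"
            using s \<tau> L0 by (intro mult_left_mono) auto
          finally show ?thesis .
        qed
        have "\<Lambda> (y - x) - \<tau> * \<Lambda> s = \<Lambda> (\<tau> *\<^sub>R (z - s))"
          by (simp add: yz linear_diff[OF \<Lambda>] linear_scale[OF \<Lambda>] right_diff_distrib)
        then have "\<bar>\<Lambda> (y - x) - \<tau> * \<Lambda> s\<bar> \<le> C * norm (\<tau> *\<^sub>R (z - s))"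
          using C(2)[of "\<tau> *\<^sub>R (z - s)"] by simp
        also have "\<dots> \<le> C * (\<tau> * d)"
          using s \<tau> C(1) by (intro mult_left_mono) auto
        finally have c: "\<bar>\<Lambda> (y - x) - \<tau> * \<Lambda> s\<bar> \<le> C * (\<tau> * d)" .
        have "\<bar>h y - h x - \<Lambda> (y - x)\<bar> \<le> e / 2 * \<tau> + L * (\<tau> * d) + C * (\<tau> * d)"
          using a b c by linarith
        also have "\<dots> = e / 2 * \<tau> + \<tau> * ((L + C) * d)" by (simp add: algebra_simps)
        also have "(L + C) * d = e / 2" using L0 C(1) by (simp add: d_def field_simps)
        finally show ?thesis by (simp add: \<tau>_def)
      qed
    qed
  qed
qed

text \<open>Expanding a direction in the standard basis and applying additivity finitely often, for each fixed
  \<open>s\<close> the directional derivative equals almost everywhere the linear form built from the partial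
  derivatives. Discarding countably many null sets, this holds for all \<open>s\<close> in a countable dense set,
  which suffices for differentiability.\<close>

theorem rademacher_real:
  fixes h :: "'a::euclidean_space \<Rightarrow> real"
  assumes L: "L-lipschitz_on UNIV h"
  shows "AE x in lborel. h differentiable (at x)"
proof -
  define dd where "dd x s l \<longleftrightarrow> ((\<lambda>\<tau>. (h (x + \<tau> *\<^sub>R s) - h x) / \<tau>) \<longlongrightarrow> l) (at 0)" for x s l
  have dir: "AE x in lborel. \<exists>l. dd x s l" for s
    unfolding dd_def by (rule lipschitz_directionally_differentiable_ae[OF L])
  have add: "AE x in lborel. \<forall>l l' l''. dd x s l \<longrightarrow> dd x s' l' \<longrightarrow> dd x (s + s') l'' \<longrightarrow> l'' = l + l'" for s s'
    unfolding dd_def by (rule directional_derivative_additive_ae[OF L])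
  have scale: "dd x (c *\<^sub>R s) (c * l)" if "dd x s l" for x s c l
  proof (cases "c = 0")
    case True then show ?thesis by (simp add: dd_def)
  next
    case False
    have "filterlim (\<lambda>\<tau>. \<tau> * c) (at 0) (at (0::real))"
      using False by (intro filterlim_atI) (auto intro!: tendsto_eq_intros simp: eventually_at_filter)
    then have "((\<lambda>\<tau>. (h (x + (\<tau> * c) *\<^sub>R s) - h x) / (\<tau> * c)) \<longlongrightarrow> l) (at 0)"
      using that unfolding dd_def by (rule filterlim_compose[rotated])
    then have "((\<lambda>\<tau>. c * ((h (x + (\<tau> * c) *\<^sub>R s) - h x) / (\<tau> * c))) \<longlongrightarrow> c * l) (at 0)"
      by (intro tendsto_intros)
    then show ?thesis using False by (simp add: dd_def)
  qed
  define \<Lambda> where "\<Lambda> x s = (\<Sum>b\<in>Basis. (s \<bullet> b) * (THE l. dd x b l))" for x s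
  have the: "(THE l. dd x b l) = l" if "dd x b l" for x b l
    using that unfolding dd_def by (intro the_equality) (auto intro: LIM_unique)
  have sums: "AE x in lborel. dd x (\<Sum>b\<in>S. c b *\<^sub>R b) (\<Sum>b\<in>S. c b * (THE l. dd x b l))"
    if "finite S" for S :: "'a set" and c
    using that
  proof (induction S)
    case empty
    then show ?case by (simp add: dd_def)
  next
    case (insert b S)
    show ?case
      using insert.IH dir[of b] add[of "c b *\<^sub>R b" "\<Sum>b\<in>S. c b *\<^sub>R b"] dir[of "\<Sum>b\<in>insert b S. c b *\<^sub>R b"]
    proof eventually_elim
      case (elim x)
      obtain l where l: "dd x b l" using elim by auto
      obtain l' where l': "dd x (\<Sum>b\<in>insert b S. c b *\<^sub>R b) l'" using elim by auto
      have "l' = c b * l + (\<Sum>b\<in>S. c b * (THE l. dd x b l))"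
        using elim(3) scale[OF l, of "c b"] elim(1) l' insert.hyps by auto
      then show ?case using l' insert.hyps the[OF l] by simp
    qed
  qed
  have each: "AE x in lborel. dd x s (\<Lambda> x s)" for s
    using sums[OF finite_Basis, of "\<lambda>b. s \<bullet> b"] by (simp add: \<Lambda>_def euclidean_representation)
  obtain Q :: "'a set" where Q: "countable Q" "\<And>U. open U \<Longrightarrow> U \<noteq> {} \<Longrightarrow> \<exists>s\<in>Q. s \<in> U"
    by (rule countable_dense_setE) blast
  have "AE x in lborel. \<forall>s\<in>Q. dd x s (\<Lambda> x s)"
    using Q(1) each by (simp add: AE_ball_countable)
  then show ?thesis
  proof eventually_elim
    case (elim x)
    have "linear (\<Lambda> x)"
      unfolding \<Lambda>_def by (intro linearI) (auto simp: inner_add_left distrib_right sum.distrib sum_distrib_left mult.assoc)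
    then have "(h has_derivative \<Lambda> x) (at x)"
      using elim by (intro lipschitz_differentiable_if_directional[OF L _ Q(2)]) (auto simp: dd_def)
    then show ?case by (auto simp: differentiable_def)
  qed
qed

theorem rademacher:
  fixes h :: "'a::euclidean_space \<Rightarrow> 'b::euclidean_space"
  assumes L: "L-lipschitz_on UNIV h"
  shows "AE x in lborel. h differentiable (at x)"
proof -
  have "AE x in lborel. (\<lambda>x. h x \<bullet> b) differentiable (at x)" if "b \<in> Basis" for b
  proof (rule rademacher_real)
    show "L-lipschitz_on UNIV (\<lambda>x. h x \<bullet> b)"
    proof (rule lipschitz_onI)
      fix x y
      have "dist (h x \<bullet> b) (h y \<bullet> b) \<le> dist (h x) (h y)"
        using Basis_le_norm[OF that, of "h x - h y"] by (simp add: dist_norm inner_diff_left)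
      also have "\<dots> \<le> L * dist x y" by (rule lipschitz_onD[OF L]) auto
      finally show "dist (h x \<bullet> b) (h y \<bullet> b) \<le> L * dist x y" .
    qed (rule lipschitz_on_nonneg[OF L])
  qed
  then have "AE x in lborel. \<forall>b\<in>Basis. (\<lambda>x. h x \<bullet> b) differentiable (at x)"
    by (simp add: AE_ball_countable countable_finite)
  then show ?thesis
  proof eventually_elim
    case (elim x)
    then obtain D where D: "\<And>b. b \<in> Basis \<Longrightarrow> ((\<lambda>x. h x \<bullet> b) has_derivative D b) (at x)"
      unfolding differentiable_def bchoice_iff by blast
    have "(h has_derivative (\<lambda>v. \<Sum>b\<in>Basis. D b v *\<^sub>R b)) (at x)"
      using D by (subst has_derivative_componentwise_within) simp
    then show ?case by (auto simp: differentiable_def)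
  qed
qed

section \<open>A mean value inequality for Lipschitz functions\<close>

lemma jacobian_eq:
  fixes f :: "real^'n \<Rightarrow> real^'m"
  assumes "(f has_derivative f') (at x)"
  shows "jacobian f (at x) = matrix f'" "jacobian f (at x) *v s = f' s"
  using frechet_derivative_at[OF assms] has_derivative_linear[OF assms]
  by (auto simp: jacobian_def matrix_works)

text \<open>Compose with the metric projection onto the ball, which is nonexpansive.\<close>

lemma lipschitz_extension_from_cball:
  fixes h :: "'a::euclidean_space \<Rightarrow> 'b::euclidean_space"
  assumes L: "L-lipschitz_on (cball z r) h" and "0 \<le> r"
  obtains h' where "L-lipschitz_on UNIV h'" "\<And>x. x \<in> cball z r \<Longrightarrow> h' x = h x"
proof
  let ?p = "closest_point (cball z r)"
  have p: "?p x \<in> cball z r" for x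
    using \<open>0 \<le> r\<close> by (intro closest_point_in_set) auto
  show "L-lipschitz_on UNIV (\<lambda>x. h (?p x))"
  proof (rule lipschitz_onI)
    fix x y
    have "dist (h (?p x)) (h (?p y)) \<le> L * dist (?p x) (?p y)"
      by (rule lipschitz_onD[OF L p p])
    also have "\<dots> \<le> L * dist x y"
      using \<open>0 \<le> r\<close> lipschitz_on_nonneg[OF L] by (intro mult_left_mono closest_point_lipschitz) auto
    finally show "dist (h (?p x)) (h (?p y)) \<le> L * dist x y" .
  qed (rule lipschitz_on_nonneg[OF L])
  show "h (?p x) = h x" if "x \<in> cball z r" for x
    using that by (simp add: closest_point_self)
qed

lemma lipschitz_real_le_if_derivative_le:
  fixes \<phi> :: "real \<Rightarrow> real"
  assumes L: "L-lipschitz_on UNIV \<phi>" and N: "negligible N" and "0 \<le> \<tau>"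
    and le: "\<And>\<sigma> d. 0 \<le> \<sigma> \<Longrightarrow> \<sigma> \<le> \<tau> \<Longrightarrow> \<sigma> \<notin> N \<Longrightarrow> (\<phi> has_real_derivative d) (at \<sigma>) \<Longrightarrow> d \<le> c"
  shows "\<phi> \<tau> - \<phi> 0 \<le> c * \<tau>"
proof -
  obtain G N' where N': "negligible N'"
    and der: "\<And>\<sigma>. \<sigma> \<notin> N' \<Longrightarrow> (\<phi> has_real_derivative G \<sigma>) (at \<sigma>)"
    and int: "\<And>a b. a \<le> b \<Longrightarrow> (G has_integral (\<phi> b - \<phi> a)) {a..b}"
    using lipschitz_real_ftc[OF L] by metis
  define G' where "G' \<sigma> = (if \<sigma> \<in> N \<union> N' then c else G \<sigma>)" for \<sigma>
  have "(G' has_integral (\<phi> \<tau> - \<phi> 0)) {0..\<tau>}"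
    by (rule has_integral_spike[OF _ _ int[OF \<open>0 \<le> \<tau>\<close>], of "N \<union> N'"]) (use N N' in \<open>auto simp: G'_def\<close>)
  moreover have "((\<lambda>_. c) has_integral c * \<tau>) {0..\<tau>}"
    using has_integral_const_real[of c 0 \<tau>] \<open>0 \<le> \<tau>\<close> by (simp add: mult.commute)
  ultimately show ?thesis
    by (rule has_integral_le) (auto simp: G'_def intro!: le der)
qed

text \<open>A mean value inequality that tests the derivative only at points of differentiability. The segment
  itself may consist of exceptional points, but by Rademacher's and Fubini's theorems almost every
  parallel segment meets them in a null set; there the one-dimensional fundamental theorem applies,
  and continuity carries the inequality back to the given segment.\<close>

lemma lipschitz_increment_le_if_jacobian_le:
  fixes h :: "real^'n \<Rightarrow> real^'m"
  assumes L: "L-lipschitz_on (cball z r) h" and "0 \<le> r" and op: "open V" and V: "V \<subseteq> ball z r"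
    and seg: "\<And>\<sigma>. 0 \<le> \<sigma> \<Longrightarrow> \<sigma> \<le> \<tau> \<Longrightarrow> x + \<sigma> *\<^sub>R s \<in> V" and "0 \<le> \<tau>"
    and le: "\<And>y. y \<in> V \<Longrightarrow> h differentiable (at y) \<Longrightarrow> e \<bullet> (jacobian h (at y) *v s) \<le> c"
  shows "e \<bullet> (h (x + \<tau> *\<^sub>R s) - h x) \<le> c * \<tau>"
proof (rule ccontr)
  assume contra: "\<not> ?thesis"
  obtain h' where L': "L-lipschitz_on UNIV h'" and h': "\<And>x. x \<in> cball z r \<Longrightarrow> h' x = h x"
    using lipschitz_extension_from_cball[OF L \<open>0 \<le> r\<close>] by metis
  have h'V: "h' y = h y" if "y \<in> V" for y using V h' that by auto
  have cont: "continuous_on UNIV h'" using L' by (rule lipschitz_on_continuous_on)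
  have "AE y in lborel. h' differentiable (at y)" by (rule rademacher[OF L'])
  then obtain N where N: "N \<in> null_sets lborel" "{y. \<not> h' differentiable (at y)} \<subseteq> N"
    by (auto simp: eventually_ae_filter)
  have "negligible N" and Nb: "N \<in> sets borel"
    using N(1) borel_negligible_iff[of N] by (auto simp: null_sets_def)
  then have "AE y in lborel. negligible {\<sigma>::real. y + \<sigma> *\<^sub>R s \<in> N}"
    using negligible_iff_parallel_lines[OF Nb, of s] by simp
  then obtain N' where N': "N' \<in> null_sets lborel" "{y. \<not> negligible {\<sigma>::real. y + \<sigma> *\<^sub>R s \<in> N}} \<subseteq> N'"
    by (auto simp: eventually_ae_filter)
  have negN': "negligible N'"
    using N'(1) borel_negligible_iff[of N'] by (auto simp: null_sets_def)
  define S where "S = (\<lambda>\<sigma>. x + \<sigma> *\<^sub>R s) ` {0..\<tau>}"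
  have "compact S" unfolding S_def by (intro compact_continuous_image continuous_intros) auto
  moreover have "S \<subseteq> V" using seg by (auto simp: S_def)
  ultimately obtain \<epsilon> :: real where \<epsilon>: "\<epsilon> > 0" "(\<Union>y\<in>S. ball y \<epsilon>) \<subseteq> V"
    using compact_subset_open_imp_ball_epsilon_subset[OF _ op, of S] by blast
  define W where "W = ball x \<epsilon> \<inter> {y. c * \<tau> < e \<bullet> (h' (y + \<tau> *\<^sub>R s) - h' y)}"
  have "open W"
    unfolding W_def
    by (intro open_Int open_ball open_Collect_less continuous_intros continuous_on_compose2[OF cont]) auto
  moreover have "x \<in> W"
  proof -
    have "h' x = h x" "h' (x + \<tau> *\<^sub>R s) = h (x + \<tau> *\<^sub>R s)"
      using seg[of 0] seg[of \<tau>] \<open>0 \<le> \<tau>\<close> h'V by auto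
    then show ?thesis using contra \<epsilon>(1) by (simp add: W_def not_le)
  qed
  ultimately have "\<not> W \<subseteq> N'"
    using open_not_negligible[of W] negligible_subset[OF negN', of W] by blast
  then obtain y where y: "y \<in> W" "y \<notin> N'" by blast
  have yV: "y + \<sigma> *\<^sub>R s \<in> V" if "0 \<le> \<sigma>" "\<sigma> \<le> \<tau>" for \<sigma>
  proof -
    have "y + \<sigma> *\<^sub>R s \<in> ball (x + \<sigma> *\<^sub>R s) \<epsilon>"
      using y(1) by (simp add: W_def dist_norm)
    moreover have "x + \<sigma> *\<^sub>R s \<in> S" using that by (auto simp: S_def)
    ultimately show ?thesis using \<epsilon>(2) by blast
  qed
  define \<phi> where "\<phi> \<sigma> = e \<bullet> h' (y + \<sigma> *\<^sub>R s)" for \<sigma> :: real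
  have "(norm e * (L * norm s))-lipschitz_on UNIV \<phi>"
  proof (rule lipschitz_onI)
    fix \<sigma> \<sigma>' :: real
    have "dist (\<phi> \<sigma>) (\<phi> \<sigma>') = \<bar>e \<bullet> (h' (y + \<sigma> *\<^sub>R s) - h' (y + \<sigma>' *\<^sub>R s))\<bar>"
      by (simp add: \<phi>_def dist_real_def inner_diff_right)
    also have "\<dots> \<le> norm e * norm (h' (y + \<sigma> *\<^sub>R s) - h' (y + \<sigma>' *\<^sub>R s))"
      by (rule Cauchy_Schwarz_ineq2)
    also have "\<dots> \<le> norm e * (L * norm ((y + \<sigma> *\<^sub>R s) - (y + \<sigma>' *\<^sub>R s)))"
      using lipschitz_onD[OF L', of "y + \<sigma> *\<^sub>R s" "y + \<sigma>' *\<^sub>R s"]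
      by (intro mult_left_mono) (auto simp: dist_norm)
    also have "(y + \<sigma> *\<^sub>R s) - (y + \<sigma>' *\<^sub>R s) = (\<sigma> - \<sigma>') *\<^sub>R s" by (simp add: scaleR_diff_left)
    finally show "dist (\<phi> \<sigma>) (\<phi> \<sigma>') \<le> norm e * (L * norm s) * dist \<sigma> \<sigma>'"
      by (simp add: dist_real_def mult_ac)
  qed (use lipschitz_on_nonneg[OF L] in auto)
  moreover have "negligible {\<sigma>::real. y + \<sigma> *\<^sub>R s \<in> N}" using N'(2) y(2) by auto
  ultimately have "\<phi> \<tau> - \<phi> 0 \<le> c * \<tau>"
  proof (rule lipschitz_real_le_if_derivative_le[OF _ _ \<open>0 \<le> \<tau>\<close>])
    fix \<sigma> d :: real
    assume \<sigma>: "0 \<le> \<sigma>" "\<sigma> \<le> \<tau>" "\<sigma> \<notin> {\<sigma>. y + \<sigma> *\<^sub>R s \<in> N}" and d: "(\<phi> has_real_derivative d) (at \<sigma>)"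
    let ?y = "y + \<sigma> *\<^sub>R s"
    obtain A where A: "(h' has_derivative A) (at ?y)"
      using N(2) \<sigma>(3) by (auto simp: differentiable_def)
    have hA: "(h has_derivative A) (at ?y)"
      by (rule has_derivative_transform_within_open[OF A op yV[OF \<sigma>(1,2)] h'V])
    have "((\<lambda>\<sigma>. y + \<sigma> *\<^sub>R s) has_derivative (\<lambda>\<sigma>. \<sigma> *\<^sub>R s)) (at \<sigma>)"
      by (auto intro!: derivative_eq_intros)
    then have "((\<lambda>\<sigma>. h' (y + \<sigma> *\<^sub>R s)) has_derivative (\<lambda>\<sigma>. A (\<sigma> *\<^sub>R s))) (at \<sigma>)"
      by (rule has_derivative_compose[where g = h' and g' = A]) (rule A)
    then have "(\<phi> has_derivative (\<lambda>\<sigma>. e \<bullet> A (\<sigma> *\<^sub>R s))) (at \<sigma>)"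
      unfolding \<phi>_def by (rule has_derivative_inner_right)
    then have "(\<phi> has_real_derivative e \<bullet> A s) (at \<sigma>)"
      unfolding has_field_derivative_def
      by (rule has_derivative_eq_rhs) (auto simp: linear_scale[OF has_derivative_linear[OF A]])
    then have "d = e \<bullet> A s" using d DERIV_unique by blast
    then show "d \<le> c"
      using le[OF yV[OF \<sigma>(1,2)] differentiableI[OF hA]] jacobian_eq(2)[OF hA] by simp
  qed
  then show False using y(1) by (simp add: W_def \<phi>_def inner_diff_right)
qed

section \<open>The Clarke Jacobian\<close>

text \<open>The Bouligand subdifferential, whose convex hull is the Clarke Jacobian.\<close>

definition limiting_jacobians :: "(real^'n \<Rightarrow> real^'m) \<Rightarrow> real^'n \<Rightarrow> (real^'n^'m) set" where
  "limiting_jacobians h x = {V. \<exists>X. X \<longlonglongrightarrow> x \<and> (\<forall>k. h differentiable (at (X k))) \<and>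
            (\<lambda>k. jacobian h (at (X k))) \<longlonglongrightarrow> V}"

lemma clarke_jacobian_eq: "clarke_jacobian h x = convex hull (limiting_jacobians h x)"
  by (simp add: clarke_jacobian_def limiting_jacobians_def)

lemma jacobian_in_clarke_jacobian:
  "h differentiable (at x) \<Longrightarrow> jacobian h (at x) \<in> clarke_jacobian h x"
  unfolding clarke_jacobian_def
  by (rule hull_inc, rule CollectI, rule exI[of _ "\<lambda>_. x"]) simp

lemma matrix_vector_mult_tendsto:
  fixes V :: "'a \<Rightarrow> real^'n^'m"
  assumes "(V \<longlongrightarrow> B) F" "(W \<longlongrightarrow> w) F"
  shows "((\<lambda>i. V i *v W i) \<longlongrightarrow> B *v w) F"
  unfolding matrix_vector_mult_def using assms by (auto intro!: tendsto_intros)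

lemma jacobian_apply_tendsto:
  fixes h :: "real^'n \<Rightarrow> real^'m"
  assumes "h differentiable (at y)"
  shows "((\<lambda>\<tau>. inverse \<tau> *\<^sub>R (h (y + \<tau> *\<^sub>R s) - h y)) \<longlongrightarrow> jacobian h (at y) *v s) (at_right 0)"
proof -
  have hA: "(h has_derivative (\<lambda>v. jacobian h (at y) *v v)) (at (y + 0 *\<^sub>R s))"
    using assms by (simp flip: jacobian_works)
  have "((\<lambda>\<tau>. y + \<tau> *\<^sub>R s) has_derivative (\<lambda>\<tau>. \<tau> *\<^sub>R s)) (at 0)"
    by (auto intro!: derivative_eq_intros)
  then have "((\<lambda>\<tau>. h (y + \<tau> *\<^sub>R s)) has_derivative (\<lambda>\<tau>. jacobian h (at y) *v (\<tau> *\<^sub>R s))) (at 0)"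
    by (rule has_derivative_compose[where g = h and g' = "\<lambda>v. jacobian h (at y) *v v"]) (rule hA)
  then have "((\<lambda>\<tau>. norm (h (y + \<tau> *\<^sub>R s) - h y - jacobian h (at y) *v (\<tau> *\<^sub>R s)) / norm \<tau>) \<longlongrightarrow> 0) (at 0)"
    unfolding has_derivative_at by simp
  then have "((\<lambda>\<tau>. norm (h (y + \<tau> *\<^sub>R s) - h y - jacobian h (at y) *v (\<tau> *\<^sub>R s)) / norm \<tau>) \<longlongrightarrow> 0) (at_right 0)"
    by (rule tendsto_mono[rotated]) (simp add: at_le)
  then have "((\<lambda>\<tau>. norm (inverse \<tau> *\<^sub>R (h (y + \<tau> *\<^sub>R s) - h y) - jacobian h (at y) *v s)) \<longlongrightarrow> 0) (at_right 0)"
  proof (rule Lim_transform_eventually)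
    show "\<forall>\<^sub>F \<tau> in at_right 0. norm (h (y + \<tau> *\<^sub>R s) - h y - jacobian h (at y) *v (\<tau> *\<^sub>R s)) / norm \<tau>
        = norm (inverse \<tau> *\<^sub>R (h (y + \<tau> *\<^sub>R s) - h y) - jacobian h (at y) *v s)"
      using eventually_at_right_less[of 0]
    proof eventually_elim
      case (elim \<tau>)
      have "inverse \<tau> *\<^sub>R (h (y + \<tau> *\<^sub>R s) - h y) - jacobian h (at y) *v s
          = inverse \<tau> *\<^sub>R (h (y + \<tau> *\<^sub>R s) - h y - jacobian h (at y) *v (\<tau> *\<^sub>R s))"
        using elim by (simp add: scaleR_diff_right matrix_vector_mult_scaleR)
      then show ?case using elim by (simp add: divide_inverse_commute)
    qed
  qed
  then show ?thesis by (simp add: tendsto_norm_zero_iff LIM_zero_iff)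
qed

lemma jacobian_norm_bound:
  fixes h :: "real^'n \<Rightarrow> real^'m"
  assumes N: "is_norm N" and M: "is_norm M"
    and lip: "\<And>x x'. x \<in> ball x0 r \<Longrightarrow> x' \<in> ball x0 r \<Longrightarrow> M (h x - h x') \<le> l * N (x - x')"
    and y: "y \<in> ball x0 r" and diff: "h differentiable (at y)"
  shows "M (jacobian h (at y) *v s) \<le> l * N s"
proof (rule tendsto_upperbound)
  show "((\<lambda>\<tau>. M (inverse \<tau> *\<^sub>R (h (y + \<tau> *\<^sub>R s) - h y))) \<longlongrightarrow> M (jacobian h (at y) *v s)) (at_right 0)"
    by (intro is_norm_tendsto[OF M] jacobian_apply_tendsto diff)
  have "((\<lambda>\<tau>. y + \<tau> *\<^sub>R s) \<longlongrightarrow> y) (at_right 0)"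
    by (auto intro!: tendsto_eq_intros)
  then have "\<forall>\<^sub>F \<tau> in at_right 0. y + \<tau> *\<^sub>R s \<in> ball x0 r"
    by (rule topological_tendstoD) (use y in auto)
  moreover have "\<forall>\<^sub>F \<tau> in at_right (0::real). 0 < \<tau>"
    by (rule eventually_at_right_less)
  ultimately show "\<forall>\<^sub>F \<tau> in at_right 0. M (inverse \<tau> *\<^sub>R (h (y + \<tau> *\<^sub>R s) - h y)) \<le> l * N s"
  proof eventually_elim
    case (elim \<tau>)
    then have "M (h (y + \<tau> *\<^sub>R s) - h y) \<le> l * (\<tau> * N s)"
      using lip[OF elim(1) y] by (simp add: is_norm_scale[OF N])
    then show ?case using elim(2) unfolding is_norm_scale[OF M] by (simp add: divide_simps mult_ac)
  qed
qed auto

text \<open>A bound of this form defines a closed convex set of matrices. So it passes from the Jacobians to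
  their limits and to the convex hull.\<close>

lemma clarke_jacobian_norm_bound:
  fixes h :: "real^'n \<Rightarrow> real^'m"
  assumes N: "is_norm N" and M: "is_norm M"
    and lip: "\<And>x x'. x \<in> ball x0 r \<Longrightarrow> x' \<in> ball x0 r \<Longrightarrow> M (h x - h x') \<le> l * N (x - x')"
    and y: "y \<in> ball x0 r" and V: "V \<in> clarke_jacobian h y"
  shows "M (V *v s) \<le> l * N s"
proof -
  have "convex {V. M (V *v s) \<le> l * N s}"
    unfolding convex_def
  proof (intro allI ballI impI, rule CollectI)
    fix A B :: "real^'n^'m" and u v :: real
    assume A: "A \<in> {V. M (V *v s) \<le> l * N s}" and B: "B \<in> {V. M (V *v s) \<le> l * N s}"
      and uv: "0 \<le> u" "0 \<le> v" "u + v = 1"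
    have "M ((u *\<^sub>R A + v *\<^sub>R B) *v s) \<le> M (u *\<^sub>R (A *v s)) + M (v *\<^sub>R (B *v s))"
      using is_norm_triangle[OF M] by (simp add: matrix_vector_mult_add_rdistrib scaleR_matrix_vector_assoc)
    also have "\<dots> \<le> u * (l * N s) + v * (l * N s)"
      using A B uv by (intro add_mono) (auto simp: is_norm_scale[OF M] intro: mult_left_mono)
    also have "\<dots> = l * N s" using uv(3) by (simp flip: distrib_right)
    finally show "M ((u *\<^sub>R A + v *\<^sub>R B) *v s) \<le> l * N s" .
  qed
  moreover have "limiting_jacobians h y \<subseteq> {V. M (V *v s) \<le> l * N s}"
  proof
    fix V assume "V \<in> limiting_jacobians h y"
    then obtain X where X: "X \<longlonglongrightarrow> y" "\<And>k. h differentiable (at (X k))" "(\<lambda>k. jacobian h (at (X k))) \<longlonglongrightarrow> V"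
      by (auto simp: limiting_jacobians_def)
    have "\<forall>\<^sub>F k in sequentially. X k \<in> ball x0 r"
      using X(1) y by (intro topological_tendstoD) auto
    then have "\<forall>\<^sub>F k in sequentially. M (jacobian h (at (X k)) *v s) \<le> l * N s"
      by eventually_elim (rule jacobian_norm_bound[OF N M lip _ X(2)])
    moreover have "(\<lambda>k. M (jacobian h (at (X k)) *v s)) \<longlonglongrightarrow> M (V *v s)"
      by (intro is_norm_tendsto[OF M] matrix_vector_mult_tendsto X(3)) auto
    ultimately have "M (V *v s) \<le> l * N s"
      by (intro tendsto_upperbound) auto
    then show "V \<in> {V. M (V *v s) \<le> l * N s}" by simp
  qed
  ultimately have "clarke_jacobian h y \<subseteq> {V. M (V *v s) \<le> l * N s}"
    unfolding clarke_jacobian_eq by (intro hull_minimal)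
  then show ?thesis using V by auto
qed

lemma is_norm_norm: "is_norm (norm :: 'a::real_normed_vector \<Rightarrow> real)"
  by (auto simp: is_norm_def norm_triangle_ineq)

text \<open>Testing with the \<open>i\<close>-th row itself bounds the norm of that row by \<open>L\<close>.\<close>

lemma matrix_norm_le:
  fixes V :: "real^'n^'m"
  assumes "\<And>s. norm (V *v s) \<le> L * norm s"
  shows "norm V \<le> real CARD('m) * L"
proof -
  have "norm (V $ i) \<le> L" for i
  proof (cases "V $ i = 0")
    case True
    have "0 \<le> norm (V *v axis undefined 1)" by simp
    also have "\<dots> \<le> L" using assms[of "axis undefined 1"] by simp
    finally show ?thesis using True by simp
  next
    case False
    have "norm (V $ i) * norm (V $ i) = (V *v (V $ i)) $ i"
      by (simp add: matrix_vector_mul_component dot_square_norm power2_eq_square)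
    also have "\<dots> \<le> norm (V *v (V $ i))" by (metis abs_le_D1 component_le_norm_cart)
    also have "\<dots> \<le> L * norm (V $ i)" by (rule assms)
    finally show ?thesis using False by simp
  qed
  then have "(\<Sum>i\<in>UNIV. norm (V $ i)) \<le> (\<Sum>i\<in>(UNIV :: 'm set). L)" by (intro sum_mono)
  moreover have "norm V \<le> (\<Sum>i\<in>UNIV. norm (V $ i))"
    unfolding norm_vec_def[of V] by (rule L2_set_le_sum) simp
  ultimately show ?thesis by simp
qed

lemma lipschitz_on_norm_bound:
  assumes "L-lipschitz_on (cball z r) h" "x \<in> ball z r" "x' \<in> ball z r"
  shows "norm (h x - h x') \<le> L * norm (x - x')"
  using lipschitz_onD[OF assms(1), of x x'] assms(2,3) by (simp add: dist_norm)

text \<open>The first-order condition for \<open>v \<bullet> h\<close> produces an element of \<open>{V\<^sup>T v | V \<in> clarke_jacobian h x}\<close>. Otherwise a direction \<open>a\<close>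
  separates \<open>u\<close>, with a margin larger than \<open>\<epsilon> |a|\<close>, from that convex set. By compactness the
  Jacobians at all points of differentiability near \<open>x\<close> are still on the far side, up to a small
  error, and the mean value inequality contradicts the growth of \<open>v \<bullet> h\<close> along \<open>a\<close>.\<close>

lemma clarke_subgradient:
  fixes h :: "real^'n \<Rightarrow> real^'m"
  assumes L: "L-lipschitz_on (cball x r) h" and "0 < r"
    and low: "\<And>\<delta>. 0 < \<delta> \<Longrightarrow> \<forall>\<^sub>F y in nhds x. u \<bullet> (y - x) - (\<epsilon> + \<delta>) * norm (y - x) \<le> v \<bullet> (h y - h x)"
    and "0 \<le> \<epsilon>" "\<epsilon> < \<epsilon>'"
  shows "\<exists>V\<in>clarke_jacobian h x. norm (transpose V *v v - u) < \<epsilon>'"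
proof (rule ccontr)
  assume contra: "\<not> ?thesis"
  define C where "C = (\<lambda>V. transpose V *v v) ` clarke_jacobian h x"
  have "linear (\<lambda>V::real^'n^'m. transpose V *v v)"
    by (rule linearI)
      (auto simp: vector_matrix_mult_def vec_eq_iff sum.distrib sum_distrib_left algebra_simps)
  moreover have "convex (clarke_jacobian h x)"
    unfolding clarke_jacobian_eq by (rule convex_convex_hull)
  ultimately have "convex C"
    unfolding C_def by (rule convex_linear_image)
  have "\<exists>a b. a \<noteq> 0 \<and> (\<forall>y\<in>C. a \<bullet> y \<le> b) \<and> b < a \<bullet> u - \<epsilon> * norm a"
  \<comment> \<open>for empty \<open>C\<close> any direction will do; the contradiction below then shows that this case does not occur\<close>
  proof (cases "C = {}")
    case True
    then show ?thesis
      by (intro exI[of _ "axis undefined 1"] exI[of _ "axis undefined 1 \<bullet> u - \<epsilon> * norm (axis undefined 1 :: real^'n) - 1"])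
        (auto simp: axis_eq_0_iff)
  next
    case False
    have "C \<inter> ball u \<epsilon>' = {}"
      using contra by (auto simp: C_def dist_norm norm_minus_commute)
    moreover have "u \<in> ball u \<epsilon>'" using assms by simp
    ultimately obtain a b where ab: "a \<noteq> 0" "\<And>y. y \<in> C \<Longrightarrow> a \<bullet> y \<le> b" "\<And>z. z \<in> ball u \<epsilon>' \<Longrightarrow> b \<le> a \<bullet> z"
      using separating_hyperplane_sets[OF \<open>convex C\<close> convex_ball False, of u \<epsilon>'] by blast
    \<comment> \<open>an intermediate radius makes the separation strict\<close>
    define \<epsilon>2 where "\<epsilon>2 = (\<epsilon> + \<epsilon>') / 2"
    have e2: "\<epsilon> < \<epsilon>2" "\<epsilon>2 < \<epsilon>'" "0 \<le> \<epsilon>2" using assms by (auto simp: \<epsilon>2_def)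
    have "b \<le> a \<bullet> (u - (\<epsilon>2 / norm a) *\<^sub>R a)"
      using ab(1) e2 by (intro ab(3)) (auto simp: dist_norm)
    also have "\<dots> = a \<bullet> u - \<epsilon>2 * norm a"
      using ab(1) by (simp add: inner_diff_right power2_eq_square flip: power2_norm_eq_inner)
    also have "\<dots> < a \<bullet> u - \<epsilon> * norm a"
      using ab(1) e2(1) by simp
    finally show ?thesis using ab by blast
  qed
  then obtain a b where a: "a \<noteq> 0" and ab: "\<And>y. y \<in> C \<Longrightarrow> a \<bullet> y \<le> b" and b: "b < a \<bullet> u - \<epsilon> * norm a"
    by blast
  define \<eta> where "\<eta> = (a \<bullet> u - \<epsilon> * norm a - b) / 2"
  define c where "c = b + \<eta>"
  have \<eta>: "\<eta> > 0" "c + \<eta> = a \<bullet> u - \<epsilon> * norm a" using b by (auto simp: \<eta>_def c_def field_simps)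
  have "\<exists>\<rho>. 0 < \<rho> \<and> \<rho> \<le> r \<and> (\<forall>y\<in>ball x \<rho>. h differentiable (at y) \<longrightarrow> v \<bullet> (jacobian h (at y) *v a) \<le> c)"
  proof (rule ccontr)
    assume no: "\<not> ?thesis"
    define \<rho> where "\<rho> k = min r (1 / real (Suc k))" for k
    have "\<exists>y\<in>ball x (\<rho> k). h differentiable (at y) \<and> c < v \<bullet> (jacobian h (at y) *v a)" for k
    proof -
      have "0 < \<rho> k" "\<rho> k \<le> r" using \<open>0 < r\<close> by (auto simp: \<rho>_def)
      then show ?thesis using no by (metis not_le)
    qed
    then obtain Y where Y: "\<And>k. Y k \<in> ball x (\<rho> k)" "\<And>k. h differentiable (at (Y k))"
      "\<And>k. c < v \<bullet> (jacobian h (at (Y k)) *v a)" by metis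
    have Yr: "Y k \<in> ball x r" for k using Y(1)[of k] by (auto simp: \<rho>_def)
    have "(\<lambda>k. dist (Y k) x) \<longlonglongrightarrow> 0"
    proof (rule Lim_null_comparison)
      show "\<forall>\<^sub>F k in sequentially. norm (dist (Y k) x) \<le> 1 / real (Suc k)"
      proof (rule always_eventually, rule allI)
        fix k
        have "dist (Y k) x < 1 / real (Suc k)" using Y(1)[of k] by (simp add: \<rho>_def dist_commute)
        then show "norm (dist (Y k) x) \<le> 1 / real (Suc k)" by simp
      qed
      show "(\<lambda>k. 1 / real (Suc k)) \<longlonglongrightarrow> 0"
        using LIMSEQ_inverse_real_of_nat by (simp add: divide_inverse)
    qed
    then have Ylim: "Y \<longlonglongrightarrow> x" by (rule tendsto_dist_iff[THEN iffD2])
    have "norm (jacobian h (at (Y k)) *v s) \<le> L * norm s" for k s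
      by (rule jacobian_norm_bound[OF is_norm_norm is_norm_norm lipschitz_on_norm_bound[OF L] Yr Y(2)])
    then have "norm (jacobian h (at (Y k))) \<le> real CARD('m) * L" for k
      by (rule matrix_norm_le)
    then have "bounded (range (\<lambda>k. jacobian h (at (Y k))))"
      by (auto simp: bounded_iff)
    then obtain V \<sigma> where \<sigma>: "strict_mono \<sigma>" "((\<lambda>k. jacobian h (at (Y k))) \<circ> \<sigma>) \<longlonglongrightarrow> V"
      using bounded_imp_convergent_subsequence by blast
    have "V \<in> clarke_jacobian h x"
      unfolding clarke_jacobian_def using LIMSEQ_subseq_LIMSEQ[OF Ylim \<sigma>(1)] \<sigma>(2) Y(2)
      by (intro hull_inc CollectI exI[of _ "Y \<circ> \<sigma>"]) (auto simp: o_def)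
    then have "a \<bullet> (transpose V *v v) \<le> b" using ab by (auto simp: C_def)
    moreover have "a \<bullet> (transpose V *v v) = v \<bullet> (V *v a)"
      by (metis dot_lmul_matrix inner_commute transpose_matrix_vector)
    moreover have "c \<le> v \<bullet> (V *v a)"
    proof (rule tendsto_lowerbound)
      show "(\<lambda>k. v \<bullet> (jacobian h (at (Y (\<sigma> k))) *v a)) \<longlonglongrightarrow> v \<bullet> (V *v a)"
        using \<sigma>(2) by (intro tendsto_inner tendsto_const matrix_vector_mult_tendsto) (auto simp: o_def)
    qed (use Y(3) in \<open>auto intro!: always_eventually less_imp_le\<close>)
    ultimately show False using \<eta>(1) by (simp add: c_def)
  qed
  then obtain \<rho> where \<rho>: "0 < \<rho>" "\<rho> \<le> r"
    "\<And>y. y \<in> ball x \<rho> \<Longrightarrow> h differentiable (at y) \<Longrightarrow> v \<bullet> (jacobian h (at y) *v a) \<le> c" by blast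
  define \<delta> where "\<delta> = \<eta> / (2 * norm a)"
  have \<delta>: "\<delta> > 0" "\<delta> * norm a = \<eta> / 2" using a \<eta>(1) by (auto simp: \<delta>_def)
  obtain d where d: "d > 0" "\<And>y. dist y x < d \<Longrightarrow> u \<bullet> (y - x) - (\<epsilon> + \<delta>) * norm (y - x) \<le> v \<bullet> (h y - h x)"
    using low[OF \<delta>(1)] unfolding eventually_nhds_metric by blast
  define \<tau> where "\<tau> = min \<rho> d / (2 * norm a)"
  have \<tau>: "0 < \<tau>" "\<tau> * norm a < \<rho>" "\<tau> * norm a < d"
    using a \<rho>(1) d(1) by (auto simp: \<tau>_def field_simps min_def)
  have "v \<bullet> (h (x + \<tau> *\<^sub>R a) - h x) \<le> c * \<tau>"
  proof (rule lipschitz_increment_le_if_jacobian_le[OF L _ open_ball[of x \<rho>]])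
    fix \<sigma> assume "0 \<le> \<sigma>" "\<sigma> \<le> \<tau>"
    then have "\<sigma> * norm a \<le> \<tau> * norm a" by (intro mult_right_mono) auto
    then show "x + \<sigma> *\<^sub>R a \<in> ball x \<rho>" using \<tau> \<open>0 \<le> \<sigma>\<close> by (simp add: dist_norm)
  qed (use \<rho> \<tau> \<open>0 < r\<close> in auto)
  moreover have "u \<bullet> (\<tau> *\<^sub>R a) - (\<epsilon> + \<delta>) * norm (\<tau> *\<^sub>R a) \<le> v \<bullet> (h (x + \<tau> *\<^sub>R a) - h x)"
    using d(2)[of "x + \<tau> *\<^sub>R a"] \<tau> by (simp add: dist_norm)
  ultimately have "\<tau> * (a \<bullet> u - (\<epsilon> + \<delta>) * norm a) \<le> \<tau> * c"
    using \<tau>(1) by (simp add: inner_commute algebra_simps)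
  then have "a \<bullet> u - (\<epsilon> + \<delta>) * norm a \<le> c" using \<tau>(1) by simp
  then show False using \<eta> \<delta>(2) by (simp add: distrib_right)
qed

section \<open>Directional derivatives of semismooth functions\<close>

text \<open>Semismoothness controls the Jacobians in a truncated cone around the ray of direction \<open>u\<close>: there
  \<open>jacobian h (at y) *v u\<close> is close to \<open>l\<close>. The mean value inequality on the part of the ray that lies in
  the open cone, followed by letting its starting point tend to \<open>x\<close>, gives the difference quotients.\<close>

lemma semismooth_directional_derivative:
  fixes h :: "real^'n \<Rightarrow> real^'m"
  assumes L: "L-lipschitz_on (cball x r) h" and "0 < r"
    and ss: "\<And>t W V. down0 t \<Longrightarrow> W \<longlonglongrightarrow> u \<Longrightarrow> (\<And>i. V i \<in> clarke_jacobian h (x + t i *\<^sub>R W i))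
        \<Longrightarrow> (\<lambda>i. V i *v W i) \<longlonglongrightarrow> l"
  shows "((\<lambda>t. inverse t *\<^sub>R (h (x + t *\<^sub>R u) - h x)) \<longlongrightarrow> l) (at_right 0)"
proof -
  have L0: "0 \<le> L" using L by (rule lipschitz_on_nonneg)
  have cone: "\<exists>\<tau>>0. \<forall>t w. 0 < t \<longrightarrow> t < \<tau> \<longrightarrow> norm (w - u) < \<tau> \<longrightarrow> h differentiable (at (x + t *\<^sub>R w))
      \<longrightarrow> norm (jacobian h (at (x + t *\<^sub>R w)) *v w - l) \<le> \<delta>" if "\<delta> > 0" for \<delta>
  proof (rule ccontr)
    assume no: "\<not> ?thesis"
    have "\<exists>t w. 0 < t \<and> t < 1 / real (Suc k) \<and> norm (w - u) < 1 / real (Suc k) \<and> h differentiable (at (x + t *\<^sub>R w))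
       \<and> \<delta> < norm (jacobian h (at (x + t *\<^sub>R w)) *v w - l)" for k
      using no[simplified, rule_format, of "1 / real (Suc k)"] by (auto simp: not_le)
    then obtain t W where tW: "\<And>k. 0 < t k" "\<And>k. t k < 1 / real (Suc k)" "\<And>k. norm (W k - u) < 1 / real (Suc k)"
      "\<And>k. h differentiable (at (x + t k *\<^sub>R W k))"
      "\<And>k. \<delta> < norm (jacobian h (at (x + t k *\<^sub>R W k)) *v W k - l)" by metis
    have n0: "(\<lambda>k. 1 / real (Suc k)) \<longlonglongrightarrow> 0"
      using LIMSEQ_inverse_real_of_nat by (simp add: divide_inverse)
    have "t \<longlonglongrightarrow> 0"
      by (rule Lim_null_comparison[OF always_eventually n0], rule allI)
        (use tW(1) less_imp_le[OF tW(2)] in \<open>simp add: abs_of_pos\<close>)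
    then have "down0 t" using tW(1) by (simp add: down0_def)
    moreover have "(\<lambda>k. W k - u) \<longlonglongrightarrow> 0"
      by (rule Lim_null_comparison[OF always_eventually n0], rule allI) (use less_imp_le[OF tW(3)] in simp)
    then have "W \<longlonglongrightarrow> u" by (simp add: LIM_zero_iff)
    ultimately have "(\<lambda>k. jacobian h (at (x + t k *\<^sub>R W k)) *v W k) \<longlonglongrightarrow> l"
      by (rule ss) (intro jacobian_in_clarke_jacobian tW(4))
    then have "\<forall>\<^sub>F k in sequentially. dist (jacobian h (at (x + t k *\<^sub>R W k)) *v W k) l < \<delta>"
      using that by (rule tendstoD)
    then obtain k where "dist (jacobian h (at (x + t k *\<^sub>R W k)) *v W k) l < \<delta>"
      by (auto simp: eventually_sequentially)
    then show False using tW(5)[of k] by (simp add: dist_norm)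
  qed
  show ?thesis
  proof (rule tendstoI)
    fix e :: real assume "e > 0"
    define \<delta> where "\<delta> = e / 4"
    have "\<delta> > 0" using \<open>e > 0\<close> by (simp add: \<delta>_def)
    obtain \<tau>0 where \<tau>0: "\<tau>0 > 0" "\<And>t w. 0 < t \<Longrightarrow> t < \<tau>0 \<Longrightarrow> norm (w - u) < \<tau>0 \<Longrightarrow> h differentiable (at (x + t *\<^sub>R w))
      \<Longrightarrow> norm (jacobian h (at (x + t *\<^sub>R w)) *v w - l) \<le> \<delta>" using cone[OF \<open>\<delta> > 0\<close>] by blast
    define \<tau> where "\<tau> = Min {\<tau>0, \<delta> / (L + 1), r / (2 * (norm u + 1)), 1}"
    have \<tau>: "0 < \<tau>" "\<tau> \<le> \<tau>0" "\<tau> \<le> \<delta> / (L + 1)" "\<tau> \<le> r / (2 * (norm u + 1))" "\<tau> \<le> 1"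
      using \<tau>0(1) \<open>\<delta> > 0\<close> \<open>0 < r\<close> L0 by (auto simp: \<tau>_def add_nonneg_pos)
    define Z where "Z = (\<Union>t\<in>{0<..<\<tau>}. ball (x + t *\<^sub>R u) (t * \<tau>))"
    have "open Z" by (auto simp: Z_def)
    have Oe: "\<exists>t w. 0 < t \<and> t < \<tau> \<and> norm (w - u) < \<tau> \<and> y = x + t *\<^sub>R w" if yZ: "y \<in> Z" for y
    proof -
      obtain t where t: "0 < t" "t < \<tau>" and y: "y \<in> ball (x + t *\<^sub>R u) (t * \<tau>)"
        using yZ unfolding Z_def by auto
      have y': "norm (y - (x + t *\<^sub>R u)) < t * \<tau>"
        using y by (simp only: mem_ball dist_norm norm_minus_commute)
      define w where "w = inverse t *\<^sub>R (y - x)"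
      have "norm (w - u) = norm (inverse t *\<^sub>R (y - (x + t *\<^sub>R u)))"
        using t by (simp add: w_def scaleR_diff_right scaleR_add_right diff_diff_eq)
      also have "\<dots> < \<tau>" using t y' by (simp only: norm_scaleR) (simp add: field_simps)
      finally show ?thesis using t by (intro exI[of _ t] exI[of _ w]) (simp add: w_def)
    qed
    have Or: "Z \<subseteq> ball x r"
    proof
      fix y assume "y \<in> Z"
      then obtain t w where t: "0 < t" "t < \<tau>" "norm (w - u) < \<tau>" "y = x + t *\<^sub>R w" using Oe by blast
      have "norm w \<le> norm u + 1" using t(3) \<tau>(5) norm_triangle_sub[of w u] by linarith
      then have "t * norm w \<le> \<tau> * (norm u + 1)" using t \<tau>(1) by (intro mult_mono) auto
      also have "\<dots> \<le> (r / (2 * (norm u + 1))) * (norm u + 1)" using \<tau>(4) by (intro mult_right_mono) auto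
      also have "\<dots> = r / 2"
      proof -
        have "norm u + 1 \<noteq> 0" using norm_ge_zero[of u] by linarith
        moreover have "r / (2 * a) * a = r / 2" if "a \<noteq> 0" for a :: real using that by simp
        ultimately show ?thesis by blast
      qed
      also have "\<dots> < r" using \<open>0 < r\<close> by simp
      finally show "y \<in> ball x r" using t by (simp add: dist_norm)
    qed
    have jac: "norm (jacobian h (at y) *v u - l) \<le> 2 * \<delta>" if yZ: "y \<in> Z" "h differentiable (at y)" for y
    proof -
      obtain t w where t: "0 < t" "t < \<tau>" "norm (w - u) < \<tau>" "y = x + t *\<^sub>R w" using Oe yZ by blast
      have a1: "norm (jacobian h (at y) *v w - l) \<le> \<delta>"
        using \<tau>0(2)[of t w] t \<tau>(2) yZ(2) by simp
      have a2: "norm (jacobian h (at y) *v (u - w)) \<le> L * norm (u - w)"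
        by (rule jacobian_norm_bound[OF is_norm_norm is_norm_norm lipschitz_on_norm_bound[OF L]])
          (use yZ Or in auto)
      have a3: "L * norm (u - w) \<le> (L + 1) * \<tau>"
        using t(3) L0 by (intro mult_mono) (auto simp: norm_minus_commute)
      have a4: "(L + 1) * \<tau> \<le> \<delta>" using \<tau>(3) L0 by (simp add: field_simps)
      have "jacobian h (at y) *v u - l = (jacobian h (at y) *v w - l) + jacobian h (at y) *v (u - w)"
        by (simp add: matrix_vector_mult_diff_distrib)
      then have "norm (jacobian h (at y) *v u - l) \<le> norm (jacobian h (at y) *v w - l) + norm (jacobian h (at y) *v (u - w))"
        by (simp only: norm_triangle_ineq)
      then show ?thesis using a1 a2 a3 a4 by linarith
    qed
    have main: "norm (inverse t *\<^sub>R (h (x + t *\<^sub>R u) - h x) - l) \<le> 2 * \<delta>" if t: "0 < t" "t < \<tau>" for t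
    proof -
      define q where "q = inverse t *\<^sub>R (h (x + t *\<^sub>R u) - h x) - l"
      \<comment> \<open>test with the direction of the error, so that an estimate of the inner product bounds its norm\<close>
      define e' where "e' = q /\<^sub>R norm q"
      have e': "norm e' \<le> 1" "e' \<bullet> q = norm q"
        by (cases "q = 0"; simp add: e'_def dot_square_norm power2_eq_square)+
      have le: "e' \<bullet> (h (x + t *\<^sub>R u) - h (x + \<theta> *\<^sub>R u)) \<le> (e' \<bullet> l + 2 * \<delta>) * (t - \<theta>)" if \<theta>: "0 < \<theta>" "\<theta> < t" for \<theta>
      proof -
        have "e' \<bullet> (h ((x + \<theta> *\<^sub>R u) + (t - \<theta>) *\<^sub>R u) - h (x + \<theta> *\<^sub>R u)) \<le> (e' \<bullet> l + 2 * \<delta>) * (t - \<theta>)"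
        proof (rule lipschitz_increment_le_if_jacobian_le[OF L _ \<open>open Z\<close> Or])
          show "x + \<theta> *\<^sub>R u + \<sigma> *\<^sub>R u \<in> Z" if "0 \<le> \<sigma>" "\<sigma> \<le> t - \<theta>" for \<sigma>
            unfolding Z_def using that \<theta> t \<tau>(1)
            by (intro UN_I[of "\<theta> + \<sigma>"]) (auto simp: scaleR_add_left add.assoc)
          show "e' \<bullet> (jacobian h (at y) *v u) \<le> e' \<bullet> l + 2 * \<delta>" if "y \<in> Z" "h differentiable (at y)" for y
          proof -
            have "e' \<bullet> (jacobian h (at y) *v u - l) \<le> norm e' * norm (jacobian h (at y) *v u - l)"
              by (rule norm_cauchy_schwarz)
            also have "\<dots> \<le> 1 * (2 * \<delta>)" using e'(1) jac[OF that] by (intro mult_mono) auto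
            finally show ?thesis by (simp add: inner_diff_right)
          qed
        qed (use \<theta> \<open>0 < r\<close> in auto)
        moreover have "(x + \<theta> *\<^sub>R u) + (t - \<theta>) *\<^sub>R u = x + t *\<^sub>R u" by (simp add: scaleR_diff_left)
        ultimately show ?thesis by simp
      qed
      have "e' \<bullet> (h (x + t *\<^sub>R u) - h x) \<le> (e' \<bullet> l + 2 * \<delta>) * (t - 0)"
      proof -
        have "isCont h x"
          using lipschitz_on_continuous_on[OF L] \<open>0 < r\<close>
          by (intro continuous_on_interior) auto
        moreover have "((\<lambda>\<theta>. x + \<theta> *\<^sub>R u) \<longlongrightarrow> x) (at_right 0)" by (auto intro!: tendsto_eq_intros)
        ultimately have "((\<lambda>\<theta>. h (x + \<theta> *\<^sub>R u)) \<longlongrightarrow> h x) (at_right 0)" by (rule isCont_tendsto_compose)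
        then have A: "((\<lambda>\<theta>. e' \<bullet> (h (x + t *\<^sub>R u) - h (x + \<theta> *\<^sub>R u))) \<longlongrightarrow> e' \<bullet> (h (x + t *\<^sub>R u) - h x)) (at_right 0)"
          by (intro tendsto_intros)
        have B: "((\<lambda>\<theta>. (e' \<bullet> l + 2 * \<delta>) * (t - \<theta>)) \<longlongrightarrow> (e' \<bullet> l + 2 * \<delta>) * (t - 0)) (at_right 0)"
          by (intro tendsto_intros)
        have C: "\<forall>\<^sub>F \<theta> in at_right 0. e' \<bullet> (h (x + t *\<^sub>R u) - h (x + \<theta> *\<^sub>R u)) \<le> (e' \<bullet> l + 2 * \<delta>) * (t - \<theta>)"
          unfolding eventually_at_right_field by (rule exI[of _ t]) (use t(1) le in simp)
        show ?thesis by (rule tendsto_le[OF _ B A C]) simp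
      qed
      then have "e' \<bullet> (t *\<^sub>R q) \<le> t * (2 * \<delta>)"
        using t(1) by (simp add: q_def algebra_simps inner_diff_right inner_add_right)
      then have "norm q \<le> 2 * \<delta>" using t(1) e'(2) by simp
      then show ?thesis by (simp add: q_def)
    qed
    show "\<forall>\<^sub>F t in at_right 0. dist (inverse t *\<^sub>R (h (x + t *\<^sub>R u) - h x)) l < e"
      unfolding eventually_at_right_field
    proof (intro exI[of _ \<tau>] conjI allI impI \<tau>(1))
      fix t assume "0 < t" "t < \<tau>"
      then show "dist (inverse t *\<^sub>R (h (x + t *\<^sub>R u) - h x)) l < e"
        using main[of t] \<open>e > 0\<close> by (simp add: dist_norm \<delta>_def)
    qed
  qed
qed

section \<open>Normals at points where subregularity fails\<close>

lemma normal_cone_scaleR: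
  assumes "z \<in> normal_cone A y" "0 \<le> c"
  shows "c *\<^sub>R z \<in> normal_cone A y"
proof (cases "y \<in> A")
  case True
  then show ?thesis
    using assms by (auto simp: normal_cone_def mult_nonneg_nonpos)
next
  case False
  then show ?thesis using assms by (simp add: normal_cone_def)
qed

lemma normal_cone_mem: "z \<in> normal_cone A y \<Longrightarrow> y \<in> A"
  by (auto simp: normal_cone_def split: if_splits)

text \<open>The normal cone consists of the regular (Frechet) normals, so it contains all proximal ones.\<close>

lemma proximal_normal:
  fixes A :: "'a::euclidean_space set"
  assumes z: "z \<in> A" and "0 < r" and le: "\<And>a. a \<in> A \<Longrightarrow> dist a z < r \<Longrightarrow> norm (y - z) \<le> norm (y - a)"
  shows "y - z \<in> normal_cone A z"
proof -
  have "(y - z) \<bullet> w \<le> 0" if w: "w \<in> tangent_cone A z" for w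
  proof -
    obtain W t where Wt: "W \<longlonglongrightarrow> w" "down0 t" "\<And>i. z + t i *\<^sub>R W i \<in> A"
      using w unfolding tangent_cone_def by blast
    have t: "\<And>i. 0 < t i" "t \<longlonglongrightarrow> 0" using Wt(2) by (auto simp: down0_def)
    have "(\<lambda>i. z + t i *\<^sub>R W i) \<longlonglongrightarrow> z + 0 *\<^sub>R w" by (intro tendsto_intros t Wt)
    then have "\<forall>\<^sub>F i in sequentially. dist (z + t i *\<^sub>R W i) z < r"
      using \<open>0 < r\<close> by (intro tendstoD) auto
    then have "\<forall>\<^sub>F i in sequentially. (y - z) \<bullet> W i \<le> t i * (norm (W i))\<^sup>2 / 2"
    proof eventually_elim
      case (elim i)
      have "(norm (y - z))\<^sup>2 \<le> (norm (y - (z + t i *\<^sub>R W i)))\<^sup>2"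
        using le[OF Wt(3) elim] by (intro power_mono) auto
      also have "y - (z + t i *\<^sub>R W i) = (y - z) - t i *\<^sub>R W i" by simp
      also have "(norm ((y - z) - t i *\<^sub>R W i))\<^sup>2 = (norm (y - z))\<^sup>2 - 2 * t i * ((y - z) \<bullet> W i) + (t i)\<^sup>2 * (norm (W i))\<^sup>2"
        unfolding power2_norm_eq_inner
        by (simp add: inner_diff_left inner_diff_right inner_commute power2_eq_square algebra_simps)
      finally have "t i * (2 * ((y - z) \<bullet> W i)) \<le> t i * (t i * (norm (W i))\<^sup>2)"
        by (simp add: power2_eq_square)
      then show ?case using t(1)[of i] by simp
    qed
    moreover have "(\<lambda>i. (y - z) \<bullet> W i) \<longlonglongrightarrow> (y - z) \<bullet> w"
      by (intro tendsto_intros Wt)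
    moreover have "(\<lambda>i. t i * (norm (W i))\<^sup>2 / 2) \<longlonglongrightarrow> 0 * (norm w)\<^sup>2 / 2"
      by (intro tendsto_intros Wt t) auto
    ultimately have "(y - z) \<bullet> w \<le> 0 * (norm w)\<^sup>2 / 2"
      by (intro tendsto_le[OF sequentially_bot])
    then show ?thesis by simp
  qed
  then show ?thesis using z by (simp add: normal_cone_def)
qed

lemma norm_add_squared:
  fixes a b :: "'a::real_inner"
  shows "(norm (a + b))\<^sup>2 = (norm a)\<^sup>2 + 2 * (a \<bullet> b) + (norm b)\<^sup>2"
  unfolding power2_norm_eq_inner by (simp add: inner_add_left inner_add_right inner_commute)

lemma norm_diff_le_linearization:
  fixes a d :: "'a::real_inner"
  assumes "a \<noteq> 0"
  shows "norm (a - d) \<le> norm a - (a /\<^sub>R norm a) \<bullet> d + (norm d)\<^sup>2 / (2 * norm a)"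
proof -
  have "0 \<le> (norm (a - d) - norm a)\<^sup>2" by simp
  then have "2 * norm a * norm (a - d) \<le> (norm (a - d))\<^sup>2 + (norm a)\<^sup>2"
    by (simp add: power2_eq_square algebra_simps)
  also have "(norm (a - d))\<^sup>2 = (norm a)\<^sup>2 - 2 * (a \<bullet> d) + (norm d)\<^sup>2"
    unfolding power2_norm_eq_inner by (simp add: inner_diff_left inner_diff_right inner_commute)
  finally show ?thesis
    using assms by (simp add: field_simps power2_eq_square)
qed

text \<open>Failure of subregularity of \<open>K - f\<close> on \<open>D\<close>, in Euclidean norms and without extended reals: there
  are points of \<open>D\<close> close to \<open>xb\<close> whose distance to the solution set is arbitrarily large
  compared to the residual, witnessed by a single \<open>k \<in> K\<close>. As \<open>xb\<close> is a solution, the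
  strict inequality forces the residual to be positive.\<close>

definition nonsubregular :: "'a::euclidean_space set \<Rightarrow> 'b::euclidean_space set \<Rightarrow> ('a \<Rightarrow> 'b) \<Rightarrow> 'a \<Rightarrow> bool" where
  "nonsubregular D K f xb \<longleftrightarrow> (\<forall>\<kappa>>0. \<forall>\<delta>>0. \<exists>x\<in>D. \<exists>k\<in>K. norm (x - xb) < \<delta> \<and>
     (\<forall>x'\<in>D. f x' \<in> K \<longrightarrow> \<kappa> * norm (k - f x) < norm (x - x')))"

text \<open>A variational principle with decoupled variables. Let \<open>x0\<close> be a point with small residual far from the
  solutions, and minimise \<open>|q - f x| + \<Lambda> |x - p|\<^sup>2 + \<eta> |x - x0|\<close> over \<open>x\<close> near \<open>xb\<close>, \<open>p \<in> D\<close> and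
  \<open>q \<in> K\<close>. The penalty lets each constraint act on a variable of its own: minimality in \<open>p\<close> and in \<open>q\<close>
  gives proximal normals to \<open>D\<close> and \<open>K\<close>, and minimality in \<open>x\<close> is a first-order inequality for \<open>f\<close>
  without constraints. The last term keeps \<open>x\<close> away from the solutions. For large \<open>\<Lambda>\<close> the residual at
  the minimiser is nonzero, because otherwise the minimisers would accumulate at a solution close to
  \<open>x0\<close>; so its direction \<open>vs\<close> is a unit vector.\<close>

lemma nonsubregular_proximal_point:
  fixes f :: "real^'n \<Rightarrow> real^'m"
  assumes cD: "closed D" and cK: "closed K" and xb: "xb \<in> D" "f xb \<in> K" and "0 < r"
    and L: "L-lipschitz_on (cball xb r) f"
    and nonsub: "nonsubregular D K f xb"
    and \<eta>: "0 < \<eta>" "\<eta> \<le> 1"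
  shows "\<exists>x p q ps vs c. x \<noteq> xb \<and> norm (x - xb) < \<eta> \<and> norm (x - xb) < r \<and> norm (p - x) \<le> \<eta> * norm (x - xb) \<and>
     norm (q - f x) \<le> \<eta> * norm (x - xb) \<and> ps \<in> normal_cone D p \<and> - vs \<in> normal_cone K q \<and> norm vs = 1 \<and>
     (\<forall>\<^sub>F y in nhds x. 0 \<le> - (vs \<bullet> (f y - f x)) + ps \<bullet> (y - x) + \<eta> * norm (y - x) + c * (norm (y - x))\<^sup>2)"
proof -
  \<comment> \<open>with the factor \<open>4 / \<eta>\<close> the minimiser stays within a quarter of the distance from \<open>x0\<close> to the solutions\<close>
  have "0 < 4 / \<eta>" "0 < min \<eta> r / 2" using \<eta> \<open>0 < r\<close> by auto
  then obtain x0 k where x0: "x0 \<in> D" and k: "k \<in> K" and x0b: "norm (x0 - xb) < min \<eta> r / 2"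
    and far: "\<And>x'. x' \<in> D \<Longrightarrow> f x' \<in> K \<Longrightarrow> 4 / \<eta> * norm (k - f x0) < norm (x0 - x')"
    using nonsub unfolding nonsubregular_def by blast
  define a where "a = norm (k - f x0)"
  define \<beta> where "\<beta> = 4 / \<eta> * a"
  have a\<beta>: "a = \<eta> * \<beta> / 4" using \<eta> by (simp add: \<beta>_def)
  have a0: "a > 0"
  proof (rule ccontr)
    assume "\<not> a > 0"
    then have "k = f x0" by (simp add: a_def)
    then show False using far[OF x0] k by simp
  qed
  then have \<beta>0: "\<beta> > 0" using \<eta> by (simp add: \<beta>_def)
  have far': "\<beta> < norm (x0 - x')" if "x' \<in> D" "f x' \<in> K" for x'
    using far[OF that] by (simp add: \<beta>_def a_def)
  have \<beta>xb: "\<beta> < norm (x0 - xb)" using far'[OF xb] .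
  have L0: "0 \<le> L" using L by (rule lipschitz_on_nonneg)
  have fL: "norm (f x - f y) \<le> L * norm (x - y)" if "x \<in> cball xb r" "y \<in> cball xb r" for x y
    using lipschitz_onD[OF L that] by (simp add: dist_norm)
  have fc: "continuous_on (cball xb r) f" using L by (rule lipschitz_on_continuous_on)
  define R where "R = L * r + a + 1"
  define C where "C = cball xb r \<times> ((D \<inter> cball xb r) \<times> (K \<inter> cball (f xb) R))"
  have "compact C"
    unfolding C_def by (intro compact_Times compact_cball closed_Int_compact cD cK)
  have x0r: "x0 \<in> cball xb r" using x0b \<open>0 < r\<close> by (simp add: dist_norm norm_minus_commute)
  have fx_le: "norm (f x - f xb) \<le> L * r" if "x \<in> cball xb r" for x
  proof -
    have "norm (f x - f xb) \<le> L * norm (x - xb)" using that \<open>0 < r\<close> by (intro fL) auto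
    also have "\<dots> \<le> L * r" using that L0 by (intro mult_left_mono) (auto simp: dist_norm norm_minus_commute)
    finally show ?thesis .
  qed
  have "norm (k - f xb) \<le> a + L * r"
    using norm_triangle_ineq[of "k - f x0" "f x0 - f xb"] fx_le[OF x0r] by (simp add: a_def)
  then have feas: "(x0, x0, k) \<in> C"
    using x0 k x0r by (simp add: C_def R_def dist_norm norm_minus_commute)
  \<comment> \<open>the scaling makes \<open>|x - p|\<close> at most \<open>\<eta> \<beta> / 2\<close>, and tend to 0 as \<open>j\<close> grows\<close>
  define \<Lambda> where "\<Lambda> j = real (Suc j) * a / (\<eta> * \<beta> / 2)\<^sup>2" for j
  have \<Lambda>0: "\<Lambda> j > 0" for j using a0 \<eta> \<beta>0 by (simp add: \<Lambda>_def)
  define \<Phi> where "\<Phi> j z = (case z of (x, p, q) \<Rightarrow> norm (q - f x) + \<Lambda> j * (norm (x - p))\<^sup>2 + \<eta> * norm (x - x0))" for j z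
  have \<Phi>x0: "\<Phi> j (x0, x0, k) = a" for j by (simp add: \<Phi>_def a_def)
  have "\<exists>z\<in>C. \<forall>z'\<in>C. \<Phi> j z \<le> \<Phi> j z'" for j
  proof (rule continuous_attains_inf[OF \<open>compact C\<close>])
    show "C \<noteq> {}" using feas by auto
    have "continuous_on C (\<lambda>z. f (fst z))"
      by (rule continuous_on_compose2[OF fc]) (auto simp: C_def intro!: continuous_intros)
    then show "continuous_on C (\<Phi> j)"
      unfolding \<Phi>_def case_prod_beta by (intro continuous_intros)
  qed
  then obtain z where z: "\<And>j. z j \<in> C" "\<And>j z'. z' \<in> C \<Longrightarrow> \<Phi> j (z j) \<le> \<Phi> j z'" by metis
  define X P Q where "X j = fst (z j)" and "P j = fst (snd (z j))" and "Q j = snd (snd (z j))" for j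
  have zX: "z j = (X j, P j, Q j)" for j by (simp add: X_def P_def Q_def)
  have inC: "X j \<in> cball xb r" "P j \<in> D" "P j \<in> cball xb r" "Q j \<in> K" for j
    using z(1)[of j] by (auto simp: zX C_def)
  have val: "norm (Q j - f (X j)) + \<Lambda> j * (norm (X j - P j))\<^sup>2 + \<eta> * norm (X j - x0) \<le> a" for j
    using z(2)[OF feas, of j] unfolding \<Phi>x0 zX by (simp add: \<Phi>_def)
  have nn: "0 \<le> norm (Q j - f (X j))" "0 \<le> \<Lambda> j * (norm (X j - P j))\<^sup>2" "0 \<le> \<eta> * norm (X j - x0)" for j
    using \<Lambda>0[of j] \<eta> by auto
  have q_le: "norm (Q j - f (X j)) \<le> a" for j using val[of j] nn[of j] by linarith
  have x_le: "norm (X j - x0) \<le> \<beta> / 4" for j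
  proof -
    have "\<eta> * norm (X j - x0) \<le> a" using val[of j] nn[of j] by linarith
    then have "\<eta> * norm (X j - x0) \<le> \<eta> * (\<beta> / 4)" by (simp add: a\<beta>)
    then show ?thesis using \<eta> by simp
  qed
  have p_le: "(norm (X j - P j))\<^sup>2 \<le> (\<eta> * \<beta> / 2)\<^sup>2 / real (Suc j)" for j
  proof -
    have le: "\<Lambda> j * (norm (X j - P j))\<^sup>2 \<le> a" using val[of j] nn[of j] by linarith
    have B: "0 < (\<eta> * \<beta> / 2)\<^sup>2" using \<eta> \<beta>0 by simp
    have "a * (real (Suc j) * (norm (X j - P j))\<^sup>2) = \<Lambda> j * (norm (X j - P j))\<^sup>2 * (\<eta> * \<beta> / 2)\<^sup>2"
      using \<eta> \<beta>0 unfolding \<Lambda>_def by simp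
    also have "\<dots> \<le> a * (\<eta> * \<beta> / 2)\<^sup>2" using le B by (intro mult_right_mono) auto
    finally have "real (Suc j) * (norm (X j - P j))\<^sup>2 \<le> (\<eta> * \<beta> / 2)\<^sup>2"
      using a0 mult_le_cancel_left_pos by blast
    moreover have "0 < real (Suc j)" by simp
    ultimately show ?thesis by (simp only: pos_le_divide_eq mult.commute)
  qed
  have p_le': "norm (X j - P j) \<le> \<eta> * \<beta> / 2" for j
  proof -
    have "(norm (X j - P j))\<^sup>2 \<le> (\<eta> * \<beta> / 2)\<^sup>2"
    proof (rule order_trans[OF p_le[of j]])
      have "(\<eta> * \<beta> / 2)\<^sup>2 / real (Suc j) \<le> (\<eta> * \<beta> / 2)\<^sup>2 / 1" by (rule divide_left_mono) auto
      then show "(\<eta> * \<beta> / 2)\<^sup>2 / real (Suc j) \<le> (\<eta> * \<beta> / 2)\<^sup>2" by simp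
    qed
    then show ?thesis by (rule power2_le_imp_le) (use \<eta> \<beta>0 in simp)
  qed
  have "\<exists>j. Q j \<noteq> f (X j)"
  proof (rule ccontr)
    assume "\<not> ?thesis"
    then have eq: "f (X j) = Q j" for j by simp
    have "\<forall>j. X j \<in> cball xb r" using inC by simp
    then obtain x \<sigma> where x: "x \<in> cball xb r" "strict_mono (\<sigma> :: nat \<Rightarrow> nat)" "(X \<circ> \<sigma>) \<longlonglongrightarrow> x"
      using compact_imp_seq_compact[OF compact_cball] unfolding seq_compact_def by meson
    have "(\<lambda>j. (norm (X j - P j))\<^sup>2) \<longlonglongrightarrow> 0"
    proof (rule Lim_null_comparison)
      show "\<forall>\<^sub>F j in sequentially. norm ((norm (X j - P j))\<^sup>2) \<le> (\<eta> * \<beta> / 2)\<^sup>2 * inverse (real (Suc j))"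
      proof (rule always_eventually, rule allI)
        show "norm ((norm (X j - P j))\<^sup>2) \<le> (\<eta> * \<beta> / 2)\<^sup>2 * inverse (real (Suc j))" for j
          using p_le[of j] by (simp only: real_norm_def abs_of_nonneg[OF zero_le_power2] divide_inverse[of _ "real (Suc j)"])
      qed
      show "(\<lambda>j. (\<eta> * \<beta> / 2)\<^sup>2 * inverse (real (Suc j))) \<longlonglongrightarrow> 0"
        by (intro tendsto_mult_right_zero LIMSEQ_inverse_real_of_nat)
    qed
    then have "(\<lambda>j. sqrt ((norm (X j - P j))\<^sup>2)) \<longlonglongrightarrow> sqrt 0" by (intro tendsto_intros)
    then have "(\<lambda>j. X j - P j) \<longlonglongrightarrow> 0" by (simp add: tendsto_norm_zero_iff)
    from LIMSEQ_subseq_LIMSEQ[OF this x(2)]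
    have "(\<lambda>j. X (\<sigma> j) - P (\<sigma> j)) \<longlonglongrightarrow> 0" by (simp add: o_def)
    then have "(\<lambda>j. X (\<sigma> j) - (X (\<sigma> j) - P (\<sigma> j))) \<longlonglongrightarrow> x - 0"
      using x(3) by (intro tendsto_diff) (simp_all add: o_def)
    then have "(\<lambda>j. P (\<sigma> j)) \<longlonglongrightarrow> x" by simp
    then have xD: "x \<in> D" by (rule closed_sequentially[OF cD, rotated]) (rule inC)
    have "(\<lambda>j. f (X (\<sigma> j))) \<longlonglongrightarrow> f x"
      by (rule continuous_on_tendsto_compose[OF fc x(3)[unfolded o_def] x(1)])
        (rule always_eventually, rule allI, rule inC)
    then have xK: "f x \<in> K" by (rule closed_sequentially[OF cK, rotated]) (simp only: eq inC)
    have "(\<lambda>j. norm (X (\<sigma> j) - x0)) \<longlonglongrightarrow> norm (x - x0)"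
      by (intro tendsto_intros x(3)[unfolded o_def])
    then have "norm (x - x0) \<le> \<beta> / 4"
      by (rule LIMSEQ_le_const2) (use x_le in blast)
    then show False using far'[OF xD xK] \<beta>0 by (simp add: norm_minus_commute)
  qed
  then obtain j where j: "Q j \<noteq> f (X j)" by blast
  define x p q where "x = X j" and "p = P j" and "q = Q j"
  have x_near: "norm (x - xb) \<le> 5 / 4 * norm (x0 - xb)" "3 / 4 * norm (x0 - xb) \<le> norm (x - xb)"
    using x_le[of j] \<beta>xb norm_triangle_ineq[of "x - x0" "x0 - xb"] norm_triangle_ineq[of "x0 - x" "x - xb"]
    by (auto simp: x_def norm_minus_commute)
  have \<beta>x: "3 / 4 * \<beta> < norm (x - xb)" using x_near(2) \<beta>xb by linarith
  have xr: "norm (x - xb) < r" "norm (x - xb) < \<eta>" using x_near(1) x0b \<open>0 < r\<close> \<eta> by auto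
  have x_less: "norm (x - xb) \<le> 5 / 8 * r" using x_near(1) x0b by auto
  have "\<beta> < r / 2" using \<beta>xb x0b by auto
  have px: "norm (x - p) \<le> \<eta> * \<beta> / 2" using p_le'[of j] by (simp add: x_def p_def)
  moreover have "\<eta> * \<beta> \<le> \<beta>" using \<eta> \<beta>0 by simp
  ultimately have "norm (x - p) < r / 4" using \<open>\<beta> < r / 2\<close> by linarith
  then have pr: "norm (p - xb) < r"
    using x_less \<open>0 < r\<close> norm_triangle_ineq[of "p - x" "x - xb"] by (simp add: norm_minus_commute)
  have px2: "norm (p - x) \<le> \<eta> * norm (x - xb)"
  proof -
    have "\<eta> * \<beta> / 2 \<le> \<eta> * norm (x - xb)" using \<beta>x \<beta>0 \<eta> by (simp add: mult.assoc[symmetric])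
    then show ?thesis using px by (simp add: norm_minus_commute)
  qed
  have qx: "norm (q - f x) \<le> a" using q_le[of j] by (simp add: q_def x_def)
  have qx2: "norm (q - f x) \<le> \<eta> * norm (x - xb)"
  proof -
    have "a \<le> \<eta> * norm (x - xb)" unfolding a\<beta> using \<beta>x \<beta>0 \<eta> by (simp add: mult.assoc[symmetric])
    then show ?thesis using qx by linarith
  qed
  have xc: "x \<in> cball xb r" using inC by (simp add: x_def)
  have qR: "norm (q - f xb) \<le> R - 1"
    using norm_triangle_ineq[of "q - f x" "f x - f xb"] fx_le[OF xc] qx by (simp add: R_def)
  have pD: "p \<in> D" and qK: "q \<in> K" using inC by (auto simp: p_def q_def)
  have opt: "norm (q - f x) + \<Lambda> j * (norm (x - p))\<^sup>2 + \<eta> * norm (x - x0)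
       \<le> norm (q' - f x') + \<Lambda> j * (norm (x' - p'))\<^sup>2 + \<eta> * norm (x' - x0)"
    if "x' \<in> cball xb r" "p' \<in> D" "p' \<in> cball xb r" "q' \<in> K" "q' \<in> cball (f xb) R" for x' p' q'
    using z(2)[of "(x', p', q')" j] that unfolding zX by (simp add: \<Phi>_def C_def x_def p_def q_def)
  have pc: "p \<in> cball xb r" and qc: "q \<in> cball (f xb) R"
    using pr qR by (auto simp: dist_norm norm_minus_commute)
  have "x - p \<in> normal_cone D p"
  proof (rule proximal_normal[OF pD])
    show "0 < r - norm (p - xb)" using pr by simp
    fix p' assume p': "p' \<in> D" "dist p' p < r - norm (p - xb)"
    then have "p' \<in> cball xb r"
      using norm_triangle_ineq[of "p' - p" "p - xb"] by (simp add: dist_norm norm_minus_commute)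
    then have "\<Lambda> j * (norm (x - p))\<^sup>2 \<le> \<Lambda> j * (norm (x - p'))\<^sup>2"
      using opt[OF xc p'(1) _ qK qc] by simp
    then have "(norm (x - p))\<^sup>2 \<le> (norm (x - p'))\<^sup>2"
      using \<Lambda>0[of j] by simp
    then show "norm (x - p) \<le> norm (x - p')" by (rule power2_le_imp_le) simp
  qed
  then have N1: "(2 * \<Lambda> j) *\<^sub>R (x - p) \<in> normal_cone D p"
    using \<Lambda>0[of j] by (intro normal_cone_scaleR) auto
  have "f x - q \<in> normal_cone K q"
  proof (rule proximal_normal[OF qK])
    show "0 < (1::real)" by simp
    fix q' assume q': "q' \<in> K" "dist q' q < 1"
    then have "q' \<in> cball (f xb) R"
      using norm_triangle_ineq[of "q' - q" "q - f xb"] qR by (simp add: dist_norm norm_minus_commute)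
    then show "norm (f x - q) \<le> norm (f x - q')"
      using opt[OF xc pD pc q'(1)] by (simp add: norm_minus_commute)
  qed
  then have "inverse (norm (q - f x)) *\<^sub>R (f x - q) \<in> normal_cone K q"
    by (rule normal_cone_scaleR) simp
  define vs where "vs = (q - f x) /\<^sub>R norm (q - f x)"
  have "- vs = inverse (norm (q - f x)) *\<^sub>R (f x - q)"
    by (simp add: vs_def flip: scaleR_minus_right)
  then have N2: "- vs \<in> normal_cone K q" using \<open>inverse _ *\<^sub>R _ \<in> _\<close> by simp
  have qf: "q - f x \<noteq> 0" using j by (simp add: q_def x_def)
  then have vs1: "norm vs = 1" by (simp add: vs_def)
  define c where "c = L\<^sup>2 / (2 * norm (q - f x)) + \<Lambda> j"
  have "\<forall>\<^sub>F y in nhds x. y \<in> ball xb r"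
    using xr by (intro eventually_nhds_in_open) (auto simp: dist_norm norm_minus_commute)
  then have ev: "\<forall>\<^sub>F y in nhds x. 0 \<le> - (vs \<bullet> (f y - f x)) + ((2 * \<Lambda> j) *\<^sub>R (x - p)) \<bullet> (y - x) + \<eta> * norm (y - x) + c * (norm (y - x))\<^sup>2"
  proof eventually_elim
    case (elim y)
    then have yc: "y \<in> cball xb r" by simp
    have "norm (q - f y) = norm ((q - f x) - (f y - f x))" by simp
    also have "\<dots> \<le> norm (q - f x) - vs \<bullet> (f y - f x) + (norm (f y - f x))\<^sup>2 / (2 * norm (q - f x))"
      unfolding vs_def by (rule norm_diff_le_linearization[OF qf])
    also have "(norm (f y - f x))\<^sup>2 / (2 * norm (q - f x)) \<le> L\<^sup>2 * (norm (y - x))\<^sup>2 / (2 * norm (q - f x))"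
      using power_mono[OF fL[OF yc xc], of 2] by (intro divide_right_mono) (auto simp: power_mult_distrib)
    finally have 1: "norm (q - f y) \<le> norm (q - f x) - vs \<bullet> (f y - f x) + L\<^sup>2 * (norm (y - x))\<^sup>2 / (2 * norm (q - f x))"
      by simp
    have eq: "(norm (y - p))\<^sup>2 = (norm (x - p))\<^sup>2 + 2 * ((x - p) \<bullet> (y - x)) + (norm (y - x))\<^sup>2"
      using norm_add_squared[of "x - p" "y - x"] by simp
    have 2: "\<Lambda> j * (norm (y - p))\<^sup>2 = \<Lambda> j * (norm (x - p))\<^sup>2 + ((2 * \<Lambda> j) *\<^sub>R (x - p)) \<bullet> (y - x) + \<Lambda> j * (norm (y - x))\<^sup>2"
      unfolding eq by (simp only: distrib_left inner_scaleR_left mult_ac)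
    have "\<eta> * norm (y - x0) \<le> \<eta> * (norm (x - x0) + norm (y - x))"
      using \<eta> norm_triangle_ineq[of "x - x0" "y - x"] by (intro mult_left_mono) auto
    then have 3: "\<eta> * norm (y - x0) \<le> \<eta> * norm (x - x0) + \<eta> * norm (y - x)" by (simp add: distrib_left)
    have 4: "c * (norm (y - x))\<^sup>2 = L\<^sup>2 * (norm (y - x))\<^sup>2 / (2 * norm (q - f x)) + \<Lambda> j * (norm (y - x))\<^sup>2"
      by (simp add: c_def distrib_right)
    show ?case using opt[OF yc pD pc qK qc] 1 2 3 4 by linarith
  qed
  have "x \<noteq> xb" using \<beta>x \<beta>0 by auto
  then show ?thesis
    using xr px2 qx2 N1 N2 vs1 ev by blast
qed

section \<open>Functions of class C1\<close>

lemma norm_matrix_vector_mult_le: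
  fixes A :: "real^'n^'m"
  shows "norm (A *v x) \<le> norm A * norm x"
proof -
  have "norm (A *v x) = L2_set (\<lambda>i. norm ((A *v x) $ i)) UNIV" by (simp add: norm_vec_def)
  also have "\<dots> \<le> L2_set (\<lambda>i. norm (A $ i) * norm x) UNIV"
    by (intro L2_set_mono) (auto simp: matrix_vector_mul_component Cauchy_Schwarz_ineq2)
  also have "\<dots> = norm A * norm x"
    by (simp add: norm_vec_def[of A] L2_set_left_distrib)
  finally show ?thesis .
qed

lemma C1_aroundE:
  fixes h :: "real^'n \<Rightarrow> real^'m"
  assumes "C1_around h x0"
  obtains r where "r > 0" "\<And>x. x \<in> ball x0 r \<Longrightarrow> h differentiable (at x)"
    "continuous_on (ball x0 r) (\<lambda>x. jacobian h (at x))"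
proof -
  obtain U where U: "open U" "x0 \<in> U" "\<And>x. x \<in> U \<Longrightarrow> h differentiable (at x)"
    "continuous_on U (\<lambda>x. jacobian h (at x))" using assms unfolding C1_around_def by blast
  obtain r where "r > 0" "ball x0 r \<subseteq> U" using U openE by blast
  then show thesis using that U continuous_on_subset by blast
qed

text \<open>The mean value inequality for \<open>h - jacobian h (at x0)\<close>, whose derivative is small near \<open>x0\<close>.\<close>

lemma C1_strict_differentiability:
  fixes h :: "real^'n \<Rightarrow> real^'m"
  assumes C1: "C1_around h x0" and "e > 0"
  obtains r where "r > 0" "\<And>x. x \<in> ball x0 r \<Longrightarrow> h differentiable (at x)"
    "\<And>x. x \<in> ball x0 r \<Longrightarrow> norm (jacobian h (at x) - jacobian h (at x0)) \<le> e"
    "\<And>x x'. x \<in> ball x0 r \<Longrightarrow> x' \<in> ball x0 r \<Longrightarrow>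
      norm (h x - h x' - jacobian h (at x0) *v (x - x')) \<le> e * norm (x - x')"
proof -
  define J where "J x = jacobian h (at x)" for x
  obtain r0 where r0: "r0 > 0" "\<And>x. x \<in> ball x0 r0 \<Longrightarrow> h differentiable (at x)"
    "continuous_on (ball x0 r0) J" using C1_aroundE[OF C1] unfolding J_def by metis
  have "isCont J x0" using r0 by (intro continuous_on_interior[OF r0(3)]) auto
  then obtain d where d: "d > 0" "\<And>x. dist x x0 < d \<Longrightarrow> dist (J x) (J x0) < e"
    unfolding continuous_at_eps_delta using \<open>e > 0\<close> by blast
  define r where "r = min r0 d"
  have diff: "h differentiable (at x)" and J_le: "norm (J x - J x0) \<le> e" if "x \<in> ball x0 r" for x
  proof -
    have x: "x \<in> ball x0 r0" "dist x x0 < d" using that by (auto simp: r_def dist_commute)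
    show "h differentiable (at x)" by (rule r0(2)[OF x(1)])
    show "norm (J x - J x0) \<le> e" using d(2)[OF x(2)] by (simp add: dist_norm)
  qed
  have der: "((\<lambda>x. h x - J x0 *v x) has_derivative (\<lambda>v. (J x - J x0) *v v)) (at x within ball x0 r)"
    if "x \<in> ball x0 r" for x
  proof -
    have "(h has_derivative (\<lambda>v. J x *v v)) (at x)"
      using diff[OF that] unfolding J_def by (simp flip: jacobian_works)
    then have "((\<lambda>x. h x - J x0 *v x) has_derivative (\<lambda>v. J x *v v - J x0 *v v)) (at x)"
      by (intro has_derivative_diff bounded_linear_imp_has_derivative matrix_vector_mul_bounded_linear)
    then show ?thesis
      by (simp add: matrix_vector_mult_diff_rdistrib has_derivative_at_withinI)
  qed
  have on: "onorm (\<lambda>v. (J x - J x0) *v v) \<le> e" if "x \<in> ball x0 r" for x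
  proof (rule onorm_le)
    show "norm ((J x - J x0) *v v) \<le> e * norm v" for v
      using norm_matrix_vector_mult_le[of "J x - J x0" v] mult_right_mono[OF J_le[OF that], of "norm v"] by simp
  qed
  have "norm (h x - h x' - J x0 *v (x - x')) \<le> e * norm (x - x')" if "x \<in> ball x0 r" "x' \<in> ball x0 r" for x x'
  proof -
    have "norm ((h x - J x0 *v x) - (h x' - J x0 *v x')) \<le> e * norm (x - x')"
      by (rule differentiable_bound[OF convex_ball der on]) (use that in auto)
    then show ?thesis by (simp add: matrix_vector_mult_diff_distrib algebra_simps)
  qed
  moreover have "r > 0" using r0(1) d(1) by (simp add: r_def)
  ultimately show thesis using that[of r] diff J_le by (simp add: J_def)
qed

lemma C1_lipschitz_near:
  fixes h :: "real^'n \<Rightarrow> real^'m"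
  assumes C1: "C1_around h x0"
  obtains r L where "r > 0" "L-lipschitz_on (cball x0 r) h"
proof -
  obtain r where r: "r > 0" "\<And>x x'. x \<in> ball x0 r \<Longrightarrow> x' \<in> ball x0 r \<Longrightarrow>
      norm (h x - h x' - jacobian h (at x0) *v (x - x')) \<le> 1 * norm (x - x')"
    by (rule C1_strict_differentiability[OF C1 zero_less_one]) blast
  define L where "L = norm (jacobian h (at x0)) + 1"
  have "L-lipschitz_on (cball x0 (r/2)) h"
  proof (rule lipschitz_onI)
    fix x x' assume "x \<in> cball x0 (r/2)" "x' \<in> cball x0 (r/2)"
    then have "norm (h x - h x' - jacobian h (at x0) *v (x - x')) \<le> norm (x - x')"
      using r(2)[of x x'] r(1) by simp
    then show "dist (h x) (h x') \<le> L * dist x x'"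
      using norm_matrix_vector_mult_le[of "jacobian h (at x0)" "x - x'"]
        norm_triangle_ineq[of "h x - h x' - jacobian h (at x0) *v (x - x')" "jacobian h (at x0) *v (x - x')"]
      by (simp add: L_def dist_norm distrib_right)
  qed (simp add: L_def)
  then show thesis using that[of "r/2"] r(1) by simp
qed

lemma C1_imp_lipschitz_around:
  assumes "C1_around h x0"
  shows "lipschitz_around h x0"
proof -
  obtain r L where "r > 0" "L-lipschitz_on (cball x0 r) h" using C1_lipschitz_near[OF assms] by metis
  then have "open (ball x0 r) \<and> x0 \<in> ball x0 r \<and> L-lipschitz_on (ball x0 r) h"
    by (auto intro: lipschitz_on_subset)
  then show ?thesis unfolding lipschitz_around_def by blast
qed

text \<open>All limits of Jacobians coincide with the Jacobian at \<open>y\<close>.\<close>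

lemma clarke_jacobian_C1:
  fixes h :: "real^'n \<Rightarrow> real^'m"
  assumes "isCont (\<lambda>x. jacobian h (at x)) y" "V \<in> clarke_jacobian h y"
  shows "V = jacobian h (at y)"
proof -
  have "limiting_jacobians h y \<subseteq> {jacobian h (at y)}"
  proof
    fix V assume "V \<in> limiting_jacobians h y"
    then obtain X where X: "X \<longlonglongrightarrow> y" "(\<lambda>k. jacobian h (at (X k))) \<longlonglongrightarrow> V"
      unfolding limiting_jacobians_def by blast
    have "(\<lambda>k. jacobian h (at (X k))) \<longlonglongrightarrow> jacobian h (at y)"
      by (rule isCont_tendsto_compose[OF assms(1) X(1)])
    then show "V \<in> {jacobian h (at y)}" using X(2) LIMSEQ_unique by blast
  qed
  then have "clarke_jacobian h y \<subseteq> {jacobian h (at y)}"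
    unfolding clarke_jacobian_eq by (rule hull_minimal) simp
  then show ?thesis using assms(2) by blast
qed

lemma C1_imp_semismooth:
  fixes h :: "real^'n \<Rightarrow> real^'m"
  assumes C1: "C1_around h x0"
  shows "semismooth_at h x0"
  unfolding semismooth_at_def
proof (intro conjI allI exI impI)
  show "lipschitz_around h x0" using C1 by (rule C1_imp_lipschitz_around)
  fix u and t :: "nat \<Rightarrow> real" and W :: "nat \<Rightarrow> real^'n" and V :: "nat \<Rightarrow> real^'n^'m"
  assume *: "down0 t \<and> W \<longlonglongrightarrow> u \<and> (\<forall>i. V i \<in> clarke_jacobian h (x0 + t i *\<^sub>R W i))"
  obtain r where r: "r > 0" "continuous_on (ball x0 r) (\<lambda>x. jacobian h (at x))"
    using C1_aroundE[OF C1] by metis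
  have cont: "isCont (\<lambda>x. jacobian h (at x)) y" if "y \<in> ball x0 r" for y
    by (rule continuous_on_interior[OF r(2)]) (use that in simp)
  have "(\<lambda>i. x0 + t i *\<^sub>R W i) \<longlonglongrightarrow> x0 + 0 *\<^sub>R u"
    using * by (intro tendsto_intros) (auto simp: down0_def)
  then have lim: "(\<lambda>i. x0 + t i *\<^sub>R W i) \<longlonglongrightarrow> x0" by simp
  have "(\<lambda>i. jacobian h (at (x0 + t i *\<^sub>R W i)) *v W i) \<longlonglongrightarrow> jacobian h (at x0) *v u"
    using * r(1) by (intro matrix_vector_mult_tendsto isCont_tendsto_compose[OF cont lim]) auto
  moreover have "\<forall>\<^sub>F i in sequentially. x0 + t i *\<^sub>R W i \<in> ball x0 r"
    using lim r(1) by (intro topological_tendstoD) auto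
  then have "\<forall>\<^sub>F i in sequentially. jacobian h (at (x0 + t i *\<^sub>R W i)) *v W i = V i *v W i"
  proof eventually_elim
    case (elim i)
    have "V i = jacobian h (at (x0 + t i *\<^sub>R W i))"
      by (rule clarke_jacobian_C1[OF cont[OF elim]]) (use * in blast)
    then show ?case by simp
  qed
  ultimately show "(\<lambda>i. V i *v W i) \<longlonglongrightarrow> jacobian h (at x0) *v u"
    by (rule Lim_transform_eventually)
qed

lemma C1_directional_quotient:
  fixes g :: "real^'n \<Rightarrow> real^'m"
  assumes C1: "C1_around g xb" and t: "down0 t" and P: "P \<longlonglongrightarrow> u"
  shows "(\<lambda>i. inverse (t i) *\<^sub>R (g (xb + t i *\<^sub>R P i) - g xb)) \<longlonglongrightarrow> jacobian g (at xb) *v u"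
proof -
  have t0: "0 < t i" "t \<longlonglongrightarrow> 0" for i using t by (auto simp: down0_def)
  have "(\<lambda>i. xb + t i *\<^sub>R P i) \<longlonglongrightarrow> xb + 0 *\<^sub>R u" by (intro tendsto_intros t0 P)
  then have xlim: "(\<lambda>i. xb + t i *\<^sub>R P i) \<longlonglongrightarrow> xb" by simp
  have "convergent P" using P by (auto simp: convergent_def)
  then obtain C where C: "C > 0" "\<And>i. norm (P i) \<le> C"
    using convergent_imp_Bseq[of P] unfolding Bseq_def by blast
  define R where "R i = g (xb + t i *\<^sub>R P i) - g xb - jacobian g (at xb) *v (t i *\<^sub>R P i)" for i
  have "(\<lambda>i. inverse (t i) *\<^sub>R R i) \<longlonglongrightarrow> 0"
  proof (rule tendsto_norm_zero_cancel, rule tendstoI)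
    fix \<epsilon> :: real assume "\<epsilon> > 0"
    then have pos: "\<epsilon> / (2 * C) > 0" using C(1) by simp
    obtain d where d: "d > 0" "\<And>x x'. x \<in> ball xb d \<Longrightarrow> x' \<in> ball xb d \<Longrightarrow>
        norm (g x - g x' - jacobian g (at xb) *v (x - x')) \<le> \<epsilon> / (2 * C) * norm (x - x')"
      by (rule C1_strict_differentiability[OF C1 pos]) blast
    have "\<forall>\<^sub>F i in sequentially. xb + t i *\<^sub>R P i \<in> ball xb d" using xlim d(1) by (intro topological_tendstoD) auto
    then show "\<forall>\<^sub>F i in sequentially. dist (norm (inverse (t i) *\<^sub>R R i)) 0 < \<epsilon>"
    proof eventually_elim
      case (elim i)
      have "norm (R i) \<le> \<epsilon> / (2 * C) * norm (t i *\<^sub>R P i)"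
        using d(2)[OF elim, of xb] d(1) by (simp only: R_def add_diff_cancel_left' centre_in_ball)
      also have "\<dots> \<le> \<epsilon> / (2 * C) * (t i * C)"
        using C(2)[of i] t0(1)[of i] pos by (intro mult_left_mono) auto
      also have "\<dots> = t i * (\<epsilon> / 2)" using C(1) by simp
      finally have "inverse (t i) * norm (R i) \<le> \<epsilon> / 2"
        using t0(1)[of i] by (simp add: field_simps)
      then show ?case using t0(1)[of i] \<open>\<epsilon> > 0\<close> by simp
    qed
  qed
  moreover have "(\<lambda>i. jacobian g (at xb) *v P i) \<longlonglongrightarrow> jacobian g (at xb) *v u"
    by (intro matrix_vector_mult_tendsto P tendsto_const)
  ultimately have "(\<lambda>i. jacobian g (at xb) *v P i + inverse (t i) *\<^sub>R R i) \<longlonglongrightarrow> jacobian g (at xb) *v u + 0"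
    by (intro tendsto_add)
  moreover have "jacobian g (at xb) *v P i + inverse (t i) *\<^sub>R R i = inverse (t i) *\<^sub>R (g (xb + t i *\<^sub>R P i) - g xb)" for i
    using t0(1)[of i] by (simp add: R_def matrix_vector_mult_scaleR scaleR_diff_right)
  ultimately show ?thesis by simp
qed

section \<open>Directional limits of normals\<close>

text \<open>The common part of both lower estimates. The points provided by the variational principle with
  tolerance \<open>1 / (k + 1)\<close> are normalised by \<open>t k = nX (x k - xb)\<close>. The errors in \<open>p\<close> and \<open>q\<close> are
  \<open>o(t k)\<close>, so that the points of \<open>D\<close> approach \<open>xb\<close> from the limit direction \<open>u\<close> of \<open>X\<close>, and the points of
  \<open>K\<close> approach \<open>g xb\<close> from the direction \<open>v + \<nabla>g(xb) u\<close>, where \<open>v\<close> is a limit of the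
  quotients of \<open>- h\<close>. The vector \<open>U' k\<close> is what remains of the normal to \<open>D\<close> after subtracting the
  contribution of \<open>g\<close>; it is a first-order term of \<open>h\<close> only, as the last conclusion says.\<close>

lemma directional_normals_of_nonsubregular:
  fixes g h :: "real^'n \<Rightarrow> real^'m"
  assumes nX: "is_norm nX" and cD: "closed D" and cK: "closed K" and xb: "xb \<in> D" "g xb \<in> K"
    and gC1: "C1_around g xb" and hL: "lipschitz_around h xb" and h0: "h xb = 0"
    and nonsub: "nonsubregular D K (\<lambda>x. g x - h x) xb"
  obtains t X us vs u v U' V' E where
    "down0 t" "X \<longlonglongrightarrow> u" "nX u = 1" "\<And>k. nX (X k) = 1"
    "(\<lambda>k. - (inverse (t k) *\<^sub>R h (xb + t k *\<^sub>R X k))) \<longlonglongrightarrow> v"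
    "us + transpose (jacobian g (at xb)) *v vs \<in> dir_normal_cone D xb u"
    "- vs \<in> dir_normal_cone K (g xb) (v + jacobian g (at xb) *v u)"
    "norm vs = 1" "V' \<longlonglongrightarrow> vs" "U' \<longlonglongrightarrow> us" "E \<longlonglongrightarrow> (0::real)" "\<And>k. 0 < E k"
    "\<And>k \<delta>. 0 < \<delta> \<Longrightarrow> \<forall>\<^sub>F y in nhds (xb + t k *\<^sub>R X k). - (U' k) \<bullet> (y - (xb + t k *\<^sub>R X k))
        - (E k + \<delta>) * norm (y - (xb + t k *\<^sub>R X k)) \<le> V' k \<bullet> (h y - h (xb + t k *\<^sub>R X k))"
proof -
  define f where "f x = g x - h x" for x
  define J where "J x = jacobian g (at x)" for x
  obtain r1 Lg where r1: "r1 > 0" "Lg-lipschitz_on (cball xb r1) g"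
    using C1_lipschitz_near[OF gC1] by metis
  obtain T Lh where T: "open T" "xb \<in> T" "Lh-lipschitz_on T h" using hL unfolding lipschitz_around_def by blast
  obtain r2 where r2: "r2 > 0" "cball xb r2 \<subseteq> T" using T open_contains_cball by blast
  obtain r3 where r3: "r3 > 0" "\<And>x. x \<in> ball xb r3 \<Longrightarrow> g differentiable (at x)"
    "continuous_on (ball xb r3) J" using C1_aroundE[OF gC1] unfolding J_def by metis
  define r where "r = Min {r1, r2, r3}"
  have r: "r > 0" "r \<le> r1" "r \<le> r2" "r \<le> r3" using r1 r2 r3 by (auto simp: r_def)
  have gL: "Lg-lipschitz_on (cball xb r) g" using r1(2) by (rule lipschitz_on_subset) (use r in auto)
  have hLr: "Lh-lipschitz_on (cball xb r) h" using T(3) by (rule lipschitz_on_subset) (use r r2 in auto)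
  have fL: "(Lg + Lh)-lipschitz_on (cball xb r) f"
    unfolding f_def using gL hLr by (rule lipschitz_on_diff)
  have Lh0: "0 \<le> Lh" using hLr by (rule lipschitz_on_nonneg)
  have fns: "nonsubregular D K f xb" using nonsub by (simp add: f_def[abs_def])
  define e where "e k = 1 / real (Suc k)" for k
  have e: "0 < e k" "e k \<le> 1" for k by (auto simp: e_def)
  have e0: "e \<longlonglongrightarrow> 0" unfolding e_def using LIMSEQ_inverse_real_of_nat by (simp only: divide_inverse mult_1_left)
  define Pt where "Pt k x p q ps vs c \<longleftrightarrow> x \<noteq> xb \<and> norm (x - xb) < e k \<and> norm (x - xb) < r \<and>
     norm (p - x) \<le> e k * norm (x - xb) \<and> norm (q - f x) \<le> e k * norm (x - xb) \<and>
     ps \<in> normal_cone D p \<and> - vs \<in> normal_cone K q \<and> norm vs = 1 \<and>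
     (\<forall>\<^sub>F y in nhds x. 0 \<le> - (vs \<bullet> (f y - f x)) + ps \<bullet> (y - x) + e k * norm (y - x) + c * (norm (y - x))\<^sup>2)"
    for k x p q ps vs c
  have "\<exists>x p q ps vs c. Pt k x p q ps vs c" for k
    unfolding Pt_def
    by (rule nonsubregular_proximal_point[OF cD cK xb(1) _ r(1) fL fns e])
      (use xb h0 in \<open>simp_all add: f_def\<close>)
  then have "\<forall>k. \<exists>x p q ps vs c. Pt k x p q ps vs c" by blast
  then have "\<exists>x p q ps vs c. \<forall>k. Pt k (x k) (p k) (q k) (ps k) (vs k) (c k)"
    unfolding choice_iff .
  then obtain x p q ps vs c where "\<And>k. Pt k (x k) (p k) (q k) (ps k) (vs k) (c k)"
    by blast
  then have
    x: "\<And>k. x k \<noteq> xb" "\<And>k. norm (x k - xb) < e k" "\<And>k. norm (x k - xb) < r" and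
    p: "\<And>k. norm (p k - x k) \<le> e k * norm (x k - xb)" and
    q: "\<And>k. norm (q k - f (x k)) \<le> e k * norm (x k - xb)" and
    ps: "\<And>k. ps k \<in> normal_cone D (p k)" and vs: "\<And>k. - vs k \<in> normal_cone K (q k)" "\<And>k. norm (vs k) = 1" and
    opt: "\<And>k. \<forall>\<^sub>F y in nhds (x k). 0 \<le> - (vs k \<bullet> (f y - f (x k))) + ps k \<bullet> (y - x k) + e k * norm (y - x k) + c k * (norm (y - x k))\<^sup>2"
    unfolding Pt_def by blast+
  define us where "us k = ps k - transpose (J (x k)) *v vs k" for k
  have xball: "x k \<in> ball xb r" for k using x(3) by (simp add: dist_norm norm_minus_commute)
  \<comment> \<open>expand \<open>g\<close> to first order and absorb its remainder and the quadratic term into \<open>\<delta>\<close>\<close>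
  have sub: "\<forall>\<^sub>F y in nhds (x k). - us k \<bullet> (y - x k) - (e k + \<delta>) * norm (y - x k) \<le> vs k \<bullet> (h y - h (x k))"
    if \<delta>: "\<delta> > 0" for \<delta> k
  proof -
    have "(g has_derivative (\<lambda>v. J (x k) *v v)) (at (x k))"
      using r3(2)[of "x k"] xball[of k] r unfolding J_def by (simp flip: jacobian_works)
    then obtain d1 where d1: "d1 > 0" "\<And>y. norm (y - x k) < d1 \<Longrightarrow> norm (g y - g (x k) - J (x k) *v (y - x k)) \<le> \<delta> / 2 * norm (y - x k)"
      unfolding has_derivative_at_alt using half_gt_zero[OF \<delta>] by blast
    define d2 where "d2 = \<delta> / (2 * (\<bar>c k\<bar> + 1))"
    have d2: "d2 > 0" using \<delta> by (simp add: d2_def add_nonneg_pos)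
    have "\<forall>\<^sub>F y in nhds (x k). dist y (x k) < min d1 d2"
      using d1(1) d2 by (intro eventually_nhds_metric[THEN iffD2] exI[of _ "min d1 d2"]) auto
    then show ?thesis using opt[of k]
    proof eventually_elim
      case (elim y)
      define w where "w = y - x k"
      have w: "norm w < d1" "norm w < d2" using elim(1) by (auto simp: w_def dist_norm)
      have "norm (g y - g (x k) - J (x k) *v w) \<le> \<delta> / 2 * norm w" using d1(2)[of y] w by (simp add: w_def)
      moreover have "- (vs k \<bullet> (g y - g (x k) - J (x k) *v w)) \<le> norm (vs k) * norm (g y - g (x k) - J (x k) *v w)"
        using Cauchy_Schwarz_ineq2[of "vs k" "g y - g (x k) - J (x k) *v w"] by linarith
      ultimately have 1: "- (vs k \<bullet> (g y - g (x k))) \<le> - (vs k \<bullet> (J (x k) *v w)) + \<delta> / 2 * norm w"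
        by (simp add: vs(2) inner_diff_right)
      have "\<bar>c k\<bar> * norm w \<le> (\<bar>c k\<bar> + 1) * d2" using w by (intro mult_mono) auto
      also have "\<dots> = \<delta> / 2"
      proof -
        have "a * (\<delta> / (2 * a)) = \<delta> / 2" if "a \<noteq> 0" for a :: real using that by simp
        moreover have "\<bar>c k\<bar> + 1 \<noteq> 0" using abs_ge_zero[of "c k"] by linarith
        ultimately show ?thesis unfolding d2_def by blast
      qed
      finally have "\<bar>c k\<bar> * norm w * norm w \<le> \<delta> / 2 * norm w" by (rule mult_right_mono) simp
      moreover have "c k * (norm w)\<^sup>2 \<le> \<bar>c k\<bar> * norm w * norm w"
        by (simp add: power2_eq_square mult.assoc mult_right_mono)
      ultimately have 2: "c k * (norm w)\<^sup>2 \<le> \<delta> / 2 * norm w" by linarith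
      have 3: "us k \<bullet> w = ps k \<bullet> w - vs k \<bullet> (J (x k) *v w)"
        by (simp add: us_def inner_diff_left dot_lmul_matrix)
      have 4: "vs k \<bullet> (f y - f (x k)) = vs k \<bullet> (g y - g (x k)) - vs k \<bullet> (h y - h (x k))"
        by (simp add: f_def inner_diff_right)
      have "(e k + \<delta>) * norm w = e k * norm w + \<delta> / 2 * norm w + \<delta> / 2 * norm w" by (simp add: algebra_simps)
      then show ?case using elim(2) 1 2 3 4 by (simp add: w_def)
    qed
  qed
  \<comment> \<open>test the inequality at \<open>y = x k - s us k\<close>\<close>
  have us_bound: "norm (us k) \<le> Lh + 2" for k
  proof -
    have "\<forall>\<^sub>F y in nhds (x k). y \<in> ball xb r" using xball by (intro eventually_nhds_in_open) auto
    then have "\<forall>\<^sub>F y in nhds (x k). - us k \<bullet> (y - x k) \<le> (Lh + 2) * norm (y - x k)"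
      using sub[of 1 k, simplified]
    proof eventually_elim
      case (elim y)
      have "vs k \<bullet> (h y - h (x k)) \<le> norm (vs k) * norm (h y - h (x k))" by (rule norm_cauchy_schwarz)
      also have "\<dots> \<le> Lh * norm (y - x k)"
        using lipschitz_on_norm_bound[OF hLr elim(1) xball[of k]] by (simp add: vs)
      finally have "vs k \<bullet> (h y - h (x k)) \<le> Lh * norm (y - x k)" .
      moreover have "(e k + 1) * norm (y - x k) \<le> 2 * norm (y - x k)"
        using e(2)[of k] by (intro mult_right_mono) auto
      ultimately show ?case using elim(2) by (simp add: distrib_right)
    qed
    then obtain d where d: "d > 0" "\<And>y. dist y (x k) < d \<Longrightarrow> - us k \<bullet> (y - x k) \<le> (Lh + 2) * norm (y - x k)"
      unfolding eventually_nhds_metric by blast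
    show ?thesis
    proof (cases "us k = 0")
      case True then show ?thesis using Lh0 by simp
    next
      case False
      define s where "s = d / (2 * norm (us k))"
      have s: "s > 0" "s * norm (us k) < d" using d(1) False by (auto simp: s_def)
      have "s * (norm (us k) * norm (us k)) \<le> s * ((Lh + 2) * norm (us k))"
        using d(2)[of "x k - s *\<^sub>R us k"] s by (simp add: dist_norm power2_eq_square mult_ac flip: power2_norm_eq_inner)
      then show ?thesis using s(1) False by simp
    qed
  qed
  define t where "t k = nX (x k - xb)" for k
  define X where "X k = inverse (t k) *\<^sub>R (x k - xb)" for k
  obtain C where C: "C > 0" "\<And>x. nX x \<le> C * norm x" using is_norm_upper[OF nX] by metis
  obtain c0 where c0: "c0 > 0" "\<And>x. c0 * norm x \<le> nX x" using is_norm_lower[OF nX] by metis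
  have t0: "0 < t k" for k using x(1)[of k] by (simp add: t_def is_norm_pos[OF nX])
  have "(\<lambda>k. x k - xb) \<longlonglongrightarrow> 0"
    by (rule Lim_null_comparison[OF always_eventually e0]) (rule allI, rule less_imp_le, rule x(2))
  then have xlim: "x \<longlonglongrightarrow> xb" by (simp add: LIM_zero_iff)
  have tlim: "t \<longlonglongrightarrow> 0"
    unfolding t_def using is_norm_tendsto[OF nX \<open>(\<lambda>k. x k - xb) \<longlonglongrightarrow> 0\<close>] by (simp add: is_norm_zero[OF nX])
  have X1: "nX (X k) = 1" for k using t0[of k] by (simp add: X_def is_norm_scale[OF nX] t_def)
  have xX: "x k = xb + t k *\<^sub>R X k" for k using t0[of k] by (simp add: X_def)
  have Xb: "norm (X k) \<le> 1 / c0" for k using c0(2)[of "X k"] c0(1) by (simp add: X1 field_simps)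
  have tX: "norm (t k *\<^sub>R X k) \<le> t k * (1 / c0)" for k
    using mult_left_mono[OF Xb[of k], of "t k"] t0[of k] by simp
  define H where "H k = - (inverse (t k) *\<^sub>R h (x k))" for k
  have Hb: "norm (H k) \<le> Lh / c0" for k
  proof -
    have "norm (h (x k) - h xb) \<le> Lh * norm (x k - xb)"
      using lipschitz_on_norm_bound[OF hLr xball[of k], of xb] r(1) by simp
    also have "x k - xb = t k *\<^sub>R X k" using xX[of k] by simp
    also have "Lh * norm (t k *\<^sub>R X k) \<le> Lh * (t k * (1 / c0))"
      by (rule mult_left_mono[OF tX Lh0])
    finally show ?thesis using t0[of k] by (simp add: H_def h0 field_simps)
  qed
  have "bounded (range (\<lambda>k. ((X k, H k), (us k, vs k))))"
    unfolding bounded_iff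
  proof (intro exI ballI)
    fix z assume "z \<in> range (\<lambda>k. ((X k, H k), (us k, vs k)))"
    then obtain k where z: "z = ((X k, H k), (us k, vs k))" by blast
    have "norm z \<le> (norm (X k) + norm (H k)) + (norm (us k) + norm (vs k))"
      unfolding z by (intro order_trans[OF norm_Pair_le] add_mono) (auto intro: norm_Pair_le)
    also have "\<dots> \<le> (1 / c0 + Lh / c0) + ((Lh + 2) + 1)"
      using Xb[of k] Hb[of k] us_bound[of k] vs(2)[of k] by (intro add_mono) auto
    finally show "norm z \<le> (1 / c0 + Lh / c0) + ((Lh + 2) + 1)" .
  qed
  from bounded_imp_convergent_subsequence[OF this]
  obtain l \<sigma> where \<sigma>: "strict_mono \<sigma>" and l: "((\<lambda>k. ((X k, H k), (us k, vs k))) \<circ> \<sigma>) \<longlonglongrightarrow> l"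
    by blast
  define u v us' vs' where "u = fst (fst l)" and "v = snd (fst l)" and "us' = fst (snd l)" and "vs' = snd (snd l)"
  note luv = this
  have lims: "(\<lambda>k. X (\<sigma> k)) \<longlonglongrightarrow> u" "(\<lambda>k. H (\<sigma> k)) \<longlonglongrightarrow> v" "(\<lambda>k. us (\<sigma> k)) \<longlonglongrightarrow> us'" "(\<lambda>k. vs (\<sigma> k)) \<longlonglongrightarrow> vs'"
    using tendsto_fst[OF tendsto_fst[OF l]] tendsto_snd[OF tendsto_fst[OF l]]
      tendsto_fst[OF tendsto_snd[OF l]] tendsto_snd[OF tendsto_snd[OF l]]
    by (simp_all add: luv o_def)
  have t\<sigma>: "(\<lambda>k. t (\<sigma> k)) \<longlonglongrightarrow> 0" and e\<sigma>: "(\<lambda>k. e (\<sigma> k)) \<longlonglongrightarrow> 0" and x\<sigma>: "(\<lambda>k. x (\<sigma> k)) \<longlonglongrightarrow> xb"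
    using LIMSEQ_subseq_LIMSEQ[OF tlim \<sigma>] LIMSEQ_subseq_LIMSEQ[OF e0 \<sigma>] LIMSEQ_subseq_LIMSEQ[OF xlim \<sigma>]
    by (simp_all add: o_def)
  have down: "down0 (\<lambda>k. t (\<sigma> k))" using t0 t\<sigma> by (simp add: down0_def)
  have ux1: "nX u = 1"
    using is_norm_tendsto[OF nX lims(1)] by (simp add: X1 LIMSEQ_const_iff)
  have vs1: "norm vs' = 1"
    using tendsto_norm[OF lims(4)] by (simp add: vs LIMSEQ_const_iff)
  have Jlim: "(\<lambda>k. J (x (\<sigma> k))) \<longlonglongrightarrow> J xb"
  proof (rule isCont_tendsto_compose[OF _ x\<sigma>])
    show "isCont J xb" using r3(1) by (intro continuous_on_interior[OF r3(3)]) simp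
  qed
  \<comment> \<open>errors bounded by \<open>e k |x k - xb|\<close> vanish after division by \<open>t k\<close>\<close>
  have small: "(\<lambda>k. inverse (t (\<sigma> k)) *\<^sub>R z (\<sigma> k)) \<longlonglongrightarrow> 0"
    if z: "\<And>k. norm (z k) \<le> e k * norm (x k - xb)" for z :: "nat \<Rightarrow> 'b::real_normed_vector"
  proof (rule Lim_null_comparison[OF always_eventually])
    show "\<forall>k. norm (inverse (t (\<sigma> k)) *\<^sub>R z (\<sigma> k)) \<le> e (\<sigma> k) * (1 / c0)"
    proof
      fix k
      have "norm (z (\<sigma> k)) \<le> e (\<sigma> k) * norm (t (\<sigma> k) *\<^sub>R X (\<sigma> k))"
        using z[of "\<sigma> k"] xX[of "\<sigma> k"] by simp
      also have "\<dots> \<le> e (\<sigma> k) * (t (\<sigma> k) * (1 / c0))"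
        by (rule mult_left_mono[OF tX less_imp_le[OF e(1)]])
      finally show "norm (inverse (t (\<sigma> k)) *\<^sub>R z (\<sigma> k)) \<le> e (\<sigma> k) * (1 / c0)"
        using t0[of "\<sigma> k"] by (simp add: field_simps)
    qed
    show "(\<lambda>k. e (\<sigma> k) * (1 / c0)) \<longlonglongrightarrow> 0" using e\<sigma> by (intro tendsto_mult_left_zero)
  qed
  have D_cone: "us' + transpose (jacobian g (at xb)) *v vs' \<in> dir_normal_cone D xb u"
    unfolding dir_normal_cone_def
  proof (intro CollectI exI conjI allI)
    show "down0 (\<lambda>k. t (\<sigma> k))" by (rule down)
    show "(\<lambda>k. X (\<sigma> k) + inverse (t (\<sigma> k)) *\<^sub>R (p (\<sigma> k) - x (\<sigma> k))) \<longlonglongrightarrow> u"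
      using tendsto_add[OF lims(1) small[of "\<lambda>k. p k - x k", OF p]] by simp
    have "transpose (J (x k)) *v vs k + us k = ps k" for k by (simp add: us_def)
    moreover have "(\<lambda>k. us (\<sigma> k) + transpose (J (x (\<sigma> k))) *v vs (\<sigma> k)) \<longlonglongrightarrow> us' + transpose (J xb) *v vs'"
      using Jlim unfolding transpose_def
      by (intro tendsto_add lims matrix_vector_mult_tendsto tendsto_intros)
    ultimately show "(\<lambda>k. ps (\<sigma> k)) \<longlonglongrightarrow> us' + transpose (jacobian g (at xb)) *v vs'"
      by (simp add: J_def add.commute)
    fix k
    have "xb + t (\<sigma> k) *\<^sub>R (X (\<sigma> k) + inverse (t (\<sigma> k)) *\<^sub>R (p (\<sigma> k) - x (\<sigma> k))) = p (\<sigma> k)"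
      using t0[of "\<sigma> k"] xX[of "\<sigma> k"] by (simp add: scaleR_add_right)
    then show "ps (\<sigma> k) \<in> normal_cone D (xb + t (\<sigma> k) *\<^sub>R (X (\<sigma> k) + inverse (t (\<sigma> k)) *\<^sub>R (p (\<sigma> k) - x (\<sigma> k))))"
      using ps by simp
  qed
  have gd: "(\<lambda>k. inverse (t (\<sigma> k)) *\<^sub>R (g (x (\<sigma> k)) - g xb)) \<longlonglongrightarrow> J xb *v u"
    using C1_directional_quotient[OF gC1 down lims(1)] by (simp add: J_def flip: xX)
  have K_cone: "- vs' \<in> dir_normal_cone K (g xb) (v + jacobian g (at xb) *v u)"
    unfolding dir_normal_cone_def
  proof (intro CollectI exI conjI allI)
    show "down0 (\<lambda>k. t (\<sigma> k))" by (rule down)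
    show "(\<lambda>k. - vs (\<sigma> k)) \<longlonglongrightarrow> - vs'" by (intro tendsto_intros lims)
    show "(\<lambda>k. H (\<sigma> k) + inverse (t (\<sigma> k)) *\<^sub>R (g (x (\<sigma> k)) - g xb) + inverse (t (\<sigma> k)) *\<^sub>R (q (\<sigma> k) - f (x (\<sigma> k))))
       \<longlonglongrightarrow> v + jacobian g (at xb) *v u"
      using tendsto_add[OF tendsto_add[OF lims(2) gd] small[of "\<lambda>k. q k - f (x k)", OF q]] by (simp add: J_def)
    fix k
    have "g xb + t (\<sigma> k) *\<^sub>R (H (\<sigma> k) + inverse (t (\<sigma> k)) *\<^sub>R (g (x (\<sigma> k)) - g xb) + inverse (t (\<sigma> k)) *\<^sub>R (q (\<sigma> k) - f (x (\<sigma> k)))) = q (\<sigma> k)"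
    proof -
      have s: "t (\<sigma> k) *\<^sub>R (inverse (t (\<sigma> k)) *\<^sub>R z) = z" for z :: "real^'m"
        using t0[of "\<sigma> k"] by simp
      show ?thesis unfolding H_def scaleR_add_right scaleR_minus_right s by (simp add: f_def)
    qed
    then show "- vs (\<sigma> k) \<in> normal_cone K (g xb + t (\<sigma> k) *\<^sub>R (H (\<sigma> k) + inverse (t (\<sigma> k)) *\<^sub>R (g (x (\<sigma> k)) - g xb) + inverse (t (\<sigma> k)) *\<^sub>R (q (\<sigma> k) - f (x (\<sigma> k)))))"
      using vs(1)[of "\<sigma> k"] by simp
  qed
  show thesis
  proof (rule that[OF down lims(1) ux1 X1 _ D_cone K_cone vs1 lims(4) lims(3) e\<sigma>])
    show "(\<lambda>k. - (inverse (t (\<sigma> k)) *\<^sub>R h (xb + t (\<sigma> k) *\<^sub>R X (\<sigma> k)))) \<longlonglongrightarrow> v"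
      using lims(2) by (simp add: H_def xX)
    show "\<And>k. 0 < e (\<sigma> k)" by (rule e)
    show "\<And>k \<delta>. 0 < \<delta> \<Longrightarrow> \<forall>\<^sub>F y in nhds (xb + t (\<sigma> k) *\<^sub>R X (\<sigma> k)). - (us (\<sigma> k)) \<bullet> (y - (xb + t (\<sigma> k) *\<^sub>R X (\<sigma> k)))
        - (e (\<sigma> k) + \<delta>) * norm (y - (xb + t (\<sigma> k) *\<^sub>R X (\<sigma> k))) \<le> vs (\<sigma> k) \<bullet> (h y - h (xb + t (\<sigma> k) *\<^sub>R X (\<sigma> k)))"
      using sub by (simp flip: xX)
  qed
qed

section \<open>Lower estimates of the radii\<close>

text \<open>The norms are equivalent to the Euclidean ones, which only changes \<open>\<kappa>\<close>; outside \<open>D\<close> the residual is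
  infinite and the estimate of subregularity holds trivially.\<close>

lemma not_metrically_subregular_iff:
  fixes g h :: "real^'n \<Rightarrow> real^'m"
  assumes nX: "is_norm nX" and nY: "is_norm nY" and xb: "xb \<in> D" "g xb \<in> K" and h0: "h xb = 0"
    and F: "\<And>x. F x = (if x \<in> D then (\<lambda>k. k - g x) ` K else {})"
  shows "\<not> metrically_subregular nX nY (\<lambda>x. (\<lambda>y. y + h x) ` F x) xb 0 \<longleftrightarrow>
     nonsubregular D K (\<lambda>x. g x - h x) xb"
    (is "\<not> ?sub \<longleftrightarrow> ?far")
proof -
  define G where "G x = (\<lambda>y. y + h x) ` F x" for x
  define f where "f x = g x - h x" for x
  have G: "G x = (if x \<in> D then (\<lambda>k. k - f x) ` K else {})" for x
    by (auto simp: G_def F f_def image_image)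
  have G0: "0 \<in> G x \<longleftrightarrow> x \<in> D \<and> f x \<in> K" for x
    by (auto simp: G image_iff)
  have fxb: "f xb \<in> K" using xb h0 by (simp add: f_def)
  obtain CX where CX: "CX > 0" "\<And>x. nX x \<le> CX * norm x" using is_norm_upper[OF nX] by metis
  obtain cX where cX: "cX > 0" "\<And>x. cX * norm x \<le> nX x" using is_norm_lower[OF nX] by metis
  obtain CY where CY: "CY > 0" "\<And>x. nY x \<le> CY * norm x" using is_norm_upper[OF nY] by metis
  obtain cY where cY: "cY > 0" "\<And>x. cY * norm x \<le> nY x" using is_norm_lower[OF nY] by metis
  have dist_le: "set_dist nX x {x'. 0 \<in> G x'} \<le> ereal (nX (x - x'))" if "x' \<in> D" "f x' \<in> K" for x x'
    unfolding set_dist_def using that by (intro INF_lower) (simp add: G0)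
  have sub_eq: "?sub \<longleftrightarrow> (\<exists>\<kappa>\<ge>0. \<exists>U. open U \<and> xb \<in> U \<and>
        (\<forall>x\<in>U. set_dist nX x {x'. 0 \<in> G x'} \<le> ereal \<kappa> * set_dist nY 0 (G x)))"
    using xb fxb by (simp add: metrically_subregular_def G0 flip: G_def)
  show ?thesis
  proof
    assume nsub: "\<not> ?sub"
    show ?far
      unfolding nonsubregular_def
    proof (intro allI impI)
      fix \<kappa> \<delta> :: real assume "0 < \<kappa>" "0 < \<delta>"
      define \<kappa>' where "\<kappa>' = \<kappa> * CX / cY"
      have \<kappa>': "\<kappa>' > 0" using \<open>0 < \<kappa>\<close> CX cY by (simp add: \<kappa>'_def)
      have "open (ball xb \<delta>)" "xb \<in> ball xb \<delta>" using \<open>0 < \<delta>\<close> by auto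
      then obtain x where x: "x \<in> ball xb \<delta>"
        and gt: "\<not> set_dist nX x {x'. 0 \<in> G x'} \<le> ereal \<kappa>' * set_dist nY 0 (G x)"
        using nsub \<kappa>' unfolding sub_eq by (meson less_imp_le)
      have xD: "x \<in> D"
      proof (rule ccontr)
        assume "x \<notin> D"
        then have "set_dist nY 0 (G x) = \<infinity>" by (simp add: set_dist_def G top_ereal_def)
        then show False using gt \<kappa>' by simp
      qed
      have "\<exists>k\<in>K. ereal (\<kappa>' * nY (k - f x)) < set_dist nX x {x'. 0 \<in> G x'}"
      proof (rule ccontr)
        assume "\<not> ?thesis"
        then have le: "set_dist nX x {x'. 0 \<in> G x'} \<le> ereal \<kappa>' * ereal (nY (k - f x))" if "k \<in> K" for k
          using that by (auto simp: not_less)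
        have "set_dist nX x {x'. 0 \<in> G x'} / ereal \<kappa>' \<le> set_dist nY 0 (G x)"
          unfolding set_dist_def[of nY]
        proof (rule INF_greatest)
          fix c assume "c \<in> G x"
          then obtain k where "k \<in> K" "c = k - f x" by (auto simp: G xD)
          then show "set_dist nX x {x'. 0 \<in> G x'} / ereal \<kappa>' \<le> ereal (nY (0 - c))"
            using le[of k] \<kappa>' is_norm_uminus[OF nY, of "k - f x"] by (simp add: ereal_divide_le_pos)
        qed
        then show False using gt \<kappa>' by (simp add: ereal_divide_le_pos)
      qed
      then obtain k where k: "k \<in> K" "ereal (\<kappa>' * nY (k - f x)) < set_dist nX x {x'. 0 \<in> G x'}" by blast
      have "\<kappa> * norm (k - f x) < norm (x - x')" if "x' \<in> D" "f x' \<in> K" for x'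
      proof -
        have "\<kappa>' * nY (k - f x) < nX (x - x')"
          using less_le_trans[OF k(2) dist_le[OF that]] by simp
        also have "\<dots> \<le> CX * norm (x - x')" by (rule CX)
        finally have "\<kappa>' * nY (k - f x) < CX * norm (x - x')" .
        moreover have "\<kappa>' * (cY * norm (k - f x)) \<le> \<kappa>' * nY (k - f x)"
          using cY(2)[of "k - f x"] \<kappa>' by (intro mult_left_mono) auto
        moreover have "\<kappa>' * (cY * norm (k - f x)) = CX * (\<kappa> * norm (k - f x))"
          using cY(1) by (simp add: \<kappa>'_def)
        ultimately have "CX * (\<kappa> * norm (k - f x)) < CX * norm (x - x')" by linarith
        then show ?thesis using CX(1) by simp
      qed
      then show "\<exists>x\<in>D. \<exists>k\<in>K. norm (x - xb) < \<delta> \<and>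
        (\<forall>x'\<in>D. g x' - h x' \<in> K \<longrightarrow> \<kappa> * norm (k - (g x - h x)) < norm (x - x'))"
        using x xD k(1) by (auto simp: f_def dist_norm norm_minus_commute intro!: bexI[of _ x] bexI[of _ k])
    qed
  next
    assume far: ?far
    show "\<not> ?sub"
      unfolding sub_eq
    proof (intro notI, elim exE conjE)
      fix \<kappa>0 :: real and U
      assume \<kappa>0: "0 \<le> \<kappa>0" and U: "open U" "xb \<in> U"
        and sub: "\<forall>x\<in>U. set_dist nX x {x'. 0 \<in> G x'} \<le> ereal \<kappa>0 * set_dist nY 0 (G x)"
      obtain \<delta> where \<delta>: "\<delta> > 0" "ball xb \<delta> \<subseteq> U" using U openE by blast
      define \<kappa> where "\<kappa> = (\<kappa>0 + 1) * CY / cX"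
      have "\<kappa> > 0" using \<kappa>0 CY cX by (simp add: \<kappa>_def)
      then obtain x k where x: "x \<in> D" "k \<in> K" "norm (x - xb) < \<delta>"
        and xk: "\<And>x'. x' \<in> D \<Longrightarrow> f x' \<in> K \<Longrightarrow> \<kappa> * norm (k - f x) < norm (x - x')"
        using far \<delta>(1) unfolding f_def nonsubregular_def by blast
      have ne: "k \<noteq> f x" using xk[of x] x by auto
      have "ereal ((\<kappa>0 + 1) * nY (k - f x)) \<le> set_dist nX x {x'. 0 \<in> G x'}"
        unfolding set_dist_def
      proof (rule INF_greatest)
        fix x' assume "x' \<in> {x'. 0 \<in> G x'}"
        then have "\<kappa> * norm (k - f x) < norm (x - x')" using xk by (simp add: G0)
        then have "cX * (\<kappa> * norm (k - f x)) \<le> cX * norm (x - x')" using cX(1) by simp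
        moreover have "(\<kappa>0 + 1) * nY (k - f x) \<le> (\<kappa>0 + 1) * (CY * norm (k - f x))"
          using \<kappa>0 CY(2) by (intro mult_left_mono) auto
        moreover have "cX * (\<kappa> * norm (k - f x)) = (\<kappa>0 + 1) * (CY * norm (k - f x))"
          using cX(1) by (simp add: \<kappa>_def)
        ultimately show "ereal ((\<kappa>0 + 1) * nY (k - f x)) \<le> ereal (nX (x - x'))"
          using cX(2)[of "x - x'"] by simp
      qed
      also have "\<dots> \<le> ereal \<kappa>0 * set_dist nY 0 (G x)"
        using sub x \<delta>(2) by (auto simp: dist_norm norm_minus_commute subset_iff)
      also have "\<dots> \<le> ereal \<kappa>0 * ereal (nY (k - f x))"
      proof (rule ereal_mult_left_mono)
        have "set_dist nY 0 (G x) \<le> ereal (nY (0 - (k - f x)))"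
          unfolding set_dist_def using x by (intro INF_lower) (simp add: G)
        then show "set_dist nY 0 (G x) \<le> ereal (nY (k - f x))"
          using is_norm_uminus[OF nY, of "k - f x"] by simp
      qed (use \<kappa>0 in simp)
      finally have "(\<kappa>0 + 1) * nY (k - f x) \<le> \<kappa>0 * nY (k - f x)" by simp
      moreover have "nY (k - f x) > 0" using ne by (intro is_norm_pos[OF nY]) simp
      ultimately show False by (simp add: distrib_right)
    qed
  qed
qed

lemma dir_normal_cone_scaleR:
  assumes "z \<in> dir_normal_cone A y w" "0 \<le> c"
  shows "c *\<^sub>R z \<in> dir_normal_cone A y w"
proof -
  obtain t W Z where tWZ: "down0 t" "W \<longlonglongrightarrow> w" "Z \<longlonglongrightarrow> z" "\<And>i. Z i \<in> normal_cone A (y + t i *\<^sub>R W i)"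
    using assms(1) unfolding dir_normal_cone_def by blast
  have "(\<lambda>i. c *\<^sub>R Z i) \<longlonglongrightarrow> c *\<^sub>R z" by (intro tendsto_intros tWZ)
  moreover have "c *\<^sub>R Z i \<in> normal_cone A (y + t i *\<^sub>R W i)" for i
    by (rule normal_cone_scaleR[OF tWZ(4) assms(2)])
  ultimately show ?thesis
    unfolding dir_normal_cone_def using tWZ(1,2) by blast
qed

text \<open>If \<open>l\<close> exceeds the Lipschitz modulus, then the quotients of \<open>h\<close> are bounded by \<open>l\<close>, hence \<open>nY v \<le> l\<close>;
  and the first-order inequality says that the increments of \<open>vs \<bullet> h\<close>, which are at most \<open>\<beta> l\<close> times the
  distance with \<open>\<beta> = dual_norm nY vs\<close>, dominate \<open>us\<close>, hence \<open>dual_norm nX us \<le> \<beta> l\<close>. Cones being invariant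
  under positive factors, both \<open>us\<close> and \<open>vs\<close> may be divided by \<open>\<beta>\<close>.\<close>

lemma lipschitz_perturbation_lower_bound:
  fixes g h :: "real^'n \<Rightarrow> real^'m"
  assumes nX: "is_norm nX" and nY: "is_norm nY" and cD: "closed D" and cK: "closed K"
    and xb: "xb \<in> D" "g xb \<in> K" and gC1: "C1_around g xb" and h: "h \<in> F_Lip xb"
    and nonsub: "nonsubregular D K (\<lambda>x. g x - h x) xb"
  shows "\<exists>us v u vs. us + transpose (jacobian g (at xb)) *v vs \<in> dir_normal_cone D xb u \<and>
     - vs \<in> dir_normal_cone K (g xb) (v + jacobian g (at xb) *v u) \<and> nX u = 1 \<and> dual_norm nY vs = 1 \<and>
     ereal (max (dual_norm nX us) (nY v)) \<le> lip nX nY h xb"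
proof -
  let ?J = "jacobian g (at xb)"
  have hL: "lipschitz_around h xb" and h0: "h xb = 0" using h by (auto simp: F_Lip_def)
  obtain t X us vs u v U' V' E where
    t: "down0 t" and X: "X \<longlonglongrightarrow> u" and u1: "nX u = 1" and X1: "\<And>k. nX (X k) = 1" and
    v: "(\<lambda>k. - (inverse (t k) *\<^sub>R h (xb + t k *\<^sub>R X k))) \<longlonglongrightarrow> v" and
    cD': "us + transpose ?J *v vs \<in> dir_normal_cone D xb u" and
    cK': "- vs \<in> dir_normal_cone K (g xb) (v + ?J *v u)" and
    vs1: "norm vs = 1" and V': "V' \<longlonglongrightarrow> vs" and U': "U' \<longlonglongrightarrow> us" and E: "E \<longlonglongrightarrow> (0::real)" "\<And>k. 0 < E k" and
    opt: "\<And>k \<delta>. 0 < \<delta> \<Longrightarrow> \<forall>\<^sub>F y in nhds (xb + t k *\<^sub>R X k). - (U' k) \<bullet> (y - (xb + t k *\<^sub>R X k))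
        - (E k + \<delta>) * norm (y - (xb + t k *\<^sub>R X k)) \<le> V' k \<bullet> (h y - h (xb + t k *\<^sub>R X k))"
    by (rule directional_normals_of_nonsubregular[OF nX cD cK xb gC1 hL h0 nonsub]) (rule that; assumption)
  have t0: "0 < t k" "t \<longlonglongrightarrow> 0" for k using t by (auto simp: down0_def)
  have "(\<lambda>k. xb + t k *\<^sub>R X k) \<longlonglongrightarrow> xb + 0 *\<^sub>R u" by (intro tendsto_intros t0 X)
  then have xlim: "(\<lambda>k. xb + t k *\<^sub>R X k) \<longlonglongrightarrow> xb" by simp
  obtain C where C: "C > 0" "\<And>y. C * norm y \<le> nX y" using is_norm_lower[OF nX] by metis
  define \<beta> where "\<beta> = dual_norm nY vs"
  have "vs \<noteq> 0" using vs1 by force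
  then have \<beta>: "\<beta> > 0" unfolding \<beta>_def by (rule dual_norm_pos[OF nY])
  have bound: "nY v \<le> l \<and> dual_norm nX us \<le> l * \<beta>" if l: "lip nX nY h xb < ereal l" for l
  proof -
    obtain r where r: "r > 0" "\<And>x x'. x \<in> ball xb r \<Longrightarrow> x' \<in> ball xb r \<Longrightarrow> nY (h x - h x') \<le> l * nX (x - x')"
      using lip_lessD[OF nX nY l] by metis
    have ev: "\<forall>\<^sub>F k in sequentially. xb + t k *\<^sub>R X k \<in> ball xb r"
      using xlim r(1) by (intro topological_tendstoD) auto
    then have "\<forall>\<^sub>F k in sequentially. nY (- (inverse (t k) *\<^sub>R h (xb + t k *\<^sub>R X k))) \<le> l"
    proof eventually_elim
      case (elim k)
      have "nY (h (xb + t k *\<^sub>R X k)) \<le> l * t k"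
        using r(2)[OF elim, of xb] r(1) t0(1)[of k] by (simp add: h0 is_norm_scale[OF nX] X1)
      then show ?case using t0(1)[of k]
        unfolding is_norm_uminus[OF nY] is_norm_scale[OF nY] by (simp add: field_simps)
    qed
    then have 1: "nY v \<le> l"
      by (rule tendsto_upperbound[OF is_norm_tendsto[OF nY v]]) simp
    have l0: "0 \<le> l" using 1 is_norm_nonneg[OF nY, of v] by linarith
    have ineq: "\<forall>\<^sub>F k in sequentially. U' k \<bullet> w \<le> dual_norm nY (V' k) * (l * nX w) + 2 * E k * norm w" for w
      using ev
    proof eventually_elim
      case (elim k)
      let ?x = "xb + t k *\<^sub>R X k"
      have "\<forall>\<^sub>F y in nhds ?x. y \<in> ball xb r" using elim by (intro eventually_nhds_in_open) auto
      with opt[OF E(2)] have "\<forall>\<^sub>F y in nhds ?x. - (U' k) \<bullet> (y - ?x) - (E k + E k) * norm (y - ?x) \<le> V' k \<bullet> (h y - h ?x) \<and> y \<in> ball xb r"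
        by (rule eventually_conj)
      then obtain d where d: "d > 0" "\<And>y. dist y ?x < d \<Longrightarrow> - (U' k) \<bullet> (y - ?x) - (E k + E k) * norm (y - ?x) \<le> V' k \<bullet> (h y - h ?x) \<and> y \<in> ball xb r"
        unfolding eventually_nhds_metric by blast
      define s where "s = d / (2 * (norm w + 1))"
      have nw: "norm w + 1 > 0" using norm_ge_zero[of w] by linarith
      have s: "s > 0" using d(1) nw by (simp add: s_def)
      have "s * norm w \<le> s * (norm w + 1)" using s by simp
      also have "\<dots> = d / 2"
      proof -
        have "d / (2 * a) * a = d / 2" if "0 < a" for a :: real using that by simp
        then show ?thesis unfolding s_def using nw by blast
      qed
      also have "\<dots> < d" using d(1) by simp
      finally have sd: "s * norm w < d" .
      define y where "y = ?x - s *\<^sub>R w"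
      have yd: "- (U' k) \<bullet> (y - ?x) - (E k + E k) * norm (y - ?x) \<le> V' k \<bullet> (h y - h ?x)" "y \<in> ball xb r"
        using d(2)[of y] s sd by (auto simp: y_def dist_norm)
      have "V' k \<bullet> (h y - h ?x) \<le> dual_norm nY (V' k) * nY (h y - h ?x)"
        by (rule dual_norm_inner[OF nY])
      also have "\<dots> \<le> dual_norm nY (V' k) * (l * nX (y - ?x))"
        by (intro mult_left_mono r yd elim dual_norm_nonneg[OF nY])
      also have "y - ?x = - (s *\<^sub>R w)" by (simp add: y_def)
      also have "nX (- (s *\<^sub>R w)) = s * nX w" using s by (simp add: is_norm_uminus[OF nX] is_norm_scale[OF nX])
      finally have "s * (U' k \<bullet> w) - (E k + E k) * (s * norm w) \<le> dual_norm nY (V' k) * (l * (s * nX w))"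
        using yd(1) s by (simp add: y_def)
      then have "s * (U' k \<bullet> w) \<le> s * (dual_norm nY (V' k) * (l * nX w) + 2 * E k * norm w)"
        by (simp add: algebra_simps)
      then show ?case using s by simp
    qed
    have dual_bd: "dual_norm nY (V' k) \<le> \<beta> + dual_norm nY (V' k - vs)" for k
    proof (rule dual_norm_least[OF nY])
      fix y
      have "V' k \<bullet> y = vs \<bullet> y + (V' k - vs) \<bullet> y" by (simp add: inner_diff_left)
      also have "\<dots> \<le> \<beta> * nY y + dual_norm nY (V' k - vs) * nY y"
        unfolding \<beta>_def by (intro add_mono dual_norm_inner[OF nY])
      finally show "V' k \<bullet> y \<le> (\<beta> + dual_norm nY (V' k - vs)) * nY y" by (simp add: distrib_right)
    qed (use \<beta> dual_norm_nonneg[OF nY] in \<open>simp add: add_nonneg_nonneg less_imp_le\<close>)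
    obtain cY where cY: "cY > 0" "\<And>y. cY * norm y \<le> nY y" using is_norm_lower[OF nY] by metis
    have dual_small: "dual_norm nY z \<le> norm z / cY" for z
    proof (rule dual_norm_least[OF nY])
      fix y
      have "z \<bullet> y \<le> norm z * norm y" by (rule norm_cauchy_schwarz)
      also have "\<dots> \<le> norm z * (nY y / cY)"
        using cY by (intro mult_left_mono) (auto simp: field_simps)
      finally show "z \<bullet> y \<le> norm z / cY * nY y" by simp
    qed (use cY in simp)
    have "dual_norm nX us \<le> l * \<beta>"
    proof (rule dual_norm_least[OF nX])
      fix w
      have "\<forall>\<^sub>F k in sequentially. U' k \<bullet> w \<le> (\<beta> + norm (V' k - vs) / cY) * (l * nX w) + 2 * E k * norm w"
        using ineq[of w]
      proof eventually_elim
        case (elim k)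
        have "dual_norm nY (V' k) * (l * nX w) \<le> (\<beta> + norm (V' k - vs) / cY) * (l * nX w)"
          using dual_bd[of k] dual_small[of "V' k - vs"] l0 is_norm_nonneg[OF nX, of w]
          by (intro mult_right_mono) auto
        then show ?case using elim by linarith
      qed
      moreover have "(\<lambda>k. U' k \<bullet> w) \<longlonglongrightarrow> us \<bullet> w" by (intro tendsto_intros U')
      moreover have "(\<lambda>k. (\<beta> + norm (V' k - vs) / cY) * (l * nX w) + 2 * E k * norm w)
          \<longlonglongrightarrow> (\<beta> + norm (vs - vs) / cY) * (l * nX w) + 2 * 0 * norm w"
        using cY(1) by (intro tendsto_intros V' E) auto
      ultimately have "us \<bullet> w \<le> (\<beta> + norm (vs - vs) / cY) * (l * nX w) + 2 * 0 * norm w"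
        by (intro tendsto_le[OF sequentially_bot])
      then show "us \<bullet> w \<le> l * \<beta> * nX w" by (simp add: mult_ac)
    qed (use l0 \<beta> in simp)
    then show ?thesis using 1 by simp
  qed
  define vs' where "vs' = inverse \<beta> *\<^sub>R vs"
  define us' where "us' = inverse \<beta> *\<^sub>R us"
  have "us' + transpose ?J *v vs' = inverse \<beta> *\<^sub>R (us + transpose ?J *v vs)"
    unfolding us'_def vs'_def scaleR_add_right matrix_vector_mult_scaleR ..
  then have A: "us' + transpose ?J *v vs' \<in> dir_normal_cone D xb u"
    using dir_normal_cone_scaleR[OF cD', of "inverse \<beta>"] \<beta> by simp
  have B: "- vs' \<in> dir_normal_cone K (g xb) (v + ?J *v u)"
    using dir_normal_cone_scaleR[OF cK', of "inverse \<beta>"] \<beta> by (simp add: vs'_def)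
  have C: "dual_norm nY vs' = 1"
    unfolding vs'_def using \<beta> by (subst dual_norm_scale[OF nY]) (auto simp: \<beta>_def)
  have us': "dual_norm nX us' = inverse \<beta> * dual_norm nX us"
    unfolding us'_def using \<beta> by (subst dual_norm_scale[OF nX]) auto
  have D: "ereal (max (dual_norm nX us') (nY v)) \<le> lip nX nY h xb"
  proof (rule ccontr)
    assume "\<not> ?thesis"
    then have "lip nX nY h xb < ereal (max (dual_norm nX us') (nY v))" by (simp only: not_le)
    from ereal_dense2[OF this]
    obtain l where l: "lip nX nY h xb < ereal l" "ereal l < ereal (max (dual_norm nX us') (nY v))"
      by blast
    have "nY v \<le> l" "dual_norm nX us \<le> l * \<beta>" using bound[OF l(1)] by auto
    then have "nY v \<le> l" "dual_norm nX us' \<le> l" using \<beta> by (auto simp: us' field_simps)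
    moreover have "l < max (dual_norm nX us') (nY v)" using l(2) by (simp only: less_ereal.simps)
    ultimately show False by linarith
  qed
  show ?thesis using A B C D u1 by blast
qed

text \<open>Now a single matrix explains both \<open>v\<close> and \<open>us\<close>. The first-order inequality at \<open>x k\<close> yields Clarke
  Jacobians \<open>V k\<close> with \<open>(V k)\<^sup>T V' k\<close> close to \<open>- U' k\<close>. A cluster point \<open>A\<close> satisfies \<open>A\<^sup>T vs = - us\<close>.
  By semismoothness \<open>V k X k\<close> tends to the directional derivative of \<open>h\<close>, so \<open>A u = - v\<close> as well,
  and \<open>B = - A\<close> is the required matrix. Its operator norm is at most the Lipschitz modulus, since this
  holds for all Clarke Jacobians near \<open>xb\<close> up to an arbitrarily small error.\<close>

lemma semismooth_perturbation_lower_bound: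
  fixes g h :: "real^'n \<Rightarrow> real^'m"
  assumes nX: "is_norm nX" and nY: "is_norm nY" and cD: "closed D" and cK: "closed K"
    and xb: "xb \<in> D" "g xb \<in> K" and gC1: "C1_around g xb" and h: "h \<in> F_ss xb"
    and nonsub: "nonsubregular D K (\<lambda>x. g x - h x) xb"
  shows "\<exists>B u vs. transpose (B + jacobian g (at xb)) *v vs \<in> dir_normal_cone D xb u \<and>
     - vs \<in> dir_normal_cone K (g xb) ((B + jacobian g (at xb)) *v u) \<and> nX u = 1 \<and> dual_norm nY vs = 1 \<and>
     ereal (op_norm nX nY B) \<le> lip nX nY h xb"
proof -
  let ?J = "jacobian g (at xb)"
  have ss: "semismooth_at h xb" and h0: "h xb = 0" using h by (auto simp: F_ss_def)
  then have hL: "lipschitz_around h xb" by (simp add: semismooth_at_def)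
  obtain t X us vs u v U' V' E where
    t: "down0 t" and X: "X \<longlonglongrightarrow> u" and u1: "nX u = 1" and X1: "\<And>k. nX (X k) = 1" and
    v: "(\<lambda>k. - (inverse (t k) *\<^sub>R h (xb + t k *\<^sub>R X k))) \<longlonglongrightarrow> v" and
    cD': "us + transpose ?J *v vs \<in> dir_normal_cone D xb u" and
    cK': "- vs \<in> dir_normal_cone K (g xb) (v + ?J *v u)" and
    vs1: "norm vs = 1" and V': "V' \<longlonglongrightarrow> vs" and U': "U' \<longlonglongrightarrow> us" and E: "E \<longlonglongrightarrow> (0::real)" "\<And>k. 0 < E k" and
    opt: "\<And>k \<delta>. 0 < \<delta> \<Longrightarrow> \<forall>\<^sub>F y in nhds (xb + t k *\<^sub>R X k). - (U' k) \<bullet> (y - (xb + t k *\<^sub>R X k))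
        - (E k + \<delta>) * norm (y - (xb + t k *\<^sub>R X k)) \<le> V' k \<bullet> (h y - h (xb + t k *\<^sub>R X k))"
    by (rule directional_normals_of_nonsubregular[OF nX cD cK xb gC1 hL h0 nonsub]) (rule that; assumption)
  have t0: "0 < t k" "t \<longlonglongrightarrow> 0" for k using t by (auto simp: down0_def)
  have "(\<lambda>k. xb + t k *\<^sub>R X k) \<longlonglongrightarrow> xb + 0 *\<^sub>R u" by (intro tendsto_intros t0 X)
  then have xlim: "(\<lambda>k. xb + t k *\<^sub>R X k) \<longlonglongrightarrow> xb" by simp
  obtain T L where T: "open T" "xb \<in> T" "L-lipschitz_on T h" using hL unfolding lipschitz_around_def by blast
  obtain r where r: "r > 0" "cball xb r \<subseteq> T" using T open_contains_cball by blast
  have Lr: "L-lipschitz_on (cball xb r) h" using T(3) r(2) by (rule lipschitz_on_subset)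
  obtain l where l: "\<And>t W V. down0 t \<Longrightarrow> W \<longlonglongrightarrow> u \<Longrightarrow> (\<And>i. V i \<in> clarke_jacobian h (xb + t i *\<^sub>R W i))
        \<Longrightarrow> (\<lambda>i. V i *v W i) \<longlonglongrightarrow> l"
    using ss unfolding semismooth_at_def by blast
  have vl: "v = - l"
  proof -
    have fl: "filterlim t (at_right 0) sequentially"
      by (rule tendsto_imp_filterlim_at_right[OF t0(2)]) (simp add: t0(1))
    have sd: "((\<lambda>t. inverse t *\<^sub>R (h (xb + t *\<^sub>R u) - h xb)) \<longlongrightarrow> l) (at_right 0)"
      by (rule semismooth_directional_derivative[OF Lr r(1)], rule l)
    have A: "(\<lambda>k. inverse (t k) *\<^sub>R (h (xb + t k *\<^sub>R u) - h xb)) \<longlonglongrightarrow> l"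
      by (rule filterlim_compose[OF sd fl])
    have "(\<lambda>k. xb + t k *\<^sub>R u) \<longlonglongrightarrow> xb + 0 *\<^sub>R u" by (intro tendsto_intros t0)
    then have ulim: "(\<lambda>k. xb + t k *\<^sub>R u) \<longlonglongrightarrow> xb" by simp
    have "\<forall>\<^sub>F k in sequentially. xb + t k *\<^sub>R X k \<in> ball xb r \<and> xb + t k *\<^sub>R u \<in> ball xb r"
      using xlim ulim r(1) by (intro eventually_conj topological_tendstoD) auto
    then have ev: "\<forall>\<^sub>F k in sequentially. norm (inverse (t k) *\<^sub>R (h (xb + t k *\<^sub>R X k) - h (xb + t k *\<^sub>R u))) \<le> L * norm (X k - u)"
    proof eventually_elim
      case (elim k)
      have "norm (h (xb + t k *\<^sub>R X k) - h (xb + t k *\<^sub>R u)) \<le> L * norm ((xb + t k *\<^sub>R X k) - (xb + t k *\<^sub>R u))"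
        using lipschitz_on_norm_bound[OF Lr] elim by blast
      also have "(xb + t k *\<^sub>R X k) - (xb + t k *\<^sub>R u) = t k *\<^sub>R (X k - u)" by (simp add: scaleR_diff_right)
      finally show ?case using t0(1)[of k] unfolding norm_scaleR by (simp add: field_simps)
    qed
    have "(\<lambda>k. L * norm (X k - u)) \<longlonglongrightarrow> L * norm (u - u)" by (intro tendsto_intros X)
    then have "(\<lambda>k. L * norm (X k - u)) \<longlonglongrightarrow> 0" by simp
    with ev have B: "(\<lambda>k. inverse (t k) *\<^sub>R (h (xb + t k *\<^sub>R X k) - h (xb + t k *\<^sub>R u))) \<longlonglongrightarrow> 0"
      by (rule Lim_null_comparison)
    have "(\<lambda>k. - (inverse (t k) *\<^sub>R h (xb + t k *\<^sub>R X k))) \<longlonglongrightarrow> - (l + 0)"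
      using tendsto_minus[OF tendsto_add[OF A B]] by (simp add: h0 scaleR_diff_right)
    from LIMSEQ_unique[OF v this] show ?thesis by simp
  qed
  define x where "x k = xb + t k *\<^sub>R X k" for k
  have "\<forall>\<^sub>F k in sequentially. x k \<in> ball xb r"
    unfolding x_def using xlim r(1) by (intro topological_tendstoD) auto
  then obtain k0 where k0: "\<And>k. k \<ge> k0 \<Longrightarrow> x k \<in> ball xb r" by (auto simp: eventually_sequentially)
  have "\<exists>V\<in>clarke_jacobian h (x (k + k0)). norm (transpose V *v V' (k + k0) - (- U' (k + k0))) < 2 * E (k + k0)" for k
  proof -
    have xk: "x (k + k0) \<in> ball xb r" by (rule k0) simp
    define r' where "r' = r - dist (x (k + k0)) xb"
    have r': "r' > 0" using xk by (simp add: r'_def dist_commute)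
    have sub: "cball (x (k + k0)) r' \<subseteq> cball xb r"
    proof
      fix y assume "y \<in> cball (x (k + k0)) r'"
      then have "dist (x (k + k0)) y \<le> r - dist (x (k + k0)) xb" by (simp add: r'_def)
      then show "y \<in> cball xb r" using dist_triangle[of xb y "x (k + k0)"] by (simp add: dist_commute)
    qed
    show ?thesis
    proof (rule clarke_subgradient[OF lipschitz_on_subset[OF Lr sub] r'])
      show "\<forall>\<^sub>F y in nhds (x (k + k0)). - U' (k + k0) \<bullet> (y - x (k + k0)) - (E (k + k0) + \<delta>) * norm (y - x (k + k0))
          \<le> V' (k + k0) \<bullet> (h y - h (x (k + k0)))" if "0 < \<delta>" for \<delta>
        using opt[OF that, of "k + k0"] unfolding x_def .
      show "0 \<le> E (k + k0)" "E (k + k0) < 2 * E (k + k0)"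
        using E(2)[of "k + k0"] by linarith+
    qed
  qed
  then obtain V where V: "\<And>k. V k \<in> clarke_jacobian h (x (k + k0))"
    "\<And>k. norm (transpose (V k) *v V' (k + k0) - (- U' (k + k0))) < 2 * E (k + k0)" by metis
  have "norm (V k *v s) \<le> L * norm s" for k s
    by (rule clarke_jacobian_norm_bound[OF is_norm_norm is_norm_norm lipschitz_on_norm_bound[OF Lr] k0 V(1)]) auto
  then have "norm (V k) \<le> real CARD('m) * L" for k by (rule matrix_norm_le)
  then have "bounded (range V)" by (auto simp: bounded_iff)
  from bounded_imp_convergent_subsequence[OF this]
  obtain A \<sigma> where \<sigma>: "strict_mono \<sigma>" and A: "(V \<circ> \<sigma>) \<longlonglongrightarrow> A" by blast
  have sub: "(\<lambda>k. z (\<sigma> k + k0)) \<longlonglongrightarrow> w" if "z \<longlonglongrightarrow> w" for z :: "nat \<Rightarrow> 'b::topological_space" and w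
    using LIMSEQ_subseq_LIMSEQ[OF LIMSEQ_ignore_initial_segment[OF that, of k0] \<sigma>] by (simp add: o_def)
  have A': "(\<lambda>k. V (\<sigma> k)) \<longlonglongrightarrow> A" using A by (simp add: o_def)
  have "(\<lambda>k. V (\<sigma> k) *v X (\<sigma> k + k0)) \<longlonglongrightarrow> l"
  proof (rule l)
    show "down0 (\<lambda>k. t (\<sigma> k + k0))" using t0 sub[OF t0(2)] by (simp add: down0_def)
    show "(\<lambda>k. X (\<sigma> k + k0)) \<longlonglongrightarrow> u" by (rule sub[OF X])
    show "V (\<sigma> i) \<in> clarke_jacobian h (xb + t (\<sigma> i + k0) *\<^sub>R X (\<sigma> i + k0))" for i
      using V(1)[of "\<sigma> i"] by (simp add: x_def)
  qed
  moreover have "(\<lambda>k. V (\<sigma> k) *v X (\<sigma> k + k0)) \<longlonglongrightarrow> A *v u"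
    by (intro matrix_vector_mult_tendsto A' sub[OF X])
  ultimately have Au: "A *v u = l" using LIMSEQ_unique by blast
  have tr: "transpose A *v vs = - us"
  proof -
    have "(\<lambda>k. transpose (V (\<sigma> k)) *v V' (\<sigma> k + k0) - (- U' (\<sigma> k + k0))) \<longlonglongrightarrow> 0"
    proof -
      have le: "norm (transpose (V (\<sigma> k)) *v V' (\<sigma> k + k0) - (- U' (\<sigma> k + k0))) \<le> 2 * E (\<sigma> k + k0)" for k
        by (rule less_imp_le[OF V(2)[of "\<sigma> k"]])
      have "(\<lambda>k. 2 * E (\<sigma> k + k0)) \<longlonglongrightarrow> 0" by (rule tendsto_mult_right_zero[OF sub[OF E(1)]])
      with always_eventually[OF allI[OF le]] show ?thesis by (rule Lim_null_comparison)
    qed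
    moreover have "(\<lambda>k. transpose (V (\<sigma> k)) *v V' (\<sigma> k + k0) - (- U' (\<sigma> k + k0))) \<longlonglongrightarrow> transpose A *v vs - (- us)"
      using A' unfolding transpose_def
      by (intro tendsto_diff matrix_vector_mult_tendsto tendsto_minus sub[OF U'] sub[OF V'] tendsto_intros)
    ultimately have "transpose A *v vs - (- us) = 0" using LIMSEQ_unique by blast
    then show ?thesis by (simp add: eq_neg_iff_add_eq_0)
  qed
  define \<beta> where "\<beta> = dual_norm nY vs"
  have "vs \<noteq> 0" using vs1 by force
  then have \<beta>: "\<beta> > 0" unfolding \<beta>_def by (rule dual_norm_pos[OF nY])
  define vs' where "vs' = inverse \<beta> *\<^sub>R vs"
  define B where "B = - A"
  have Bu: "(B + ?J) *v u = v + ?J *v u"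
    using matrix_vector_mult_diff_rdistrib[of ?J A u] by (simp add: B_def Au vl)
  have tB: "transpose (B + ?J) *v vs = us + transpose ?J *v vs"
  proof -
    have "transpose (B + ?J) = transpose ?J - transpose A" by (simp add: B_def transpose_def vec_eq_iff)
    then have "transpose (B + ?J) *v vs = transpose ?J *v vs - transpose A *v vs"
      by (simp only: matrix_vector_mult_diff_rdistrib)
    then show ?thesis unfolding tr by simp
  qed
  have "transpose (B + ?J) *v vs' = inverse \<beta> *\<^sub>R (us + transpose ?J *v vs)"
    unfolding vs'_def matrix_vector_mult_scaleR tB ..
  then have C1: "transpose (B + ?J) *v vs' \<in> dir_normal_cone D xb u"
    using dir_normal_cone_scaleR[OF cD', of "inverse \<beta>"] \<beta> by simp
  have C2: "- vs' \<in> dir_normal_cone K (g xb) ((B + ?J) *v u)"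
    using dir_normal_cone_scaleR[OF cK', of "inverse \<beta>"] \<beta> unfolding Bu by (simp add: vs'_def)
  have C3: "dual_norm nY vs' = 1"
    unfolding vs'_def using \<beta> by (subst dual_norm_scale[OF nY]) (auto simp: \<beta>_def)
  have C4: "ereal (op_norm nX nY B) \<le> lip nX nY h xb"
  proof (rule ccontr)
    assume "\<not> ?thesis"
    then have "lip nX nY h xb < ereal (op_norm nX nY B)" by (simp only: not_le)
    from ereal_dense2[OF this]
    obtain c where c: "lip nX nY h xb < ereal c" "ereal c < ereal (op_norm nX nY B)"
      by blast
    obtain \<rho> where \<rho>: "\<rho> > 0" "\<And>x x'. x \<in> ball xb \<rho> \<Longrightarrow> x' \<in> ball xb \<rho> \<Longrightarrow> nY (h x - h x') \<le> c * nX (x - x')"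
      using lip_lessD[OF nX nY c(1)] by metis
    have "x \<longlonglongrightarrow> xb" using xlim by (simp add: x_def[abs_def])
    then have ev: "\<forall>\<^sub>F k in sequentially. x (\<sigma> k + k0) \<in> ball xb \<rho>"
      using sub[of x xb] \<rho>(1) by (intro topological_tendstoD) auto
    have le: "nY (A *v s) \<le> c * nX s" for s
    proof (rule tendsto_upperbound)
      show "(\<lambda>k. nY (V (\<sigma> k) *v s)) \<longlonglongrightarrow> nY (A *v s)"
        by (intro is_norm_tendsto[OF nY] matrix_vector_mult_tendsto A' tendsto_const)
      show "\<forall>\<^sub>F k in sequentially. nY (V (\<sigma> k) *v s) \<le> c * nX s"
        using ev by eventually_elim (rule clarke_jacobian_norm_bound[OF nX nY \<rho>(2) _ V(1)])
    qed simp
    have "0 \<le> nY (A *v u)" by (rule is_norm_nonneg[OF nY])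
    also have "\<dots> \<le> c" using le[of u] u1 by simp
    finally have "0 \<le> c" .
    have "op_norm nX nY B \<le> c"
    proof (rule op_norm_least[OF nX _ \<open>0 \<le> c\<close>])
      fix s
      have "B *v s = - (A *v s)" using matrix_vector_mult_diff_rdistrib[of 0 A s] by (simp add: B_def)
      then show "nY (B *v s) \<le> c * nX s" using le[of s] by (simp add: is_norm_uminus[OF nY])
    qed
    then show False using c(2) by simp
  qed
  show ?thesis using C1 C2 C3 C4 u1 by blast
qed

section \<open>Flat perturbations with prescribed first-order expansions\<close>

lemma truncated_square_derivative:
  "((\<lambda>r::real. (max 0 r)\<^sup>2) has_real_derivative 2 * max 0 r) (at r)"
proof (cases r "0::real" rule: linorder_cases)
  case less
  have "((\<lambda>r::real. 0) has_real_derivative 2 * max 0 r) (at r)" using less by simp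
  then show ?thesis
    by (rule has_field_derivative_transform_within_open[where S = "{..<0}"]) (use less in auto)
next
  case equal
  have "((\<lambda>h::real. (max 0 h)\<^sup>2 / h) \<longlongrightarrow> 0) (at 0)"
  proof (rule Lim_null_comparison)
    show "\<forall>\<^sub>F h in at (0::real). norm ((max 0 h)\<^sup>2 / h) \<le> \<bar>h\<bar>"
      by (auto simp: eventually_at_filter max_def power2_eq_square)
    show "((\<lambda>h::real. \<bar>h\<bar>) \<longlongrightarrow> 0) (at 0)"
      using tendsto_rabs[OF tendsto_ident_at[of "0::real" UNIV]] by simp
  qed
  then show ?thesis using equal by (simp add: DERIV_def)
next
  case greater
  have "((\<lambda>r::real. r\<^sup>2) has_real_derivative 2 * max 0 r) (at r)"
    using greater by (auto intro!: derivative_eq_intros)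
  then show ?thesis
    by (rule has_field_derivative_transform_within_open[where S = "{0<..}"]) (use greater in auto)
qed

text \<open>A function of class C1 supported in the unit ball with value 1 and derivative 0 at the
  origin. The square smooths the kink of the positive part.\<close>

definition bump :: "'a::real_inner \<Rightarrow> real" where
  "bump z = (max 0 (1 - z \<bullet> z))\<^sup>2"

lemma bump_derivative:
  "(bump has_derivative (\<lambda>y. - 4 * max 0 (1 - z \<bullet> z) * (z \<bullet> y))) (at z)"
proof -
  have "((\<lambda>z. 1 - z \<bullet> z) has_derivative (\<lambda>y. - 2 * (z \<bullet> y))) (at z)"
    by (auto intro!: derivative_eq_intros simp: inner_commute)
  then have "((\<lambda>z. (max 0 (1 - z \<bullet> z))\<^sup>2) has_derivative (\<lambda>y. 2 * max 0 (1 - z \<bullet> z) * (- 2 * (z \<bullet> y)))) (at z)"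
    by (rule has_derivative_compose[where g = "\<lambda>r. (max 0 r)\<^sup>2"])
      (rule has_field_derivative_imp_has_derivative[OF truncated_square_derivative])
  then show ?thesis
    unfolding bump_def[abs_def] by (rule has_derivative_eq_rhs) auto
qed

lemma bump_outside: "1 \<le> norm z \<Longrightarrow> max 0 (1 - z \<bullet> z) = 0"
  using one_le_power[of "norm z" 2] by (simp add: power2_norm_eq_inner)

lemma bump_bounds: "0 \<le> bump z" "bump z \<le> 1" "1 - bump z \<le> 2 * (norm z)\<^sup>2"
proof -
  define s where "s = z \<bullet> z"
  have s: "0 \<le> s" "(norm z)\<^sup>2 = s" by (auto simp: s_def power2_norm_eq_inner)
  show "0 \<le> bump z" by (simp add: bump_def)
  have "(max 0 (1 - s))\<^sup>2 \<le> 1\<^sup>2" using s by (intro power_mono) auto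
  then show "bump z \<le> 1" by (simp add: bump_def s_def)
  have "1 - (max 0 (1 - s))\<^sup>2 \<le> 2 * s"
  proof (cases "s \<le> 1")
    case True
    then have "1 - (max 0 (1 - s))\<^sup>2 = 2 * s - s\<^sup>2" by (simp add: power2_eq_square algebra_simps)
    then show ?thesis by simp
  qed simp
  then show "1 - bump z \<le> 2 * (norm z)\<^sup>2" by (simp add: bump_def s(2) flip: s_def)
qed

text \<open>The affine map \<open>b + E (x - p)\<close>, cut off outside the ball of radius \<open>R\<close> around \<open>p\<close>.\<close>

definition affine_bump :: "real^'n \<Rightarrow> real \<Rightarrow> real^'m \<Rightarrow> real^'n^'m \<Rightarrow> real^'n \<Rightarrow> real^'m" where
  "affine_bump p R b E x = bump ((x - p) /\<^sub>R R) *\<^sub>R (b + E *v (x - p))"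

definition affine_bump_deriv :: "real^'n \<Rightarrow> real \<Rightarrow> real^'m \<Rightarrow> real^'n^'m \<Rightarrow> real^'n \<Rightarrow> real^'n \<Rightarrow> real^'m" where
  "affine_bump_deriv p R b E x y =
     bump ((x - p) /\<^sub>R R) *\<^sub>R (E *v y) +
     (- 4 * max 0 (1 - ((x - p) /\<^sub>R R) \<bullet> ((x - p) /\<^sub>R R)) * (((x - p) /\<^sub>R R) \<bullet> (y /\<^sub>R R))) *\<^sub>R (b + E *v (x - p))"

lemma affine_bump_has_derivative:
  "(affine_bump p R b E has_derivative affine_bump_deriv p R b E x) (at x)"
proof -
  have "((\<lambda>x. (x - p) /\<^sub>R R) has_derivative (\<lambda>y. y /\<^sub>R R)) (at x)"
    by (auto intro!: derivative_eq_intros)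
  then have 1: "((\<lambda>x. bump ((x - p) /\<^sub>R R)) has_derivative
      (\<lambda>y. - 4 * max 0 (1 - ((x - p) /\<^sub>R R) \<bullet> ((x - p) /\<^sub>R R)) * (((x - p) /\<^sub>R R) \<bullet> (y /\<^sub>R R)))) (at x)"
    by (rule has_derivative_compose[where g = bump]) (rule bump_derivative)
  have "((\<lambda>x. x - p) has_derivative (\<lambda>y. y)) (at x)"
    by (auto intro!: derivative_eq_intros)
  then have "((\<lambda>x. E *v (x - p)) has_derivative (\<lambda>y. E *v y)) (at x)"
    by (rule bounded_linear.has_derivative[OF matrix_vector_mul_bounded_linear])
  then have 2: "((\<lambda>x. b + E *v (x - p)) has_derivative (\<lambda>y. E *v y)) (at x)"
    using has_derivative_add[OF has_derivative_const[of b]] by fastforce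
  show ?thesis
    unfolding affine_bump_def[abs_def] affine_bump_deriv_def[abs_def]
    by (rule has_derivative_scaleR[OF 1 2])
qed

lemma affine_bump_outside:
  assumes "R > 0" "R \<le> norm (x - p)"
  shows "affine_bump p R b E x = 0" "affine_bump_deriv p R b E x y = 0"
proof -
  have "1 \<le> norm ((x - p) /\<^sub>R R)" using assms unfolding norm_scaleR by (simp add: field_simps)
  then have "max 0 (1 - ((x - p) /\<^sub>R R) \<bullet> ((x - p) /\<^sub>R R)) = 0" by (rule bump_outside)
  then show "affine_bump p R b E x = 0" "affine_bump_deriv p R b E x y = 0"
    by (simp_all only: affine_bump_def affine_bump_deriv_def bump_def) simp_all
qed

text \<open>The derivative is controlled by \<open>|b| / R + |E|\<close> uniformly in \<open>x\<close>. So affine pieces with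
  values \<open>b = o(R)\<close> and slopes \<open>E = o(1)\<close> can be summed in class C1.\<close>

lemma affine_bump_deriv_bound:
  fixes E :: "real^'n^'m"
  assumes R: "R > 0"
  shows "norm (affine_bump_deriv p R b E x y) \<le> 5 * (norm b / R + norm E) * norm y"
proof (cases "R \<le> norm (x - p)")
  case True
  then show ?thesis using R by (simp add: affine_bump_outside)
next
  case False
  define z where "z = (x - p) /\<^sub>R R"
  define m where "m = max 0 (1 - z \<bullet> z)"
  have z: "norm z \<le> 1" using False R unfolding z_def norm_scaleR by (simp add: field_simps)
  have m: "0 \<le> m" "m \<le> 1" by (auto simp: m_def)
  have b: "norm (b + E *v (x - p)) \<le> R * (norm b / R + norm E)"
  proof -
    have "norm (b + E *v (x - p)) \<le> norm b + norm E * norm (x - p)"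
      using norm_triangle_ineq[of b "E *v (x - p)"] norm_matrix_vector_mult_le[of E "x - p"] by linarith
    also have "\<dots> \<le> norm b + norm E * R" using False by (intro add_left_mono mult_left_mono) auto
    finally show ?thesis using R by (simp add: distrib_left mult.commute)
  qed
  have in_le: "\<bar>z \<bullet> (y /\<^sub>R R)\<bar> \<le> norm y / R"
  proof -
    have "\<bar>z \<bullet> (y /\<^sub>R R)\<bar> \<le> norm z * norm (y /\<^sub>R R)" by (rule Cauchy_Schwarz_ineq2)
    also have "\<dots> \<le> 1 * norm (y /\<^sub>R R)" using z by (intro mult_right_mono) auto
    finally show ?thesis using R by (simp add: divide_inverse_commute)
  qed
  have "norm (affine_bump_deriv p R b E x y) \<le> norm (bump z *\<^sub>R (E *v y)) + norm ((- 4 * m * (z \<bullet> (y /\<^sub>R R))) *\<^sub>R (b + E *v (x - p)))"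
    unfolding affine_bump_deriv_def z_def[symmetric] m_def[symmetric] by (rule norm_triangle_ineq)
  also have "norm (bump z *\<^sub>R (E *v y)) \<le> 1 * (norm E * norm y)"
    unfolding norm_scaleR using bump_bounds[of z] norm_matrix_vector_mult_le[of E y]
    by (intro mult_mono) auto
  also have "norm ((- 4 * m * (z \<bullet> (y /\<^sub>R R))) *\<^sub>R (b + E *v (x - p))) \<le> (4 * 1 * (norm y / R)) * (R * (norm b / R + norm E))"
    unfolding norm_scaleR
  proof (rule mult_mono[OF _ b])
    have "m * \<bar>z \<bullet> (y /\<^sub>R R)\<bar> \<le> 1 * (norm y / R)" using m in_le by (intro mult_mono) auto
    then show "\<bar>- 4 * m * (z \<bullet> (y /\<^sub>R R))\<bar> \<le> 4 * 1 * (norm y / R)" using m by (simp add: abs_mult)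
  qed (use R in auto)
  also have "(4 * 1 * (norm y / R)) * (R * (norm b / R + norm E)) = 4 * (norm b / R + norm E) * norm y"
    using R by simp
  finally have "norm (affine_bump_deriv p R b E x y) \<le> norm E * norm y + 4 * (norm b / R + norm E) * norm y" by simp
  moreover have "norm E * norm y \<le> (norm b / R + norm E) * norm y" using R by (intro mult_right_mono) auto
  moreover have "5 * (norm b / R + norm E) * norm y = 4 * (norm b / R + norm E) * norm y + (norm b / R + norm E) * norm y"
    by (simp add: distrib_right)
  ultimately show ?thesis by linarith
qed

text \<open>The error has the explicit modulus \<open>2 |x - p|\<^sup>2 / R\<close> for all admissible \<open>b\<close> and \<open>E\<close>. This
  uniformity allows the perturbation below to choose \<open>b\<close> after the modulus is known.\<close>

lemma affine_bump_near_center: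
  fixes E :: "real^'n^'m"
  assumes R: "R > 0" and x: "norm (x - p) < R" and small: "norm b / R + norm E \<le> 1"
  shows "norm (affine_bump p R b E x - b - E *v (x - p)) \<le> 2 / R * (norm (x - p))\<^sup>2"
proof -
  define z where "z = (x - p) /\<^sub>R R"
  have b: "norm (b + E *v (x - p)) \<le> R"
  proof -
    have "norm (b + E *v (x - p)) \<le> norm b + norm E * norm (x - p)"
      using norm_triangle_ineq[of b "E *v (x - p)"] norm_matrix_vector_mult_le[of E "x - p"] by linarith
    also have "\<dots> \<le> norm b + norm E * R" using x by (intro add_left_mono mult_left_mono) auto
    also have "\<dots> = R * (norm b / R + norm E)" using R by (simp add: distrib_left mult.commute)
    also have "\<dots> \<le> R * 1" using small R by (intro mult_left_mono) auto
    finally show ?thesis by simp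
  qed
  have "affine_bump p R b E x - b - E *v (x - p) = - ((1 - bump z) *\<^sub>R (b + E *v (x - p)))"
    by (simp add: affine_bump_def z_def scaleR_diff_left)
  then have "norm (affine_bump p R b E x - b - E *v (x - p)) = (1 - bump z) * norm (b + E *v (x - p))"
    using bump_bounds(2)[of z] by simp
  also have "\<dots> \<le> (2 * (norm z)\<^sup>2) * R"
    using bump_bounds[of z] b by (intro mult_mono) auto
  also have "\<dots> = 2 / R * (norm (x - p))\<^sup>2"
    using R unfolding z_def norm_scaleR by (simp add: power_mult_distrib power2_eq_square field_simps)
  finally show ?thesis .
qed

lemma affine_bump_deriv_continuous: "continuous_on UNIV (\<lambda>x. affine_bump_deriv p R b E x y)"
proof -
  have "continuous_on UNIV (\<lambda>x. E *v (x - p))"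
    by (intro linear_continuous_on_compose[where g = "(*v) E"] continuous_intros) auto
  then show ?thesis
    unfolding affine_bump_deriv_def bump_def by (intro continuous_intros)
qed

text \<open>A function of class C1 that is flat at \<open>xb\<close> but has prescribed first-order expansions at a
  sequence \<open>p k\<close> tending to \<open>xb\<close>: the sum of the cut-off affine maps. By the bound on their derivatives
  the differentiated series converges uniformly on the whole space, and since the supports do not
  overlap, only one summand is visible near each \<open>p k\<close>.\<close>

lemma C1_interpolation:
  fixes p :: "nat \<Rightarrow> real^'n" and b :: "nat \<Rightarrow> real^'m" and E :: "nat \<Rightarrow> real^'n^'m"
  assumes R: "\<And>k. R k > 0" and small: "\<And>k. norm (b k) / R k + norm (E k) \<le> (1/2) ^ k"
    and xb: "\<And>k. R k \<le> norm (xb - p k)"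
    and disj: "\<And>j k x. j \<noteq> k \<Longrightarrow> norm (x - p k) < R k \<Longrightarrow> R j \<le> norm (x - p j)"
  obtains h where "C1_around h xb" "h xb = 0" "jacobian h (at xb) = 0"
    "\<And>k x. norm (x - p k) < R k \<Longrightarrow> norm (h x - b k - E k *v (x - p k)) \<le> 2 / R k * (norm (x - p k))\<^sup>2"
proof -
  define \<phi> where "\<phi> k = affine_bump (p k) (R k) (b k) (E k)" for k
  define \<phi>' where "\<phi>' k = affine_bump_deriv (p k) (R k) (b k) (E k)" for k
  define \<Phi>' where "\<Phi>' x y = (\<Sum>k. \<phi>' k x y)" for x y
  have bd: "norm (\<phi>' k x y) \<le> (5 * norm y) * (1/2) ^ k" for k x y
  proof -
    have "norm (\<phi>' k x y) \<le> 5 * (norm (b k) / R k + norm (E k)) * norm y"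
      unfolding \<phi>'_def by (rule affine_bump_deriv_bound[OF R])
    also have "\<dots> \<le> 5 * (1/2) ^ k * norm y"
      using small[of k] by (intro mult_right_mono mult_left_mono) auto
    finally show ?thesis by (simp add: mult_ac)
  qed
  have sumM: "summable (\<lambda>k. (5 * norm y) * (1/2 :: real) ^ k)" for y :: "real^'n"
    by (intro summable_mult summable_geometric) simp
  have summ: "summable (\<lambda>k. \<phi>' k x y)" for x y
    by (rule summable_comparison_test'[OF sumM[of y], of 0]) (rule bd)
  have tail: "norm ((\<Sum>k<n. \<phi>' k x y) - \<Phi>' x y) \<le> 10 * (1/2) ^ n * norm y" for n x y
  proof -
    have "(\<Sum>k<n. \<phi>' k x y) - \<Phi>' x y = - (\<Sum>k. \<phi>' (k + n) x y)"
      using suminf_minus_initial_segment[OF summ[of x y], of n] by (simp add: \<Phi>'_def)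
    then have "norm ((\<Sum>k<n. \<phi>' k x y) - \<Phi>' x y) = norm (\<Sum>k. \<phi>' (k + n) x y)" by simp
    also have "\<dots> \<le> (\<Sum>k. (5 * norm y * (1/2) ^ n) * (1/2) ^ k)"
    proof (rule norm_suminf_le)
      show "norm (\<phi>' (k + n) x y) \<le> (5 * norm y * (1/2) ^ n) * (1/2) ^ k" for k
        using bd[of "k + n" x y] by (simp add: power_add mult_ac)
      show "summable (\<lambda>k. (5 * norm y * (1/2) ^ n) * (1/2 :: real) ^ k)"
        by (intro summable_mult summable_geometric) simp
    qed
    also have "\<dots> = (5 * norm y * (1/2) ^ n) * 2"
      by (subst suminf_mult) (auto simp: suminf_geometric intro!: summable_geometric)
    finally show ?thesis by (simp add: mult_ac)
  qed
  have phi_xb: "\<phi> k xb = 0" "\<phi>' k xb y = 0" for k y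
    unfolding \<phi>_def \<phi>'_def using affine_bump_outside[OF R xb] by auto
  have "\<exists>h. \<forall>x\<in>UNIV. (\<lambda>k. \<phi> k x) sums h x \<and> (h has_derivative \<Phi>' x) (at x within UNIV)"
  proof (rule has_derivative_series[where f' = \<phi>' and x = xb and l = 0])
    show "(\<phi> n has_derivative \<phi>' n x) (at x within UNIV)" for n x
      unfolding \<phi>_def \<phi>'_def by (simp add: affine_bump_has_derivative)
    show "(\<lambda>n. \<phi> n xb) sums 0" by (simp add: phi_xb)
    fix e :: real assume "e > 0"
    have "(\<lambda>n. 10 * (1/2 :: real) ^ n) \<longlonglongrightarrow> 10 * 0"
      by (intro tendsto_intros LIMSEQ_power_zero) auto
    then have "\<forall>\<^sub>F n in sequentially. 10 * (1/2 :: real) ^ n < e"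
      using \<open>e > 0\<close> by (intro order_tendstoD(2)) auto
    then show "\<forall>\<^sub>F n in sequentially. \<forall>x\<in>UNIV. \<forall>h. norm ((\<Sum>i<n. \<phi>' i x h) - \<Phi>' x h) \<le> e * norm h"
    proof eventually_elim
      case (elim n)
      show ?case
      proof (intro ballI allI)
        fix x h :: "real^'n"
        show "norm ((\<Sum>i<n. \<phi>' i x h) - \<Phi>' x h) \<le> e * norm h"
          using tail[where n = n and x = x and y = h] mult_right_mono[OF less_imp_le[OF elim], of "norm h"] by simp
      qed
    qed
  qed auto
  then obtain h where h: "\<And>x. (\<lambda>k. \<phi> k x) sums h x" "\<And>x. (h has_derivative \<Phi>' x) (at x)" by auto
  have cont: "continuous_on UNIV (\<lambda>x. \<Phi>' x y)" for y
  proof -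
    have "uniform_limit UNIV (\<lambda>n x. \<Sum>k<n. \<phi>' k x y) (\<lambda>x. \<Phi>' x y) sequentially"
      unfolding \<Phi>'_def by (rule Weierstrass_m_test[OF _ sumM[of y]]) (rule bd)
    moreover have "\<forall>\<^sub>F n in sequentially. continuous_on UNIV (\<lambda>x. \<Sum>k<n. \<phi>' k x y)"
      unfolding \<phi>'_def by (intro always_eventually allI continuous_on_sum affine_bump_deriv_continuous)
    ultimately show ?thesis by (intro uniform_limit_theorem) auto
  qed
  have jac: "jacobian h (at x) = matrix (\<Phi>' x)" for x by (rule jacobian_eq(1)[OF h(2)])
  show thesis
  proof
    show "C1_around h xb"
      unfolding C1_around_def
    proof (intro exI[of _ UNIV] conjI ballI)
      show "h differentiable (at x)" for x using h(2) by (auto simp: differentiable_def)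
      show "continuous_on UNIV (\<lambda>x. jacobian h (at x))"
        unfolding jac matrix_def by (intro continuous_on_vec_lambda continuous_on_component cont)
    qed auto
    show "h xb = 0" using h(1)[of xb] by (simp add: phi_xb sums_iff)
    show "jacobian h (at xb) = 0"
      unfolding jac by (simp add: matrix_def \<Phi>'_def phi_xb vec_eq_iff)
    fix k x assume x: "norm (x - p k) < R k"
    have "(\<lambda>j. \<phi> j x) sums (\<Sum>j\<in>{k}. \<phi> j x)"
    proof (rule sums_finite)
      show "\<phi> j x = 0" if "j \<notin> {k}" for j
        unfolding \<phi>_def using affine_bump_outside(1)[OF R disj[OF _ x]] that by auto
    qed simp
    then have "h x = \<phi> k x" using h(1)[of x] sums_unique2 by fastforce
    moreover have "norm (b k) / R k + norm (E k) \<le> 1"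
      using small[of k] power_le_one[of "1/2 :: real" k] by linarith
    ultimately show "norm (h x - b k - E k *v (x - p k)) \<le> 2 / R k * (norm (x - p k))\<^sup>2"
      using affine_bump_near_center[OF R x] by (simp add: \<phi>_def)
  qed
qed

section \<open>Destroying subregularity by a flat perturbation\<close>

text \<open>If violated, the normalised differences \<open>(a - z) / |a - z|\<close> along a sequence \<open>a\<close> tending to \<open>z\<close> cluster
  at a tangent vector on which \<open>zs\<close> is positive.\<close>

lemma normal_cone_imp_frechet_normal:
  fixes A :: "'a::euclidean_space set"
  assumes zs: "zs \<in> normal_cone A z" and \<epsilon>: "0 < \<epsilon>"
  shows "\<exists>\<delta>>0. \<forall>a\<in>A. norm (a - z) < \<delta> \<longrightarrow> zs \<bullet> (a - z) \<le> \<epsilon> * norm (a - z)"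
proof (rule ccontr)
  assume no: "\<not> ?thesis"
  have "\<exists>a. a \<in> A \<and> norm (a - z) < 1 / real (Suc k) \<and> \<epsilon> * norm (a - z) < zs \<bullet> (a - z)" for k
    using no[simplified, rule_format, of "1 / real (Suc k)"] by (auto simp: not_le)
  then obtain a where a: "\<And>k. a k \<in> A" "\<And>k. norm (a k - z) < 1 / real (Suc k)"
    "\<And>k. \<epsilon> * norm (a k - z) < zs \<bullet> (a k - z)" by metis
  define t where "t k = norm (a k - z)" for k
  define W where "W k = (a k - z) /\<^sub>R t k" for k
  have t: "0 < t k" for k
  proof -
    have "a k \<noteq> z" using a(3)[of k] by auto
    then show ?thesis by (simp add: t_def)
  qed
  have n0: "(\<lambda>k. 1 / real (Suc k)) \<longlonglongrightarrow> 0"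
    using LIMSEQ_inverse_real_of_nat by (simp only: divide_inverse mult_1_left)
  have t0: "t \<longlonglongrightarrow> 0"
    by (rule Lim_null_comparison[OF always_eventually n0], rule allI) (use less_imp_le[OF a(2)] in \<open>simp add: t_def\<close>)
  have W1: "W k \<in> sphere 0 1" for k using t[of k] by (simp add: W_def t_def)
  obtain w \<sigma> where w: "strict_mono (\<sigma> :: nat \<Rightarrow> nat)" "(W \<circ> \<sigma>) \<longlonglongrightarrow> w"
    using compact_imp_seq_compact[OF compact_sphere, of "0::'a" 1] W1 unfolding seq_compact_def by meson
  have "w \<in> tangent_cone A z"
    unfolding tangent_cone_def
  proof (intro CollectI exI conjI allI)
    show "(\<lambda>k. W (\<sigma> k)) \<longlonglongrightarrow> w" using w(2) by (simp add: o_def)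
    show "down0 (\<lambda>k. t (\<sigma> k))"
      using t LIMSEQ_subseq_LIMSEQ[OF t0 w(1)] by (simp add: down0_def o_def)
    show "z + t (\<sigma> k) *\<^sub>R W (\<sigma> k) \<in> A" for k
      using a(1)[of "\<sigma> k"] t[of "\<sigma> k"] by (simp add: W_def)
  qed
  then have "zs \<bullet> w \<le> 0" using zs by (auto simp: normal_cone_def split: if_splits)
  moreover have "\<epsilon> \<le> zs \<bullet> w"
  proof (rule LIMSEQ_le_const)
    show "(\<lambda>k. zs \<bullet> W (\<sigma> k)) \<longlonglongrightarrow> zs \<bullet> w" using w(2) by (intro tendsto_intros) (simp add: o_def)
    have "\<epsilon> \<le> zs \<bullet> W k" for k
      using a(3)[of k] t[of k] unfolding W_def t_def inner_scaleR_right by (simp add: field_simps)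
    then show "\<exists>N. \<forall>n\<ge>N. \<epsilon> \<le> zs \<bullet> W (\<sigma> n)" by blast
  qed
  ultimately show False using \<epsilon> by linarith
qed

text \<open>Suppose that near \<open>p\<close> the map \<open>f\<close> equals \<open>q + B y\<close> plus a shift of size \<open>\<alpha>\<close> in direction \<open>qs\<close>, up to
  \<open>o(|y|)\<close>, where \<open>ps\<close> and \<open>qs\<close> are normals that \<open>B\<close> matches with opposite sign. If \<open>p + y\<close> is a solution,
  then \<open>qs \<bullet> (f (p + y) - q) = \<alpha> - ps \<bullet> y + o(|y|)\<close>, where \<open>ps \<bullet> y \<le> o(|y|)\<close>, whereas normality to \<open>K\<close> bounds
  the left-hand side by \<open>o(|y| + \<alpha>)\<close>. So \<open>\<alpha> = o(|y|)\<close>: the solutions are further away than any given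
  multiple of the residual \<open>\<alpha> / |qs|\<close> at \<open>p\<close>. The remainder enters only through the modulus
  \<open>\<omega>\<close>, and \<open>\<alpha>0\<close> is the same for all \<open>f\<close> with this modulus.\<close>

lemma solutions_pushed_away:
  fixes B :: "real^'n^'m" and ps :: "real^'n" and qs :: "real^'m"
  assumes ps: "ps \<in> normal_cone D p" and qs: "qs \<in> normal_cone K q" "qs \<noteq> 0"
    and B: "transpose B *v qs = - ps"
    and \<omega>: "\<And>e. 0 < e \<Longrightarrow> \<exists>d>0. \<forall>y. norm y < d \<longrightarrow> \<omega> y \<le> e * norm y"
    and R: "0 < R" and \<kappa>: "0 < \<kappa>"
  shows "\<exists>\<alpha>0>0. \<forall>\<alpha> f. 0 < \<alpha> \<longrightarrow> \<alpha> \<le> \<alpha>0 \<longrightarrow>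
     (\<forall>y. norm y < R \<longrightarrow> norm (f (p + y) - q - (\<alpha> / (norm qs)\<^sup>2) *\<^sub>R qs - B *v y) \<le> \<omega> y) \<longrightarrow>
     (\<forall>x\<in>D. f x \<in> K \<longrightarrow> \<kappa> * \<alpha> \<le> norm (x - p))"
proof -
  define s where "s = norm qs"
  define C where "C = norm B"
  have s: "s > 0" and C: "C \<ge> 0" using qs(2) by (auto simp: s_def C_def)
  \<comment> \<open>the common tolerance for the remainder and both normality estimates; the bounds are those that the final computation needs\<close>
  define \<theta> where "\<theta> = Min {1, s / 2, 1 / (2 * \<kappa> * (2 + s + C))}"
  have \<theta>: "0 < \<theta>" "\<theta> \<le> 1" "\<theta> \<le> s / 2" "\<theta> \<le> 1 / (2 * \<kappa> * (2 + s + C))"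
    using s C \<kappa> by (auto simp: \<theta>_def)
  obtain d1 where d1: "d1 > 0" "\<And>y. norm y < d1 \<Longrightarrow> \<omega> y \<le> \<theta> * norm y" using \<omega>[OF \<theta>(1)] by blast
  obtain d2 where d2: "d2 > 0" "\<And>a. a \<in> D \<Longrightarrow> norm (a - p) < d2 \<Longrightarrow> ps \<bullet> (a - p) \<le> \<theta> * norm (a - p)"
    using normal_cone_imp_frechet_normal[OF ps \<theta>(1)] by blast
  obtain d3 where d3: "d3 > 0" "\<And>a. a \<in> K \<Longrightarrow> norm (a - q) < d3 \<Longrightarrow> qs \<bullet> (a - q) \<le> \<theta> * norm (a - q)"
    using normal_cone_imp_frechet_normal[OF qs(1) \<theta>(1)] by blast
  define c where "c = 1 / s + (C + 1) * \<kappa>"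
  have c: "c > 0" using s C \<kappa> by (simp add: c_def add_pos_pos)
  define \<alpha>0 where "\<alpha>0 = Min {d1 / \<kappa>, d2 / \<kappa>, R / \<kappa>, d3 / (2 * c)}"
  have \<alpha>0: "\<alpha>0 > 0" "\<alpha>0 \<le> d1 / \<kappa>" "\<alpha>0 \<le> d2 / \<kappa>" "\<alpha>0 \<le> R / \<kappa>" "\<alpha>0 \<le> d3 / (2 * c)"
    using d1 d2 d3 R \<kappa> c by (auto simp: \<alpha>0_def)
  have "\<kappa> * \<alpha> \<le> norm (x - p)"
    if \<alpha>: "0 < \<alpha>" "\<alpha> \<le> \<alpha>0" and f: "\<And>y. norm y < R \<Longrightarrow> norm (f (p + y) - q - (\<alpha> / (norm qs)\<^sup>2) *\<^sub>R qs - B *v y) \<le> \<omega> y"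
      and x: "x \<in> D" "f x \<in> K" for \<alpha> f x
  proof (rule ccontr)
    assume neg: "\<not> \<kappa> * \<alpha> \<le> norm (x - p)"
    define y where "y = x - p"
    have y: "norm y < \<kappa> * \<alpha>" using neg by (simp add: y_def)
    have "\<kappa> * \<alpha> \<le> \<kappa> * \<alpha>0" using \<alpha> \<kappa> by (intro mult_left_mono) auto
    moreover have "\<kappa> * \<alpha>0 \<le> d1" "\<kappa> * \<alpha>0 \<le> d2" "\<kappa> * \<alpha>0 \<le> R"
      using \<alpha>0(2-4) \<kappa> by (auto simp: field_simps)
    ultimately have yd: "norm y < d1" "norm y < d2" "norm y < R" using y by linarith+
    define r where "r = f x - q - (\<alpha> / s\<^sup>2) *\<^sub>R qs - B *v y"
    have "norm r \<le> \<omega> y" using f[OF yd(3)] by (simp add: r_def y_def s_def)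
    also have "\<omega> y \<le> \<theta> * norm y" by (rule d1(2)[OF yd(1)])
    finally have r: "norm r \<le> \<theta> * norm y" .
    define z where "z = f x - q"
    have zr: "z = (\<alpha> / s\<^sup>2) *\<^sub>R qs + B *v y + r" by (simp add: z_def r_def)
    have By: "norm (B *v y) \<le> C * norm y" unfolding C_def by (rule norm_matrix_vector_mult_le)
    have "norm ((\<alpha> / s\<^sup>2) *\<^sub>R qs) = \<alpha> / s" using s \<alpha>(1) by (simp add: s_def power2_eq_square)
    then have z_le: "norm z \<le> \<alpha> / s + C * norm y + \<theta> * norm y"
      using norm_triangle_ineq[of "(\<alpha> / s\<^sup>2) *\<^sub>R qs + B *v y" r] norm_triangle_ineq[of "(\<alpha> / s\<^sup>2) *\<^sub>R qs" "B *v y"] By r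
      unfolding zr by linarith
    have "norm z \<le> \<alpha> / s + (C + 1) * (\<kappa> * \<alpha>)"
    proof -
      have "\<theta> * norm y \<le> 1 * norm y" using \<theta>(2) by (intro mult_right_mono) auto
      moreover have "(C + 1) * norm y \<le> (C + 1) * (\<kappa> * \<alpha>)" using y C by (intro mult_left_mono) auto
      ultimately show ?thesis using z_le by (simp add: distrib_right)
    qed
    also have "\<dots> = c * \<alpha>" by (simp add: c_def distrib_right)
    also have "\<dots> \<le> c * (d3 / (2 * c))" using c \<alpha> \<alpha>0(5) by (intro mult_left_mono) auto
    also have "\<dots> = d3 / 2" using c by simp
    also have "\<dots> < d3" using d3(1) by simp
    finally have "norm (f x - q) < d3" by (simp add: z_def)
    then have K: "qs \<bullet> z \<le> \<theta> * norm z" unfolding z_def by (rule d3(2)[OF x(2)])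
    have D: "ps \<bullet> y \<le> \<theta> * norm y" using d2(2)[OF x(1)] yd(2) by (simp add: y_def)
    have "qs \<bullet> ((\<alpha> / s\<^sup>2) *\<^sub>R qs) = \<alpha>" using s by (simp add: s_def power2_norm_eq_inner)
    moreover have "qs \<bullet> (B *v y) = - (ps \<bullet> y)"
    proof -
      have "qs \<bullet> (B *v y) = (transpose B *v qs) \<bullet> y" by (simp add: dot_lmul_matrix)
      then show ?thesis by (simp only: B inner_minus_left)
    qed
    ultimately have qz: "qs \<bullet> z = \<alpha> - ps \<bullet> y + qs \<bullet> r" by (simp add: zr inner_add_right)
    have "- (qs \<bullet> r) \<le> s * (\<theta> * norm y)"
    proof -
      have "- (qs \<bullet> r) \<le> norm qs * norm r" using Cauchy_Schwarz_ineq2[of qs r] by linarith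
      also have "\<dots> \<le> s * (\<theta> * norm y)" unfolding s_def using r by (intro mult_left_mono) auto
      finally show ?thesis .
    qed
    then have "\<alpha> \<le> \<theta> * norm y + s * (\<theta> * norm y) + \<theta> * norm z" using qz K D by linarith
    also have "\<theta> * norm z \<le> \<theta> * (\<alpha> / s + C * norm y + \<theta> * norm y)"
      using z_le \<theta>(1) by (intro mult_left_mono) auto
    finally have "\<alpha> \<le> \<theta> * norm y + s * (\<theta> * norm y) + \<theta> * (\<alpha> / s + C * norm y + \<theta> * norm y)" by simp
    also have "\<dots> = (\<theta> * norm y) * (1 + s + C + \<theta>) + \<theta> * (\<alpha> / s)" by (simp add: algebra_simps)
    also have "\<dots> \<le> (\<theta> * norm y) * (2 + s + C) + (s / 2) * (\<alpha> / s)"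
    proof (rule add_mono)
      show "(\<theta> * norm y) * (1 + s + C + \<theta>) \<le> (\<theta> * norm y) * (2 + s + C)"
        by (rule mult_left_mono) (use \<theta> in auto)
      show "\<theta> * (\<alpha> / s) \<le> (s / 2) * (\<alpha> / s)"
        by (rule mult_right_mono) (use \<theta> s \<alpha>(1) in auto)
    qed
    finally have "\<alpha> / 2 \<le> (\<theta> * norm y) * (2 + s + C)" using s by (simp add: field_simps)
    also have "(\<theta> * norm y) * (2 + s + C) \<le> (1 / (2 * \<kappa> * (2 + s + C)) * norm y) * (2 + s + C)"
      using \<theta>(4) s C by (intro mult_right_mono) auto
    also have "\<dots> = norm y / (2 * \<kappa>)"
    proof -
      have gen: "(1 / (2 * \<kappa> * a) * norm y) * a = norm y / (2 * \<kappa>)" if "a \<noteq> 0" for a :: real using that by simp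
      show ?thesis by (rule gen) (use s C in linarith)
    qed
    finally have "\<kappa> * \<alpha> \<le> norm y" using \<kappa> by (simp add: field_simps)
    then show False using y by simp
  qed
  then show ?thesis using \<alpha>0(1) by blast
qed

text \<open>Both the position in the subsequence and the previous index may enter the choice of the next index.\<close>

lemma subsequence_with_gaps:
  assumes P: "\<And>k. \<forall>\<^sub>F n in sequentially. P k n" and Q: "\<And>m. \<forall>\<^sub>F n in sequentially. Q m n"
  obtains \<sigma> :: "nat \<Rightarrow> nat" where "strict_mono \<sigma>" "\<And>k. P k (\<sigma> k)" "\<And>k. Q (\<sigma> k) (\<sigma> (Suc k))"
proof -
  have "\<exists>\<sigma>. \<forall>k. P k (\<sigma> k) \<and> (\<sigma> k < \<sigma> (Suc k) \<and> Q (\<sigma> k) (\<sigma> (Suc k)))"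
  proof (rule dependent_nat_choice)
    show "\<exists>n. P 0 n" using P[of 0] by (auto simp: eventually_sequentially)
    fix m k
    have "\<forall>\<^sub>F n in sequentially. P (Suc k) n \<and> m < n \<and> Q m n"
      using P[of "Suc k"] eventually_gt_at_top[of m] Q[of m] by eventually_elim blast
    then show "\<exists>n. P (Suc k) n \<and> m < n \<and> Q m n" by (auto simp: eventually_sequentially)
  qed
  then show thesis using that by (auto simp: strict_mono_Suc_iff)
qed

lemma geometric_gaps:
  fixes t :: "nat \<Rightarrow> real"
  assumes "\<And>k. 0 < t k" "\<And>k. t (Suc k) \<le> t k / 3" "i < j"
  shows "t j \<le> t i / 3"
  using assms(3)
proof (induction j)
  case (Suc j)
  show ?case
  proof (cases "i = j")
    case True then show ?thesis using assms(2) by simp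
  next
    case False
    then have "t j \<le> t i / 3" using Suc by simp
    then show ?thesis using assms(1)[of j] assms(2)[of j] by linarith
  qed
qed simp

text \<open>The common part of both upper estimates. If \<open>f0\<close> takes points \<open>p i \<in> D\<close> to \<open>q i \<in> K\<close> up to \<open>o(t i)\<close>, and if its
  derivatives match the normals \<open>ps i\<close> and \<open>qs i\<close> up to \<open>o(1)\<close>, then a perturbation \<open>h\<close> that is flat at \<open>xb\<close>
  corrects both errors: it makes \<open>f0 - h\<close> hit \<open>q i\<close> up to a tiny shift along \<open>qs i\<close>, with a
  derivative that takes \<open>qs i\<close> exactly to \<open>- ps i\<close>. The correction of the derivative is the rank-one matrix \<open>E i\<close>.
  At such points the solutions are pushed away. Along a subsequence whose \<open>t i\<close> decrease
  fast enough, the balls in which the corrections act are disjoint and the corrections are summable.\<close>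

lemma C1_perturbation_destroys_subregularity:
  fixes f0 :: "real^'n \<Rightarrow> real^'m" and A :: "nat \<Rightarrow> real^'n^'m" and qst :: "real^'m"
  assumes t: "down0 t" and P: "P \<longlonglongrightarrow> u" and u: "u \<noteq> 0"
    and ps: "\<And>i. ps i \<in> normal_cone D (xb + t i *\<^sub>R P i)"
    and qs: "\<And>i. qs i \<in> normal_cone K (q i)" and qlim: "qs \<longlonglongrightarrow> qst" "qst \<noteq> 0"
    and der: "\<And>i. (f0 has_derivative (\<lambda>v. A i *v v)) (at (xb + t i *\<^sub>R P i))"
    and val: "(\<lambda>i. inverse (t i) *\<^sub>R (f0 (xb + t i *\<^sub>R P i) - q i)) \<longlonglongrightarrow> 0"
    and adj: "(\<lambda>i. transpose (A i) *v qs i + ps i) \<longlonglongrightarrow> 0"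
  obtains h where "C1_around h xb" "h xb = 0" "jacobian h (at xb) = 0"
    "nonsubregular D K (\<lambda>x. f0 x - h x) xb"
proof -
  define p where "p i = xb + t i *\<^sub>R P i" for i
  define nu where "nu = norm u"
  have nu: "nu > 0" using u by (simp add: nu_def)
  have t0: "0 < t i" "t \<longlonglongrightarrow> 0" for i using t by (auto simp: down0_def)
  \<comment> \<open>balls of radius \<open>R i\<close> around \<open>p i\<close> avoid \<open>xb\<close>, as \<open>|p i - xb|\<close> is close to \<open>nu t i\<close>\<close>
  define R where "R i = nu / 4 * t i" for i
  have R: "0 < R i" for i using nu t0 by (simp add: R_def)
  define d where "d i = transpose (A i) *v qs i + ps i" for i
  define E :: "nat \<Rightarrow> real^'n^'m" where "E i = (\<chi> a c. qs i $ a * d i $ c / (norm (qs i))\<^sup>2)" for i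
  have E_mul: "E i *v y = ((d i \<bullet> y) / (norm (qs i))\<^sup>2) *\<^sub>R qs i" for i y
  proof (rule vec_eq_iff[THEN iffD2, rule_format])
    fix a
    have "(E i *v y) $ a = (\<Sum>c\<in>UNIV. (qs i $ a / (norm (qs i))\<^sup>2) * (d i $ c * y $ c))"
      by (simp add: E_def matrix_vector_mult_def mult_ac)
    also have "\<dots> = (qs i $ a / (norm (qs i))\<^sup>2) * (d i \<bullet> y)"
      by (simp add: inner_vec_def sum_distrib_left)
    finally show "(E i *v y) $ a = (((d i \<bullet> y) / (norm (qs i))\<^sup>2) *\<^sub>R qs i) $ a"
      by (simp add: mult.commute)
  qed
  have E_tr: "transpose (E i) *v qs i = d i" if "qs i \<noteq> 0" for i
  proof (rule vector_eq_ldot[THEN iffD1, rule_format])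
    fix y
    have "y \<bullet> (transpose (E i) *v qs i) = qs i \<bullet> (E i *v y)"
      by (metis dot_lmul_matrix inner_commute transpose_matrix_vector)
    also have "\<dots> = y \<bullet> d i" using that by (simp add: E_mul power2_norm_eq_inner inner_commute)
    finally show "y \<bullet> (transpose (E i) *v qs i) = y \<bullet> d i" .
  qed
  have E0: "E \<longlonglongrightarrow> 0"
  proof -
    have "d \<longlonglongrightarrow> 0" unfolding d_def[abs_def] by (rule adj)
    then have "(\<lambda>i. \<chi> a c. qs i $ a * d i $ c / (norm (qs i))\<^sup>2) \<longlonglongrightarrow> (\<chi> a c. qst $ a * (0 :: real^'n) $ c / (norm qst)\<^sup>2)"
      using qlim by (intro tendsto_vec_lambda tendsto_intros) auto
    moreover have "(\<chi> a c. qst $ a * (0 :: real^'n) $ c / (norm qst)\<^sup>2) = (0 :: real^'n^'m)" by (simp add: vec_eq_iff)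
    ultimately show ?thesis by (simp add: E_def[abs_def])
  qed
  \<comment> \<open>the modulus of \<open>f0 - h\<close> at \<open>p i\<close>, whatever the shift will be: the remainder of \<open>f0\<close> plus that of a cut-off affine map\<close>
  define \<omega> where "\<omega> i y = norm (f0 (p i + y) - f0 (p i) - A i *v y) + 2 / R i * (norm y)\<^sup>2" for i y
  have \<omega>: "\<exists>\<rho>>0. \<forall>y. norm y < \<rho> \<longrightarrow> \<omega> i y \<le> e * norm y" if e: "0 < e" for e i
  proof -
    obtain \<rho> where \<rho>: "\<rho> > 0" "\<And>x. norm (x - p i) < \<rho> \<Longrightarrow> norm (f0 x - f0 (p i) - A i *v (x - p i)) \<le> e / 2 * norm (x - p i)"
      using der[of i] half_gt_zero[OF e] unfolding has_derivative_at_alt p_def by blast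
    define \<rho>' where "\<rho>' = min \<rho> (e * R i / 4)"
    have "\<omega> i y \<le> e * norm y" if "norm y < \<rho>'" for y
    proof -
      have y: "norm y < \<rho>" "norm y < e * R i / 4" using that by (auto simp: \<rho>'_def)
      have "norm (f0 (p i + y) - f0 (p i) - A i *v y) \<le> e / 2 * norm y"
        using \<rho>(2)[of "p i + y"] y(1) by (simp only: add_diff_cancel_left')
      moreover have "2 / R i * norm y \<le> e / 2" using y(2) R[of i] by (simp add: field_simps)
      then have "2 / R i * norm y * norm y \<le> e / 2 * norm y" by (rule mult_right_mono) simp
      then have "2 / R i * (norm y)\<^sup>2 \<le> e / 2 * norm y" by (simp add: power2_eq_square mult.assoc)
      ultimately show ?thesis unfolding \<omega>_def by linarith
    qed
    moreover have "\<rho>' > 0" using \<rho>(1) e R[of i] by (simp add: \<rho>'_def)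
    ultimately show ?thesis by blast
  qed
  \<comment> \<open>shifts of size at most \<open>(t i)\<^sup>2\<close> do not spoil \<open>b i = o(t i)\<close>\<close>
  have "\<exists>\<alpha>>0. \<alpha> \<le> (t i)\<^sup>2 \<and> (qs i \<noteq> 0 \<longrightarrow> (\<forall>f.
     (\<forall>y. norm y < R i \<longrightarrow> norm (f (p i + y) - q i - (\<alpha> / (norm (qs i))\<^sup>2) *\<^sub>R qs i - (A i - E i) *v y) \<le> \<omega> i y) \<longrightarrow>
     (\<forall>x\<in>D. f x \<in> K \<longrightarrow> real (Suc i) * \<alpha> \<le> norm (x - p i))))" for i
  proof (cases "qs i = 0")
    case True
    then show ?thesis using t0(1)[of i] by (intro exI[of _ "(t i)\<^sup>2"]) auto
  next
    case False
    have "transpose (A i - E i) = transpose (A i) - transpose (E i)" by (simp add: transpose_def vec_eq_iff)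
    then have "transpose (A i - E i) *v qs i = transpose (A i) *v qs i - transpose (E i) *v qs i"
      by (simp only: matrix_vector_mult_diff_rdistrib)
    then have tr: "transpose (A i - E i) *v qs i = - ps i"
      unfolding E_tr[OF False] by (simp add: d_def)
    have "\<exists>\<alpha>0>0. \<forall>\<alpha> f. 0 < \<alpha> \<longrightarrow> \<alpha> \<le> \<alpha>0 \<longrightarrow>
     (\<forall>y. norm y < R i \<longrightarrow> norm (f (p i + y) - q i - (\<alpha> / (norm (qs i))\<^sup>2) *\<^sub>R qs i - (A i - E i) *v y) \<le> \<omega> i y) \<longrightarrow>
     (\<forall>x\<in>D. f x \<in> K \<longrightarrow> real (Suc i) * \<alpha> \<le> norm (x - p i))"
    proof (rule solutions_pushed_away[OF ps[of i, folded p_def] qs False tr _ R[of i]])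
      show "\<exists>d>0. \<forall>y. norm y < d \<longrightarrow> \<omega> i y \<le> e * norm y" if "0 < e" for e by (rule \<omega>[OF that])
    qed simp
    then obtain \<alpha>0 where \<alpha>0: "\<alpha>0 > 0" "\<forall>\<alpha> f. 0 < \<alpha> \<longrightarrow> \<alpha> \<le> \<alpha>0 \<longrightarrow>
     (\<forall>y. norm y < R i \<longrightarrow> norm (f (p i + y) - q i - (\<alpha> / (norm (qs i))\<^sup>2) *\<^sub>R qs i - (A i - E i) *v y) \<le> \<omega> i y) \<longrightarrow>
     (\<forall>x\<in>D. f x \<in> K \<longrightarrow> real (Suc i) * \<alpha> \<le> norm (x - p i))" by blast
    define \<alpha> where "\<alpha> = min \<alpha>0 ((t i)\<^sup>2)"
    have "0 < \<alpha>" "\<alpha> \<le> \<alpha>0" "\<alpha> \<le> (t i)\<^sup>2" using \<alpha>0(1) t0(1)[of i] by (auto simp: \<alpha>_def)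
    then show ?thesis using \<alpha>0(2) by blast
  qed
  then obtain \<alpha> where \<alpha>: "\<And>i. 0 < \<alpha> i" "\<And>i. \<alpha> i \<le> (t i)\<^sup>2"
    and away: "\<And>i f. qs i \<noteq> 0 \<Longrightarrow>
     (\<forall>y. norm y < R i \<longrightarrow> norm (f (p i + y) - q i - (\<alpha> i / (norm (qs i))\<^sup>2) *\<^sub>R qs i - (A i - E i) *v y) \<le> \<omega> i y) \<Longrightarrow>
     (\<forall>x\<in>D. f x \<in> K \<longrightarrow> real (Suc i) * \<alpha> i \<le> norm (x - p i))" by metis
  define b where "b i = f0 (p i) - q i - (\<alpha> i / (norm (qs i))\<^sup>2) *\<^sub>R qs i" for i
  have bR0: "(\<lambda>i. norm (b i) / R i + norm (E i)) \<longlonglongrightarrow> 0"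
  proof -
    have "(\<lambda>i. 4 / nu * (norm (inverse (t i) *\<^sub>R (f0 (p i) - q i)) + t i / norm (qs i)) + norm (E i))
       \<longlonglongrightarrow> 4 / nu * (norm (0 :: real^'m) + 0 / norm qst) + norm (0 :: real^'n^'m)"
      using qlim val nu unfolding p_def by (intro tendsto_intros t0 E0) auto
    then have lim: "(\<lambda>i. 4 / nu * (norm (inverse (t i) *\<^sub>R (f0 (p i) - q i)) + t i / norm (qs i)) + norm (E i)) \<longlonglongrightarrow> 0" by simp
    have le: "norm (norm (b i) / R i + norm (E i)) \<le> 4 / nu * (norm (inverse (t i) *\<^sub>R (f0 (p i) - q i)) + t i / norm (qs i)) + norm (E i)" for i
    proof -
      have "norm ((\<alpha> i / (norm (qs i))\<^sup>2) *\<^sub>R qs i) = \<alpha> i / norm (qs i)"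
        using \<alpha>(1)[of i] by (cases "qs i = 0") (auto simp: power2_eq_square)
      also have "\<dots> \<le> (t i)\<^sup>2 / norm (qs i)" using \<alpha>(2)[of i] by (intro divide_right_mono) auto
      finally have "norm (b i) \<le> norm (f0 (p i) - q i) + (t i)\<^sup>2 / norm (qs i)"
        unfolding b_def using norm_triangle_ineq4[of "f0 (p i) - q i" "(\<alpha> i / (norm (qs i))\<^sup>2) *\<^sub>R qs i"] by linarith
      then have "norm (b i) / R i \<le> (norm (f0 (p i) - q i) + (t i)\<^sup>2 / norm (qs i)) / R i"
        using R[of i] by (intro divide_right_mono) auto
      also have "\<dots> = 4 / nu * (inverse (t i) * (norm (f0 (p i) - q i) + (t i)\<^sup>2 / norm (qs i)))"
        using nu t0(1)[of i] by (simp add: R_def field_simps)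
      also have "inverse (t i) * (norm (f0 (p i) - q i) + (t i)\<^sup>2 / norm (qs i)) = norm (inverse (t i) *\<^sub>R (f0 (p i) - q i)) + t i / norm (qs i)"
        using t0(1)[of i] unfolding norm_scaleR by (simp add: distrib_left power2_eq_square)
      finally show ?thesis using R[of i] by simp
    qed
    show ?thesis by (rule Lim_null_comparison[OF always_eventually[OF allI[OF le]] lim])
  qed
  obtain \<sigma> where \<sigma>: "strict_mono \<sigma>"
    and sP: "\<And>k. norm (b (\<sigma> k)) / R (\<sigma> k) + norm (E (\<sigma> k)) < (1/2) ^ k \<and> norm (P (\<sigma> k) - u) < nu / 4 \<and> norm (qst) / 2 < norm (qs (\<sigma> k))"
    and sQ: "\<And>k. t (\<sigma> (Suc k)) < t (\<sigma> k) / 3"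
  proof (rule subsequence_with_gaps[where P = "\<lambda>k i. norm (b i) / R i + norm (E i) < (1/2) ^ k \<and> norm (P i - u) < nu / 4 \<and> norm (qst) / 2 < norm (qs i)"
        and Q = "\<lambda>m n. t n < t m / 3"])
    show "\<forall>\<^sub>F i in sequentially. norm (b i) / R i + norm (E i) < (1/2) ^ k \<and> norm (P i - u) < nu / 4 \<and> norm (qst) / 2 < norm (qs i)" for k
    proof (intro eventually_conj)
      show "\<forall>\<^sub>F i in sequentially. norm (b i) / R i + norm (E i) < (1/2) ^ k"
        by (rule order_tendstoD(2)[OF bR0]) simp
      have "(\<lambda>i. norm (P i - u)) \<longlonglongrightarrow> norm (u - u)" by (intro tendsto_intros P)
      then show "\<forall>\<^sub>F i in sequentially. norm (P i - u) < nu / 4"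
        by (rule order_tendstoD(2)) (use nu in simp)
      show "\<forall>\<^sub>F i in sequentially. norm qst / 2 < norm (qs i)"
        by (rule order_tendstoD(1)[OF tendsto_norm[OF qlim(1)]]) (use qlim(2) in simp)
    qed
    show "\<forall>\<^sub>F n in sequentially. t n < t m / 3" for m
      by (rule order_tendstoD(2)[OF t0(2)]) (use t0(1) in simp)
  qed blast
  have qs0: "qs (\<sigma> k) \<noteq> 0" for k
  proof
    assume "qs (\<sigma> k) = 0"
    then have "norm qst < 0" using sP[of k] by simp
    then show False by simp
  qed
  have gaps: "t (\<sigma> j) \<le> t (\<sigma> i) / 3" if "i < j" for i j
    by (rule geometric_gaps[of "\<lambda>k. t (\<sigma> k)", OF _ _ that]) (use t0(1) sQ in \<open>auto intro: less_imp_le\<close>)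
  have Pn: "3 / 4 * nu \<le> norm (P (\<sigma> k))" "norm (P (\<sigma> k)) \<le> 5 / 4 * nu" for k
    using sP[of k] norm_triangle_ineq3[of "P (\<sigma> k)" u] by (auto simp: nu_def abs_le_iff)
  have pn: "3 / 4 * nu * t (\<sigma> k) \<le> norm (p (\<sigma> k) - xb)" "norm (p (\<sigma> k) - xb) \<le> 5 / 4 * nu * t (\<sigma> k)" for k
    using mult_right_mono[OF Pn(1)[of k], of "t (\<sigma> k)"] mult_right_mono[OF Pn(2)[of k], of "t (\<sigma> k)"] t0(1)[of "\<sigma> k"]
    by (simp_all add: p_def mult_ac)
  obtain h where h: "C1_around h xb" "h xb = 0" "jacobian h (at xb) = 0"
    "\<And>k x. norm (x - p (\<sigma> k)) < R (\<sigma> k) \<Longrightarrow>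
       norm (h x - b (\<sigma> k) - E (\<sigma> k) *v (x - p (\<sigma> k))) \<le> 2 / R (\<sigma> k) * (norm (x - p (\<sigma> k)))\<^sup>2"
  proof (rule C1_interpolation[of "\<lambda>k. R (\<sigma> k)" "\<lambda>k. b (\<sigma> k)" "\<lambda>k. E (\<sigma> k)" xb "\<lambda>k. p (\<sigma> k)"])
    show "0 < R (\<sigma> k)" for k by (rule R)
    show "norm (b (\<sigma> k)) / R (\<sigma> k) + norm (E (\<sigma> k)) \<le> (1/2) ^ k" for k using sP[of k] by simp
    show "R (\<sigma> k) \<le> norm (xb - p (\<sigma> k))" for k
    proof -
      have "0 \<le> nu * t (\<sigma> k)" using nu t0(1)[of "\<sigma> k"] by simp
      then show ?thesis using pn(1)[of k] by (simp add: R_def norm_minus_commute)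
    qed
    show "R (\<sigma> j) \<le> norm (x - p (\<sigma> j))" if jk: "j \<noteq> k" and x: "norm (x - p (\<sigma> k)) < R (\<sigma> k)" for j k x
    proof -
      have tri: "norm (p (\<sigma> k) - xb) - norm (p (\<sigma> j) - xb) \<le> norm (x - p (\<sigma> k)) + norm (x - p (\<sigma> j))"
        "norm (p (\<sigma> j) - xb) - norm (p (\<sigma> k) - xb) \<le> norm (x - p (\<sigma> k)) + norm (x - p (\<sigma> j))"
        using norm_triangle_ineq2[of "p (\<sigma> k) - xb" "p (\<sigma> j) - xb"] norm_triangle_ineq2[of "p (\<sigma> j) - xb" "p (\<sigma> k) - xb"]
          norm_triangle_ineq4[of "x - p (\<sigma> j)" "x - p (\<sigma> k)"] norm_triangle_ineq4[of "x - p (\<sigma> k)" "x - p (\<sigma> j)"]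
        by (auto simp: algebra_simps)
      define T where "T i = nu * t (\<sigma> i)" for i
      have T0: "0 < T i" for i using nu t0(1) by (simp add: T_def)
      have Tp: "3 / 4 * T i \<le> norm (p (\<sigma> i) - xb)" "norm (p (\<sigma> i) - xb) \<le> 5 / 4 * T i" "R (\<sigma> i) = T i / 4" for i
        using pn[of i] by (auto simp: T_def R_def)
      show ?thesis
      proof (cases "j < k")
        case True
        then have "T k \<le> T j / 3" using gaps[OF True] nu by (simp add: T_def field_simps)
        then show ?thesis using tri(2) Tp[of j] Tp[of k] x T0[of k] by linarith
      next
        case False
        then have "k < j" using jk by simp
        then have "T j \<le> T k / 3" using gaps nu by (simp add: T_def field_simps)
        then show ?thesis using tri(1) Tp[of j] Tp[of k] x T0[of j] by linarith
      qed
    qed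
  qed blast
  have pD: "p i \<in> D" for i using normal_cone_mem[OF ps] by (simp add: p_def)
  have qK: "q i \<in> K" for i using normal_cone_mem[OF qs] .
  define f where "f x = f0 x - h x" for x
  have fp: "f (p (\<sigma> k)) = q (\<sigma> k) + (\<alpha> (\<sigma> k) / (norm (qs (\<sigma> k)))\<^sup>2) *\<^sub>R qs (\<sigma> k)" for k
    using h(4)[of "p (\<sigma> k)" k] R by (simp add: f_def b_def algebra_simps)
  have far: "real (Suc (\<sigma> k)) * \<alpha> (\<sigma> k) \<le> norm (x - p (\<sigma> k))" if "x \<in> D" "f x \<in> K" for x k
  proof -
    have "\<forall>x\<in>D. f x \<in> K \<longrightarrow> real (Suc (\<sigma> k)) * \<alpha> (\<sigma> k) \<le> norm (x - p (\<sigma> k))"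
    proof (rule away[OF qs0], intro allI impI)
      fix y :: "real^'n" assume y: "norm y < R (\<sigma> k)"
      have "f (p (\<sigma> k) + y) - q (\<sigma> k) - (\<alpha> (\<sigma> k) / (norm (qs (\<sigma> k)))\<^sup>2) *\<^sub>R qs (\<sigma> k) - (A (\<sigma> k) - E (\<sigma> k)) *v y
          = (f0 (p (\<sigma> k) + y) - f0 (p (\<sigma> k)) - A (\<sigma> k) *v y) - (h (p (\<sigma> k) + y) - b (\<sigma> k) - E (\<sigma> k) *v y)"
        by (simp add: f_def b_def matrix_vector_mult_diff_rdistrib)
      then show "norm (f (p (\<sigma> k) + y) - q (\<sigma> k) - (\<alpha> (\<sigma> k) / (norm (qs (\<sigma> k)))\<^sup>2) *\<^sub>R qs (\<sigma> k) - (A (\<sigma> k) - E (\<sigma> k)) *v y) \<le> \<omega> (\<sigma> k) y"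
        using norm_triangle_ineq4[of "f0 (p (\<sigma> k) + y) - f0 (p (\<sigma> k)) - A (\<sigma> k) *v y" "h (p (\<sigma> k) + y) - b (\<sigma> k) - E (\<sigma> k) *v y"]
          h(4)[of "p (\<sigma> k) + y" k] y by (simp add: \<omega>_def)
    qed
    then show ?thesis using that by blast
  qed
  have "p \<longlonglongrightarrow> xb + 0 *\<^sub>R u" unfolding p_def by (intro tendsto_intros t0 P)
  then have plim: "(\<lambda>k. p (\<sigma> k)) \<longlonglongrightarrow> xb" using LIMSEQ_subseq_LIMSEQ[OF _ \<sigma>, of p xb] by (simp add: o_def)
  have nonsub: "\<exists>x\<in>D. \<exists>k\<in>K. norm (x - xb) < \<delta> \<and> (\<forall>x'\<in>D. f x' \<in> K \<longrightarrow> \<kappa> * norm (k - f x) < norm (x - x'))"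
    if \<kappa>: "0 < \<kappa>" and \<delta>: "0 < \<delta>" for \<kappa> \<delta>
  proof -
    have "\<forall>\<^sub>F k in sequentially. dist (p (\<sigma> k)) xb < \<delta>" using plim \<delta> by (rule tendstoD)
    moreover have "\<forall>\<^sub>F k in sequentially. 2 * \<kappa> / norm qst < real k"
      using filterlim_real_sequentially by (simp add: filterlim_at_top_dense)
    ultimately have "\<forall>\<^sub>F k in sequentially. dist (p (\<sigma> k)) xb < \<delta> \<and> 2 * \<kappa> / norm qst < real k"
      by (rule eventually_conj)
    then obtain k where k: "dist (p (\<sigma> k)) xb < \<delta>" "2 * \<kappa> / norm qst < real k"
      by (auto simp: eventually_sequentially)
    have s: "0 < norm qst" using qlim(2) by simp
    have "norm (q (\<sigma> k) - f (p (\<sigma> k))) = \<alpha> (\<sigma> k) / norm (qs (\<sigma> k))"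
      using \<alpha>(1)[of "\<sigma> k"] qs0[of k] by (simp add: fp power2_eq_square)
    also have "\<dots> \<le> \<alpha> (\<sigma> k) / (norm qst / 2)"
      using sP[of k] \<alpha>(1)[of "\<sigma> k"] s qs0[of k] by (intro divide_left_mono mult_pos_pos) auto
    finally have "\<kappa> * norm (q (\<sigma> k) - f (p (\<sigma> k))) \<le> \<kappa> * (\<alpha> (\<sigma> k) / (norm qst / 2))"
      using \<kappa> by (intro mult_left_mono) auto
    also have "\<dots> = 2 * \<kappa> / norm qst * \<alpha> (\<sigma> k)" using s by simp
    also have "\<dots> < real (Suc (\<sigma> k)) * \<alpha> (\<sigma> k)"
      using k(2) seq_suble[OF \<sigma>, of k] \<alpha>(1)[of "\<sigma> k"] by (intro mult_strict_right_mono) auto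
    finally have lt: "\<kappa> * norm (q (\<sigma> k) - f (p (\<sigma> k))) < real (Suc (\<sigma> k)) * \<alpha> (\<sigma> k)" .
    show ?thesis
    proof (intro bexI conjI ballI impI)
      show "norm (p (\<sigma> k) - xb) < \<delta>" using k(1) by (simp add: dist_norm)
      fix x' assume "x' \<in> D" "f x' \<in> K"
      then show "\<kappa> * norm (q (\<sigma> k) - f (p (\<sigma> k))) < norm (p (\<sigma> k) - x')"
        using far[of x' k] lt by (simp add: norm_minus_commute)
    qed (use pD qK in auto)
  qed
  show thesis
    by (rule that[OF h(1-3)]) (use nonsub in \<open>simp add: nonsubregular_def f_def\<close>)
qed

section \<open>Lipschitz functions with prescribed affine germs\<close>

text \<open>The McShane extension of a function given by its graph \<open>G\<close>. For data given by a
  relation, consistency at overlapping points is the case of distance 0 in the Lipschitz condition.\<close>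

lemma mcshane_extension:
  fixes N :: "'a::euclidean_space \<Rightarrow> real" and G :: "('a \<times> real) set"
  assumes N: "is_norm N" and c: "0 \<le> c" and ne: "G \<noteq> {}"
    and G: "\<And>x v y w. (x, v) \<in> G \<Longrightarrow> (y, w) \<in> G \<Longrightarrow> v - w \<le> c * N (x - y)"
  obtains \<xi> where "\<And>x v. (x, v) \<in> G \<Longrightarrow> \<xi> x = v" "\<And>x y. \<bar>\<xi> x - \<xi> y\<bar> \<le> c * N (x - y)"
proof -
  define \<xi> where "\<xi> x = (INF z\<in>G. snd z + c * N (x - fst z))" for x
  have tri: "c * N (x - z) \<le> c * N (x - y) + c * N (y - z)" for x y z
    using mult_left_mono[OF is_norm_triangle[OF N, of "x - y" "y - z"] c] by (simp add: distrib_left)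
  have bdd: "bdd_below ((\<lambda>z. snd z + c * N (x - fst z)) ` G)" for x
  proof -
    obtain x0 v0 where z0: "(x0, v0) \<in> G" using ne by auto
    have "v0 - c * N (x0 - x) \<le> snd z + c * N (x - fst z)" if "z \<in> G" for z
      using G[OF z0, of "fst z" "snd z"] that tri[of x0 "fst z" x] by simp
    then show ?thesis by (rule bdd_belowI2)
  qed
  have le: "\<xi> x \<le> \<xi> y + c * N (x - y)" for x y
  proof -
    have "\<xi> x - c * N (x - y) \<le> \<xi> y"
      unfolding \<xi>_def[of y]
    proof (rule cINF_greatest[OF ne])
      fix z assume "z \<in> G"
      then have "\<xi> x \<le> snd z + c * N (x - fst z)" unfolding \<xi>_def by (intro cINF_lower bdd)
      then show "\<xi> x - c * N (x - y) \<le> snd z + c * N (y - fst z)" using tri[of x "fst z" y] by linarith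
    qed
    then show ?thesis by linarith
  qed
  show thesis
  proof
    show "\<bar>\<xi> x - \<xi> y\<bar> \<le> c * N (x - y)" for x y
      using le[of x y] le[of y x] is_norm_commute[OF N, of x y] by simp
    fix x v assume xv: "(x, v) \<in> G"
    have "\<xi> x \<le> snd (x, v) + c * N (x - fst (x, v))" unfolding \<xi>_def by (intro cINF_lower bdd xv)
    then have "\<xi> x \<le> v" by (simp add: is_norm_zero[OF N])
    moreover have "v \<le> \<xi> x"
      unfolding \<xi>_def
    proof (rule cINF_greatest[OF ne])
      fix z assume "z \<in> G"
      then show "v \<le> snd z + c * N (x - fst z)" using G[OF xv, of "fst z" "snd z"] by simp
    qed
    ultimately show "\<xi> x = v" by simp
  qed
qed

text \<open>A real function with nearly optimal Lipschitz constant that is affine with slope \<open>a\<close> near each \<open>p i\<close>. On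
  balls of radius \<open>\<theta> t i\<close> around \<open>p i\<close> the prescribed values differ from those at the centres by at most
  \<open>L \<theta> t i\<close>, which is small compared to the distance of different balls if \<open>\<theta>\<close> is small; so the data are
  \<open>(L + e)\<close>-Lipschitz and can be extended.\<close>

lemma lipschitz_with_affine_germs:
  fixes N :: "'a::euclidean_space \<Rightarrow> real" and p :: "nat \<Rightarrow> 'a"
  assumes N: "is_norm N" and t: "\<And>i. 0 < t i" and c: "0 < c" and e: "0 < e" and L: "0 \<le> L"
    and sep: "\<And>i j. i \<noteq> j \<Longrightarrow> c * (t i + t j) \<le> N (p i - p j)" and sepb: "\<And>i. c * t i \<le> N (p i - xb)"
    and s: "\<And>i j. s i - s j \<le> L * N (p i - p j)" and sb: "\<And>i. \<bar>s i\<bar> \<le> L * N (p i - xb)"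
    and a: "\<And>y. a \<bullet> y \<le> L * N y"
  obtains \<zeta> where "\<zeta> xb = 0" "\<And>x y. \<bar>\<zeta> x - \<zeta> y\<bar> \<le> (L + e) * N (x - y)"
    "\<And>i. \<forall>\<^sub>F x in nhds (p i). \<zeta> x = s i + a \<bullet> (x - p i)"
proof -
  \<comment> \<open>the solution of \<open>2 L \<theta> = e (c - \<theta>)\<close>\<close>
  define \<theta> where "\<theta> = e * c / (2 * L + e)"
  have \<theta>: "0 < \<theta>" "2 * L * \<theta> = e * (c - \<theta>)"
    using c e L by (auto simp: \<theta>_def field_simps add_nonneg_pos)
  define G where "G = insert (xb, 0) {(x, s i + a \<bullet> (x - p i)) | x i. N (x - p i) \<le> \<theta> * t i}"
  have am: "- (a \<bullet> y) \<le> L * N y" for y using a[of "- y"] by (simp add: is_norm_uminus[OF N])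
  have near: "\<bar>a \<bullet> (x - p i)\<bar> \<le> L * (\<theta> * t i)" if "N (x - p i) \<le> \<theta> * t i" for x i
    using a[of "x - p i"] am[of "x - p i"] mult_left_mono[OF that L] by linarith
  have G_xb: "\<bar>v\<bar> \<le> (L + e) * N (x - xb)" if xv: "v = s i + a \<bullet> (x - p i)" "N (x - p i) \<le> \<theta> * t i" for x v i
  proof -
    have tri: "N (p i - xb) \<le> N (x - xb) + \<theta> * t i"
      using is_norm_triangle[OF N, of "p i - x" "x - xb"] xv(2) is_norm_commute[OF N, of x "p i"] by simp
    have "\<bar>v\<bar> \<le> L * N (p i - xb) + L * (\<theta> * t i)" using sb[of i] near[OF xv(2)] xv(1) by linarith
    also have "\<dots> \<le> L * (N (x - xb) + \<theta> * t i) + L * (\<theta> * t i)" using tri L by (intro add_right_mono mult_left_mono)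
    also have "\<dots> = L * N (x - xb) + (2 * L * \<theta>) * t i" by (simp add: algebra_simps)
    also have "\<dots> = L * N (x - xb) + e * ((c - \<theta>) * t i)" unfolding \<theta>(2) by simp
    also have "\<dots> \<le> L * N (x - xb) + e * N (x - xb)"
      using tri sepb[of i] e by (intro add_left_mono mult_left_mono) (auto simp: left_diff_distrib)
    finally show ?thesis by (simp add: distrib_right)
  qed
  have G_ij: "(s i + a \<bullet> (x - p i)) - (s j + a \<bullet> (y - p j)) \<le> (L + e) * N (x - y)"
    if x: "N (x - p i) \<le> \<theta> * t i" and y: "N (y - p j) \<le> \<theta> * t j" for x y i j
  proof (cases "i = j")
    case True
    have "a \<bullet> (x - p i) - a \<bullet> (y - p i) = a \<bullet> (x - y)" by (simp add: inner_diff_right)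
    also have "\<dots> \<le> L * N (x - y)" by (rule a)
    also have "\<dots> \<le> (L + e) * N (x - y)" using e is_norm_nonneg[OF N] by (intro mult_right_mono) auto
    finally show ?thesis using True by simp
  next
    case False
    have tri: "N (p i - p j) \<le> N (x - y) + \<theta> * t i + \<theta> * t j"
      using is_norm_triangle[OF N, of "p i - x" "x - p j"] is_norm_triangle[OF N, of "x - y" "y - p j"]
        x y is_norm_commute[OF N, of x "p i"] by simp
    have "(s i + a \<bullet> (x - p i)) - (s j + a \<bullet> (y - p j)) \<le> L * N (p i - p j) + L * (\<theta> * t i) + L * (\<theta> * t j)"
      using s[of i j] near[OF x] near[OF y] by linarith
    also have "\<dots> \<le> L * (N (x - y) + \<theta> * t i + \<theta> * t j) + L * (\<theta> * t i) + L * (\<theta> * t j)"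
      using tri L by (intro add_right_mono mult_left_mono)
    also have "\<dots> = L * N (x - y) + (2 * L * \<theta>) * (t i + t j)" by (simp add: algebra_simps)
    also have "\<dots> = L * N (x - y) + e * ((c - \<theta>) * (t i + t j))" unfolding \<theta>(2) by simp
    also have "\<dots> \<le> L * N (x - y) + e * N (x - y)"
    proof -
      have "(c - \<theta>) * (t i + t j) \<le> N (x - y)" using tri sep[OF False] by (simp add: algebra_simps)
      then show ?thesis using e by (intro add_left_mono mult_left_mono) auto
    qed
    finally show ?thesis by (simp add: distrib_right)
  qed
  have G: "v - w \<le> (L + e) * N (x - y)" if xv: "(x, v) \<in> G" and yw: "(y, w) \<in> G" for x v y w
    using xv[unfolded G_def] yw[unfolded G_def]
  proof (elim insertE CollectE exE conjE)
    assume "(x, v) = (xb, 0)" "(y, w) = (xb, 0)"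
    then show ?thesis by (simp add: is_norm_zero[OF N])
  next
    fix x' i assume *: "(x, v) = (x', s i + a \<bullet> (x' - p i))" "N (x' - p i) \<le> \<theta> * t i" and y: "(y, w) = (xb, 0)"
    then have "\<bar>v\<bar> \<le> (L + e) * N (x - xb)" by (intro G_xb[of v i x]) auto
    then show ?thesis using y by simp
  next
    fix y' j assume *: "(y, w) = (y', s j + a \<bullet> (y' - p j))" "N (y' - p j) \<le> \<theta> * t j" and x: "(x, v) = (xb, 0)"
    then have "\<bar>w\<bar> \<le> (L + e) * N (y - xb)" by (intro G_xb[of w j y]) auto
    then show ?thesis using x is_norm_commute[OF N, of y xb] by simp
  next
    fix x' i y' j assume "(x, v) = (x', s i + a \<bullet> (x' - p i))" "N (x' - p i) \<le> \<theta> * t i"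
      "(y, w) = (y', s j + a \<bullet> (y' - p j))" "N (y' - p j) \<le> \<theta> * t j"
    then show ?thesis using G_ij[of x i y j] by simp
  qed
  have Le: "0 \<le> L + e" and Gne: "G \<noteq> {}" using L e by (auto simp: G_def)
  obtain \<zeta> where \<zeta>: "\<And>x v. (x, v) \<in> G \<Longrightarrow> \<zeta> x = v" "\<And>x y. \<bar>\<zeta> x - \<zeta> y\<bar> \<le> (L + e) * N (x - y)"
    by (rule mcshane_extension[OF N Le Gne G]) auto
  show thesis
  proof (rule that[OF _ \<zeta>(2)])
    show "\<zeta> xb = 0" by (rule \<zeta>(1)) (simp add: G_def)
    fix i
    have "((\<lambda>x. N (x - p i)) \<longlongrightarrow> N (p i - p i)) (nhds (p i))"
      by (intro is_norm_tendsto[OF N] tendsto_diff tendsto_ident_at[of _ UNIV, unfolded at_within_def] tendsto_const filterlim_ident)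
    then have "\<forall>\<^sub>F x in nhds (p i). N (x - p i) < \<theta> * t i"
      by (rule order_tendstoD(2)) (use \<theta>(1) t in \<open>simp add: is_norm_zero[OF N]\<close>)
    then show "\<forall>\<^sub>F x in nhds (p i). \<zeta> x = s i + a \<bullet> (x - p i)"
    proof eventually_elim
      case (elim x)
      show ?case by (rule \<zeta>(1)) (use elim in \<open>auto simp: G_def\<close>)
    qed
  qed
qed

section \<open>Upper estimates of the radii\<close>

text \<open>The use of directional regularity: the sequence of step sizes that comes with the directional normal to
  one set can also be used for the other set.\<close>

lemma synchronized_normals:
  assumes reg: "dir_regular D xb \<or> dir_regular K yb"
    and ps: "ps \<in> dir_normal_cone D xb u" and qs: "qs \<in> dir_normal_cone K yb w" and r: "0 < r"
  obtains t P Q PS QS where "down0 t" "P \<longlonglongrightarrow> u" "Q \<longlonglongrightarrow> w" "PS \<longlonglongrightarrow> ps" "QS \<longlonglongrightarrow> qs"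
    "\<And>i. PS i \<in> normal_cone D (xb + t i *\<^sub>R P i)" "\<And>i. QS i \<in> normal_cone K (yb + t i *\<^sub>R Q i)"
    "\<And>i. xb + t i *\<^sub>R P i \<in> ball xb r"
proof -
  have "\<exists>t P Q PS QS. down0 t \<and> P \<longlonglongrightarrow> u \<and> Q \<longlonglongrightarrow> w \<and> PS \<longlonglongrightarrow> ps \<and> QS \<longlonglongrightarrow> qs \<and>
    (\<forall>i. PS i \<in> normal_cone D (xb + t i *\<^sub>R P i)) \<and> (\<forall>i. QS i \<in> normal_cone K (yb + t i *\<^sub>R Q i))"
    using reg
  proof
    assume "dir_regular D xb"
    then have D: "\<forall>t. down0 t \<longrightarrow> (\<exists>P PS. P \<longlonglongrightarrow> u \<and> PS \<longlonglongrightarrow> ps \<and> (\<forall>i. PS i \<in> normal_cone D (xb + t i *\<^sub>R P i)))"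
      using ps unfolding dir_regular_def dir_regular_in_def by blast
    obtain t Q QS where "down0 t" "Q \<longlonglongrightarrow> w" "QS \<longlonglongrightarrow> qs" "\<forall>i. QS i \<in> normal_cone K (yb + t i *\<^sub>R Q i)"
      using qs unfolding dir_normal_cone_def by blast
    then show ?thesis using D by blast
  next
    assume "dir_regular K yb"
    then have K: "\<forall>t. down0 t \<longrightarrow> (\<exists>Q QS. Q \<longlonglongrightarrow> w \<and> QS \<longlonglongrightarrow> qs \<and> (\<forall>i. QS i \<in> normal_cone K (yb + t i *\<^sub>R Q i)))"
      using qs unfolding dir_regular_def dir_regular_in_def by blast
    obtain t P PS where "down0 t" "P \<longlonglongrightarrow> u" "PS \<longlonglongrightarrow> ps" "\<forall>i. PS i \<in> normal_cone D (xb + t i *\<^sub>R P i)"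
      using ps unfolding dir_normal_cone_def by blast
    then show ?thesis using K by blast
  qed
  then obtain t P Q PS QS where *: "down0 t" "P \<longlonglongrightarrow> u" "Q \<longlonglongrightarrow> w" "PS \<longlonglongrightarrow> ps" "QS \<longlonglongrightarrow> qs"
    "\<And>i. PS i \<in> normal_cone D (xb + t i *\<^sub>R P i)" "\<And>i. QS i \<in> normal_cone K (yb + t i *\<^sub>R Q i)" by blast
  have t: "\<And>i. 0 < t i" "t \<longlonglongrightarrow> 0" using *(1) by (auto simp: down0_def)
  have "(\<lambda>i. xb + t i *\<^sub>R P i) \<longlonglongrightarrow> xb + 0 *\<^sub>R u" by (intro tendsto_intros t *)
  then have "(\<lambda>i. xb + t i *\<^sub>R P i) \<longlonglongrightarrow> xb" by simp
  then have "\<forall>\<^sub>F i in sequentially. xb + t i *\<^sub>R P i \<in> ball xb r"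
    by (rule topological_tendstoD) (use r in auto)
  then obtain n where n: "\<And>i. i \<ge> n \<Longrightarrow> xb + t i *\<^sub>R P i \<in> ball xb r" by (auto simp: eventually_sequentially)
  show thesis
  proof (rule that[of "\<lambda>i. t (i + n)" "\<lambda>i. P (i + n)" "\<lambda>i. Q (i + n)" "\<lambda>i. PS (i + n)" "\<lambda>i. QS (i + n)"])
    show "down0 (\<lambda>i. t (i + n))" using t LIMSEQ_ignore_initial_segment[OF t(2), of n] by (simp add: down0_def)
  qed (use * n LIMSEQ_ignore_initial_segment in \<open>auto\<close>)
qed

lemma C1_zero_jacobian_small:
  fixes h :: "real^'n \<Rightarrow> real^'m"
  assumes nX: "is_norm nX" and nY: "is_norm nY" and C1: "C1_around h xb" and J0: "jacobian h (at xb) = 0" and e: "0 < e"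
  obtains r where "r > 0" "\<And>x x'. x \<in> ball xb r \<Longrightarrow> x' \<in> ball xb r \<Longrightarrow> nY (h x - h x') \<le> e * nX (x - x')"
proof -
  obtain C where C: "C > 0" "\<And>y. nY y \<le> C * norm y" using is_norm_upper[OF nY] by metis
  obtain c where c: "c > 0" "\<And>y. c * norm y \<le> nX y" using is_norm_lower[OF nX] by metis
  have pos: "0 < e * c / C" using e c C by simp
  obtain r where r: "r > 0" "\<And>x x'. x \<in> ball xb r \<Longrightarrow> x' \<in> ball xb r \<Longrightarrow>
      norm (h x - h x' - jacobian h (at xb) *v (x - x')) \<le> e * c / C * norm (x - x')"
    by (rule C1_strict_differentiability[OF C1 pos]) blast
  have "nY (h x - h x') \<le> e * nX (x - x')" if "x \<in> ball xb r" "x' \<in> ball xb r" for x x'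
  proof -
    have "nY (h x - h x') \<le> C * norm (h x - h x')" by (rule C)
    also have "\<dots> \<le> C * (e * c / C * norm (x - x'))"
      using r(2)[OF that] C(1) by (intro mult_left_mono) (auto simp: J0)
    also have "\<dots> = e * (c * norm (x - x'))" using C(1) by simp
    also have "\<dots> \<le> e * nX (x - x')" using c(2) e by (intro mult_left_mono) auto
    finally show ?thesis .
  qed
  then show thesis using that r(1) by blast
qed

lemma lipschitz_aroundI:
  fixes h :: "real^'n \<Rightarrow> real^'m"
  assumes nX: "is_norm nX" and nY: "is_norm nY" and "0 < r" "0 \<le> l"
    and le: "\<And>x x'. x \<in> ball xb r \<Longrightarrow> x' \<in> ball xb r \<Longrightarrow> nY (h x - h x') \<le> l * nX (x - x')"
  shows "lipschitz_around h xb"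
proof -
  obtain C where C: "C > 0" "\<And>y. nX y \<le> C * norm y" using is_norm_upper[OF nX] by metis
  obtain c where c: "c > 0" "\<And>y. c * norm y \<le> nY y" using is_norm_lower[OF nY] by metis
  have "(l * C / c)-lipschitz_on (ball xb r) h"
  proof (rule lipschitz_onI)
    fix x x' assume x: "x \<in> ball xb r" "x' \<in> ball xb r"
    have "c * norm (h x - h x') \<le> l * nX (x - x')" using c(2) le[OF x] order_trans by blast
    also have "\<dots> \<le> l * (C * norm (x - x'))" using C(2) \<open>0 \<le> l\<close> by (intro mult_left_mono) auto
    finally show "dist (h x) (h x') \<le> l * C / c * dist x x'" using c(1) by (simp add: dist_norm field_simps)
  qed (use C c \<open>0 \<le> l\<close> in simp)
  then show ?thesis unfolding lipschitz_around_def using \<open>0 < r\<close> centre_in_ball open_ball by blast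
qed

lemma C1_around_diff_affine:
  fixes h :: "real^'n \<Rightarrow> real^'m"
  assumes "C1_around h xb"
  shows "C1_around (\<lambda>x. h x - B *v (x - xb)) xb"
proof -
  obtain U where U: "open U" "xb \<in> U" "\<And>x. x \<in> U \<Longrightarrow> h differentiable (at x)"
    "continuous_on U (\<lambda>x. jacobian h (at x))" using assms unfolding C1_around_def by blast
  have der: "((\<lambda>x. h x - B *v (x - xb)) has_derivative (\<lambda>v. (jacobian h (at x) - B) *v v)) (at x)" if "x \<in> U" for x
  proof -
    have "(h has_derivative (\<lambda>v. jacobian h (at x) *v v)) (at x)"
      using U(3)[OF that] by (simp flip: jacobian_works)
    moreover have "((\<lambda>x. B *v (x - xb)) has_derivative (\<lambda>v. B *v v)) (at x)"
      by (rule bounded_linear.has_derivative[OF matrix_vector_mul_bounded_linear])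
        (auto intro!: derivative_eq_intros)
    ultimately have "((\<lambda>x. h x - B *v (x - xb)) has_derivative (\<lambda>v. jacobian h (at x) *v v - B *v v)) (at x)"
      by (rule has_derivative_diff)
    then show ?thesis by (simp add: matrix_vector_mult_diff_rdistrib)
  qed
  have "continuous_on U (\<lambda>x. jacobian (\<lambda>x. h x - B *v (x - xb)) (at x))"
  proof (rule continuous_on_eq)
    show "continuous_on U (\<lambda>x. jacobian h (at x) - B)" by (intro continuous_intros U(4))
    show "jacobian h (at x) - B = jacobian (\<lambda>x. h x - B *v (x - xb)) (at x)" if "x \<in> U" for x
      using jacobian_eq(1)[OF der[OF that]] by simp
  qed
  then show ?thesis
    unfolding C1_around_def using U(1,2) der differentiableI by blast
qed

text \<open>The linear perturbation \<open>- B (x - xb)\<close> makes \<open>g + B (x - xb)\<close> map the points approaching \<open>xb\<close> from \<open>u\<close> to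
  points approaching \<open>g xb\<close> from \<open>(B + \<nabla>g(xb)) u\<close>, and its adjoint matches the limiting normals. A flat
  correction, which does not change the Lipschitz modulus, then destroys subregularity.\<close>

lemma C1_radius_upper_bound:
  fixes g :: "real^'n \<Rightarrow> real^'m" and B :: "real^'n^'m"
  assumes nX: "is_norm nX" and nY: "is_norm nY" and gC1: "C1_around g xb"
    and reg: "dir_regular D xb \<or> dir_regular K (g xb)"
    and D: "transpose (B + jacobian g (at xb)) *v vs \<in> dir_normal_cone D xb u"
    and K: "- vs \<in> dir_normal_cone K (g xb) ((B + jacobian g (at xb)) *v u)"
    and u: "u \<noteq> 0" and vs: "vs \<noteq> 0"
  shows "\<exists>h\<in>F_C1 xb. lip nX nY h xb \<le> ereal (op_norm nX nY B) \<and>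
     nonsubregular D K (\<lambda>x. g x - h x) xb"
proof -
  let ?J = "jacobian g (at xb)"
  obtain r where r: "r > 0" "\<And>x. x \<in> ball xb r \<Longrightarrow> g differentiable (at x)"
    "continuous_on (ball xb r) (\<lambda>x. jacobian g (at x))" using C1_aroundE[OF gC1] by metis
  obtain t P Q PS QS where t: "down0 t" and P: "P \<longlonglongrightarrow> u" and Q: "Q \<longlonglongrightarrow> (B + ?J) *v u"
    and PS: "PS \<longlonglongrightarrow> transpose (B + ?J) *v vs" and QS: "QS \<longlonglongrightarrow> - vs"
    and nD: "\<And>i. PS i \<in> normal_cone D (xb + t i *\<^sub>R P i)" and nK: "\<And>i. QS i \<in> normal_cone K (g xb + t i *\<^sub>R Q i)"
    and inr: "\<And>i. xb + t i *\<^sub>R P i \<in> ball xb r"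
    by (rule synchronized_normals[OF reg D K r(1)]) blast
  have t0: "0 < t i" "t \<longlonglongrightarrow> 0" for i using t by (auto simp: down0_def)
  define f0 where "f0 x = g x + B *v (x - xb)" for x
  define A where "A i = jacobian g (at (xb + t i *\<^sub>R P i)) + B" for i
  have der: "(f0 has_derivative (\<lambda>v. A i *v v)) (at (xb + t i *\<^sub>R P i))" for i
  proof -
    let ?x = "xb + t i *\<^sub>R P i"
    have "(g has_derivative (\<lambda>v. jacobian g (at ?x) *v v)) (at ?x)"
      using r(2)[OF inr[of i]] by (simp flip: jacobian_works)
    moreover have "((\<lambda>x. B *v (x - xb)) has_derivative (\<lambda>v. B *v v)) (at ?x)"
      by (rule bounded_linear.has_derivative[OF matrix_vector_mul_bounded_linear])
        (auto intro!: derivative_eq_intros)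
    ultimately have "(f0 has_derivative (\<lambda>v. jacobian g (at ?x) *v v + B *v v)) (at ?x)"
      unfolding f0_def[abs_def] by (rule has_derivative_add)
    then show ?thesis by (simp add: A_def matrix_vector_mult_add_rdistrib)
  qed
  have Alim: "A \<longlonglongrightarrow> ?J + B"
  proof -
    have "(\<lambda>i. xb + t i *\<^sub>R P i) \<longlonglongrightarrow> xb + 0 *\<^sub>R u" by (intro tendsto_intros t0 P)
    then have "(\<lambda>i. xb + t i *\<^sub>R P i) \<longlonglongrightarrow> xb" by simp
    moreover have "isCont (\<lambda>x. jacobian g (at x)) xb"
      by (rule continuous_on_interior[OF r(3)]) (use r(1) in simp)
    ultimately show ?thesis
      unfolding A_def[abs_def] by (intro tendsto_add tendsto_const) (rule isCont_tendsto_compose)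
  qed
  have val: "(\<lambda>i. inverse (t i) *\<^sub>R (f0 (xb + t i *\<^sub>R P i) - (g xb + t i *\<^sub>R Q i))) \<longlonglongrightarrow> 0"
  proof -
    have "(\<lambda>i. inverse (t i) *\<^sub>R (g (xb + t i *\<^sub>R P i) - g xb) + B *v P i - Q i) \<longlonglongrightarrow> ?J *v u + B *v u - (B + ?J) *v u"
      by (intro tendsto_add tendsto_diff C1_directional_quotient[OF gC1 t P] matrix_vector_mult_tendsto tendsto_const P Q)
    moreover have "?J *v u + B *v u - (B + ?J) *v u = 0" by (simp add: matrix_vector_mult_add_rdistrib)
    moreover have "inverse (t i) *\<^sub>R (f0 (xb + t i *\<^sub>R P i) - (g xb + t i *\<^sub>R Q i))
       = inverse (t i) *\<^sub>R (g (xb + t i *\<^sub>R P i) - g xb) + B *v P i - Q i" for i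
      using t0(1)[of i] by (simp add: f0_def matrix_vector_mult_scaleR scaleR_diff_right scaleR_add_right)
    ultimately show ?thesis by simp
  qed
  have adj: "(\<lambda>i. transpose (A i) *v QS i + PS i) \<longlonglongrightarrow> 0"
  proof -
    have "(\<lambda>i. transpose (A i) *v QS i + PS i) \<longlonglongrightarrow> transpose (?J + B) *v (- vs) + transpose (B + ?J) *v vs"
      using Alim unfolding transpose_def
      by (intro tendsto_add matrix_vector_mult_tendsto QS PS[unfolded transpose_def] tendsto_intros)
    moreover have "transpose (?J + B) *v (- vs) + transpose (B + ?J) *v vs = 0"
      by (simp only: linear_neg[OF matrix_vector_mul_linear] add.commute[of B ?J] left_minus)
    ultimately show ?thesis by simp
  qed
  obtain h where h: "C1_around h xb" "h xb = 0" "jacobian h (at xb) = 0"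
    and far: "nonsubregular D K (\<lambda>x. f0 x - h x) xb"
    by (rule C1_perturbation_destroys_subregularity[OF t P u nD nK QS _ der val adj]) (use vs in auto)
  define H where "H x = h x - B *v (x - xb)" for x
  have eq: "(\<lambda>x. f0 x - h x) = (\<lambda>x. g x - H x)" by (simp add: f0_def H_def fun_eq_iff)
  have "H \<in> F_C1 xb"
    using C1_around_diff_affine[OF h(1), of B] h(2) by (simp add: F_C1_def H_def[abs_def])
  moreover have "lip nX nY H xb \<le> ereal (op_norm nX nY B)"
  proof (rule ereal_le_epsilon2)
    fix e :: real assume e: "0 < e"
    obtain \<rho> where \<rho>: "\<rho> > 0" "\<And>x x'. x \<in> ball xb \<rho> \<Longrightarrow> x' \<in> ball xb \<rho> \<Longrightarrow> nY (h x - h x') \<le> e * nX (x - x')"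
      using C1_zero_jacobian_small[OF nX nY h(1,3) e] by metis
    have "lip nX nY H xb \<le> ereal (op_norm nX nY B + e)"
    proof (rule lip_leI[OF nX \<rho>(1)])
      fix x x' assume x: "x \<in> ball xb \<rho>" "x' \<in> ball xb \<rho>"
      have "H x - H x' = (h x - h x') + - (B *v (x - x'))"
        by (simp add: H_def matrix_vector_mult_diff_distrib)
      then have "nY (H x - H x') \<le> nY (h x - h x') + nY (B *v (x - x'))"
        using is_norm_triangle[OF nY, of "h x - h x'" "- (B *v (x - x'))"] by (simp add: is_norm_uminus[OF nY])
      also have "\<dots> \<le> e * nX (x - x') + op_norm nX nY B * nX (x - x')"
        by (intro add_mono \<rho>(2)[OF x] op_norm_apply[OF nX nY])
      finally show "nY (H x - H x') \<le> (op_norm nX nY B + e) * nX (x - x')" by (simp add: distrib_right)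
    qed
    then show "lip nX nY H xb \<le> ereal (op_norm nX nY B) + ereal e" by simp
  qed
  ultimately show ?thesis using far unfolding eq by blast
qed

text \<open>A Lipschitz perturbation can prescribe its values and its derivatives independently. Take
  \<open>- (\<xi> v + \<eta> w)\<close>, where \<open>w\<close> is a unit vector with \<open>vs \<bullet> w = 1\<close>, the function \<open>\<xi>\<close> equals \<open>nX (p i - xb)\<close>
  and is constant near \<open>p i\<close>, and \<open>\<eta>\<close> vanishes at \<open>p i\<close> and has slope \<open>us\<close> there. Then the values at
  \<open>p i\<close> contribute the direction \<open>v\<close> and the derivatives contribute \<open>us\<close>. The Lipschitz constants
  of \<open>\<xi>\<close> and \<open>\<eta>\<close> are almost 1 and \<open>dual_norm nX us\<close>, which leads to the sum in the estimate.\<close>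

lemma lipschitz_radius_upper_bound:
  fixes g :: "real^'n \<Rightarrow> real^'m"
  assumes nX: "is_norm nX" and nY: "is_norm nY" and gC1: "C1_around g xb"
    and reg: "dir_regular D xb \<or> dir_regular K (g xb)"
    and D: "us + transpose (jacobian g (at xb)) *v vs \<in> dir_normal_cone D xb u"
    and K: "- vs \<in> dir_normal_cone K (g xb) (v + jacobian g (at xb) *v u)"
    and u: "nX u = 1" and vs: "dual_norm nY vs = 1" and e: "0 < e"
  shows "\<exists>h\<in>F_Lip xb. lip nX nY h xb \<le> ereal (dual_norm nX us + nY v + e) \<and>
     nonsubregular D K (\<lambda>x. g x - h x) xb"
proof -
  let ?J = "jacobian g (at xb)"
  have u0: "u \<noteq> 0" using u is_norm_zero[OF nX] by auto
  have vs0: "vs \<noteq> 0"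
  proof
    assume "vs = 0"
    then have "dual_norm nY vs \<le> 0" by (intro dual_norm_least[OF nY]) auto
    then show False using vs by simp
  qed
  obtain w where w: "nY w \<le> 1" "vs \<bullet> w = 1" using dual_norm_attained[OF nY, of vs] vs by metis
  obtain r where r: "r > 0" "\<And>x. x \<in> ball xb r \<Longrightarrow> g differentiable (at x)"
    "continuous_on (ball xb r) (\<lambda>x. jacobian g (at x))" using C1_aroundE[OF gC1] by metis
  obtain t0 P0 Q0 PS0 QS0 where s0: "down0 t0" "P0 \<longlonglongrightarrow> u" "Q0 \<longlonglongrightarrow> v + ?J *v u"
    "PS0 \<longlonglongrightarrow> us + transpose ?J *v vs" "QS0 \<longlonglongrightarrow> - vs"
    "\<And>i. PS0 i \<in> normal_cone D (xb + t0 i *\<^sub>R P0 i)" "\<And>i. QS0 i \<in> normal_cone K (g xb + t0 i *\<^sub>R Q0 i)"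
    "\<And>i. xb + t0 i *\<^sub>R P0 i \<in> ball xb r"
    by (rule synchronized_normals[OF reg D K r(1)]) blast
  have t00: "0 < t0 i" "t0 \<longlonglongrightarrow> 0" for i using s0(1) by (auto simp: down0_def)
  obtain \<sigma> where \<sigma>: "strict_mono \<sigma>" "\<And>k. 3/4 < nX (P0 (\<sigma> k)) \<and> nX (P0 (\<sigma> k)) < 5/4"
    "\<And>k. t0 (\<sigma> (Suc k)) < t0 (\<sigma> k) / 3"
  proof (rule subsequence_with_gaps[where P = "\<lambda>k i. 3/4 < nX (P0 i) \<and> nX (P0 i) < 5/4" and Q = "\<lambda>m n. t0 n < t0 m / 3"])
    show "\<forall>\<^sub>F i in sequentially. 3/4 < nX (P0 i) \<and> nX (P0 i) < 5/4" for k :: nat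
      by (intro eventually_conj order_tendstoD[OF is_norm_tendsto[OF nX s0(2)]]) (simp_all add: u)
    show "\<forall>\<^sub>F n in sequentially. t0 n < t0 m / 3" for m
      by (rule order_tendstoD(2)[OF t00(2)]) (use t00(1) in simp)
  qed blast
  define t P Q PS QS where "t i = t0 (\<sigma> i)" and "P i = P0 (\<sigma> i)" and "Q i = Q0 (\<sigma> i)"
    and "PS i = PS0 (\<sigma> i)" and "QS i = QS0 (\<sigma> i)" for i
  note defs = t_def P_def Q_def PS_def QS_def
  have t: "0 < t i" "t \<longlonglongrightarrow> 0" for i
    using t00(1) LIMSEQ_subseq_LIMSEQ[OF t00(2) \<sigma>(1)] by (simp_all add: defs[abs_def] o_def)
  have P: "P \<longlonglongrightarrow> u" and Q: "Q \<longlonglongrightarrow> v + ?J *v u" and PS: "PS \<longlonglongrightarrow> us + transpose ?J *v vs" and QS: "QS \<longlonglongrightarrow> - vs"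
    using s0(2-5)[THEN LIMSEQ_subseq_LIMSEQ[OF _ \<sigma>(1)]] by (simp_all add: defs[abs_def] o_def)
  have nD: "PS i \<in> normal_cone D (xb + t i *\<^sub>R P i)" and nK: "QS i \<in> normal_cone K (g xb + t i *\<^sub>R Q i)"
    and inr: "xb + t i *\<^sub>R P i \<in> ball xb r" for i
    using s0(6-8) by (simp_all only: defs)
  have down: "down0 t" using t by (simp add: down0_def)
  define p where "p i = xb + t i *\<^sub>R P i" for i
  have pn: "nX (p i - xb) = t i * nX (P i)" for i
    using t(1)[of i] by (simp add: p_def is_norm_scale[OF nX])
  have pb: "3/4 * t i \<le> nX (p i - xb)" "nX (p i - xb) \<le> 5/4 * t i" for i
    using mult_left_mono[OF less_imp_le[OF conjunct1[OF \<sigma>(2)[of i]]], of "t i"]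
      mult_left_mono[OF less_imp_le[OF conjunct2[OF \<sigma>(2)[of i]]], of "t i"] t(1)[of i]
    unfolding pn by (simp_all add: defs mult_ac)
  have gap: "t j \<le> t i / 3" if "i < j" for i j
    by (rule geometric_gaps[OF t(1) _ that]) (use less_imp_le[OF \<sigma>(3)] in \<open>simp add: defs\<close>)
  have sep: "1/4 * (t i + t j) \<le> nX (p i - p j)" if "i \<noteq> j" for i j
  proof -
    have tri: "nX (p i - xb) - nX (p j - xb) \<le> nX (p i - p j)" "nX (p j - xb) - nX (p i - xb) \<le> nX (p i - p j)"
      using is_norm_triangle_diff[OF nX, of "p i - xb" "p j - xb"] is_norm_triangle_diff[OF nX, of "p j - xb" "p i - xb"]
        is_norm_commute[OF nX, of "p i" "p j"] by simp_all
    show ?thesis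
    proof (cases "i < j")
      case True
      have "1/4 * (t i + t j) \<le> 3/4 * t i - 5/4 * t j" using gap[OF True] by (simp add: field_simps)
      then show ?thesis using tri(1) pb(1)[of i] pb(2)[of j] by linarith
    next
      case False
      then have "j < i" using that by simp
      have "1/4 * (t i + t j) \<le> 3/4 * t j - 5/4 * t i" using gap[OF \<open>j < i\<close>] by (simp add: field_simps)
      then show ?thesis using tri(2) pb(1)[of j] pb(2)[of i] by linarith
    qed
  qed
  have sepb: "1/4 * t i \<le> nX (p i - xb)" for i using pb[of i] t(1)[of i] by linarith
  \<comment> \<open>the errors add up to \<open>e' (nY v + 2)\<close>: \<open>e' nY v\<close> from \<open>\<xi>\<close>, and \<open>e'\<close> each from \<open>\<eta>\<close> and the flat correction\<close>
  define e' where "e' = e / (nY v + 2)"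
  have nv: "0 \<le> nY v" by (rule is_norm_nonneg[OF nY])
  have e': "0 < e'" "e' * (nY v + 2) = e" using e nv by (auto simp: e'_def add_nonneg_pos)
  have duals: "0 \<le> dual_norm nX us" by (rule dual_norm_nonneg[OF nX])
  obtain \<xi> where \<xi>: "\<xi> xb = 0" "\<And>x y. \<bar>\<xi> x - \<xi> y\<bar> \<le> (1 + e') * nX (x - y)"
    "\<And>i. \<forall>\<^sub>F x in nhds (p i). \<xi> x = nX (p i - xb) + 0 \<bullet> (x - p i)"
  proof (rule lipschitz_with_affine_germs[where t = t and c = "1/4" and e = e' and L = 1 and p = p and xb = xb
          and s = "\<lambda>i. nX (p i - xb)" and a = 0, OF nX t(1)])
    show "nX (p i - xb) - nX (p j - xb) \<le> 1 * nX (p i - p j)" for i j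
      using is_norm_triangle_diff[OF nX, of "p i - xb" "p j - xb"] by simp
  qed (use e' sep sepb is_norm_nonneg[OF nX] in auto)
  obtain \<eta> where \<eta>: "\<eta> xb = 0" "\<And>x y. \<bar>\<eta> x - \<eta> y\<bar> \<le> (dual_norm nX us + e') * nX (x - y)"
    "\<And>i. \<forall>\<^sub>F x in nhds (p i). \<eta> x = 0 + us \<bullet> (x - p i)"
  proof (rule lipschitz_with_affine_germs[where t = t and c = "1/4" and e = e' and L = "dual_norm nX us"
          and p = p and xb = xb and s = "\<lambda>i. 0" and a = us, OF nX t(1)])
    show "us \<bullet> y \<le> dual_norm nX us * nX y" for y by (rule dual_norm_inner[OF nX])
  qed (use e' sep sepb is_norm_nonneg[OF nX] duals in auto)
  define W :: "real^'n^'m" where "W = (\<chi> a c. w $ a * us $ c)"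
  have W: "W *v y = (us \<bullet> y) *\<^sub>R w" for y
    by (simp add: vec_eq_iff W_def matrix_vector_mult_def inner_vec_def sum_distrib_left mult_ac)
  have Wt: "transpose W *v z = (w \<bullet> z) *\<^sub>R us" for z
    by (simp add: vec_eq_iff W_def transpose_def vector_matrix_mult_def matrix_vector_mult_def inner_vec_def sum_distrib_left mult_ac)
  define f0 where "f0 x = g x + (\<xi> x *\<^sub>R v + \<eta> x *\<^sub>R w)" for x
  define A where "A i = jacobian g (at (p i)) + W" for i
  have der: "(f0 has_derivative (\<lambda>y. A i *v y)) (at (xb + t i *\<^sub>R P i))" for i
  proof -
    have "(g has_derivative (\<lambda>y. jacobian g (at (p i)) *v y)) (at (p i))"
      using r(2)[OF inr[of i]] unfolding p_def by (simp flip: jacobian_works)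
    moreover have "((\<lambda>x. nX (p i - xb) *\<^sub>R v + (us \<bullet> (x - p i)) *\<^sub>R w) has_derivative (\<lambda>y. W *v y)) (at (p i))"
      unfolding W by (auto intro!: derivative_eq_intros)
    ultimately have *: "((\<lambda>x. g x + (nX (p i - xb) *\<^sub>R v + (us \<bullet> (x - p i)) *\<^sub>R w)) has_derivative (\<lambda>y. A i *v y)) (at (p i))"
      unfolding A_def matrix_vector_mult_add_rdistrib by (rule has_derivative_add)
    have "\<forall>\<^sub>F x in nhds (p i). g x + (nX (p i - xb) *\<^sub>R v + (us \<bullet> (x - p i)) *\<^sub>R w) = f0 x"
      using \<xi>(3)[of i] \<eta>(3)[of i] by eventually_elim (simp add: f0_def)
    then obtain S where S: "open S" "p i \<in> S" "\<And>x. x \<in> S \<Longrightarrow> g x + (nX (p i - xb) *\<^sub>R v + (us \<bullet> (x - p i)) *\<^sub>R w) = f0 x"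
      unfolding eventually_nhds by blast
    show ?thesis
      unfolding p_def[symmetric] by (rule has_derivative_transform_within_open[OF * S])
  qed
  have at_p: "\<xi> (p i) = nX (p i - xb)" "\<eta> (p i) = 0" for i
    using eventually_nhds_x_imp_x[OF \<xi>(3)[of i]] eventually_nhds_x_imp_x[OF \<eta>(3)[of i]] by simp_all
  have val: "(\<lambda>i. inverse (t i) *\<^sub>R (f0 (xb + t i *\<^sub>R P i) - (g xb + t i *\<^sub>R Q i))) \<longlonglongrightarrow> 0"
  proof -
    have "(\<lambda>i. inverse (t i) *\<^sub>R (g (xb + t i *\<^sub>R P i) - g xb) + nX (P i) *\<^sub>R v - Q i) \<longlonglongrightarrow> ?J *v u + nX u *\<^sub>R v - (v + ?J *v u)"
      by (intro tendsto_add tendsto_diff C1_directional_quotient[OF gC1 down P] tendsto_scaleR tendsto_const Q is_norm_tendsto[OF nX P])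
    moreover have "?J *v u + nX u *\<^sub>R v - (v + ?J *v u) = 0" by (simp add: u)
    moreover have "inverse (t i) *\<^sub>R (f0 (xb + t i *\<^sub>R P i) - (g xb + t i *\<^sub>R Q i))
       = inverse (t i) *\<^sub>R (g (xb + t i *\<^sub>R P i) - g xb) + nX (P i) *\<^sub>R v - Q i" for i
    proof -
      have "f0 (xb + t i *\<^sub>R P i) = g (xb + t i *\<^sub>R P i) + (t i * nX (P i)) *\<^sub>R v"
        using at_p[of i] pn[of i] by (simp add: f0_def p_def)
      then show ?thesis using t(1)[of i] by (simp add: scaleR_diff_right scaleR_add_right)
    qed
    ultimately show ?thesis by simp
  qed
  have adj: "(\<lambda>i. transpose (A i) *v QS i + PS i) \<longlonglongrightarrow> 0"
  proof -
    have "(\<lambda>i. xb + t i *\<^sub>R P i) \<longlonglongrightarrow> xb + 0 *\<^sub>R u" by (intro tendsto_intros t P)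
    then have "p \<longlonglongrightarrow> xb" by (simp add: p_def[abs_def])
    moreover have "isCont (\<lambda>x. jacobian g (at x)) xb"
      by (rule continuous_on_interior[OF r(3)]) (use r(1) in simp)
    ultimately have Alim: "A \<longlonglongrightarrow> ?J + W"
      unfolding A_def[abs_def] by (intro tendsto_add tendsto_const) (rule isCont_tendsto_compose)
    have "(\<lambda>i. transpose (A i) *v QS i + PS i) \<longlonglongrightarrow> transpose (?J + W) *v (- vs) + (us + transpose ?J *v vs)"
      using Alim unfolding transpose_def
      by (intro tendsto_add matrix_vector_mult_tendsto QS PS[unfolded transpose_def] tendsto_intros)
    moreover have "transpose (?J + W) *v (- vs) + (us + transpose ?J *v vs) = 0"
    proof -
      have "transpose (?J + W) = transpose ?J + transpose W" by (simp add: transpose_def vec_eq_iff)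
      then have "transpose (?J + W) *v (- vs) = transpose ?J *v (- vs) + transpose W *v (- vs)"
        by (simp only: matrix_vector_mult_add_rdistrib)
      also have "\<dots> = - (transpose ?J *v vs) - us"
        unfolding Wt linear_neg[OF matrix_vector_mul_linear] by (simp add: w(2) inner_commute[of w])
      finally show ?thesis by simp
    qed
    ultimately show ?thesis by simp
  qed
  obtain h where h: "C1_around h xb" "h xb = 0" "jacobian h (at xb) = 0"
    and far: "nonsubregular D K (\<lambda>x. f0 x - h x) xb"
    by (rule C1_perturbation_destroys_subregularity[OF down P u0 nD nK QS _ der val adj]) (use vs0 in auto)
  define H where "H x = h x - (\<xi> x *\<^sub>R v + \<eta> x *\<^sub>R w)" for x
  have eq: "(\<lambda>x. f0 x - h x) = (\<lambda>x. g x - H x)" by (simp add: f0_def H_def fun_eq_iff)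
  obtain \<rho> where \<rho>: "\<rho> > 0" "\<And>x x'. x \<in> ball xb \<rho> \<Longrightarrow> x' \<in> ball xb \<rho> \<Longrightarrow> nY (h x - h x') \<le> e' * nX (x - x')"
    using C1_zero_jacobian_small[OF nX nY h(1,3) e'(1)] by metis
  have lip: "nY (H x - H x') \<le> (dual_norm nX us + nY v + e) * nX (x - x')" if x: "x \<in> ball xb \<rho>" "x' \<in> ball xb \<rho>" for x x'
  proof -
    define n where "n = nX (x - x')"
    have n0: "0 \<le> n" unfolding n_def by (rule is_norm_nonneg[OF nX])
    have "H x - H x' = (h x - h x') + - ((\<xi> x - \<xi> x') *\<^sub>R v + (\<eta> x - \<eta> x') *\<^sub>R w)"
      by (simp add: H_def scaleR_diff_left)
    then have "nY (H x - H x') \<le> nY (h x - h x') + nY ((\<xi> x - \<xi> x') *\<^sub>R v + (\<eta> x - \<eta> x') *\<^sub>R w)"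
      using is_norm_triangle[OF nY, of "h x - h x'" "- ((\<xi> x - \<xi> x') *\<^sub>R v + (\<eta> x - \<eta> x') *\<^sub>R w)"]
      unfolding is_norm_uminus[OF nY] by simp
    also have "\<dots> \<le> e' * n + (nY ((\<xi> x - \<xi> x') *\<^sub>R v) + nY ((\<eta> x - \<eta> x') *\<^sub>R w))"
      unfolding n_def by (intro add_mono \<rho>(2)[OF x] is_norm_triangle[OF nY])
    also have "nY ((\<xi> x - \<xi> x') *\<^sub>R v) \<le> (1 + e') * n * nY v"
      unfolding is_norm_scale[OF nY] n_def by (intro mult_right_mono \<xi>(2) nv)
    also have "nY ((\<eta> x - \<eta> x') *\<^sub>R w) \<le> (dual_norm nX us + e') * n * 1"
      unfolding is_norm_scale[OF nY] n_def
      using \<eta>(2)[of x x'] w(1) is_norm_nonneg[OF nY] by (intro mult_mono) auto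
    also have "e' * n + ((1 + e') * n * nY v + (dual_norm nX us + e') * n * 1) = (dual_norm nX us + nY v + e' * (nY v + 2)) * n"
      by (simp add: algebra_simps)
    finally show ?thesis by (simp add: n_def e'(2))
  qed
  have "H \<in> F_Lip xb"
    unfolding F_Lip_def
  proof (intro CollectI conjI)
    show "H xb = 0" by (simp add: H_def h(2) \<xi>(1) \<eta>(1))
    show "lipschitz_around H xb"
      by (rule lipschitz_aroundI[OF nX nY \<rho>(1) _ lip]) (use nv duals e in auto)
  qed
  moreover have "lip nX nY H xb \<le> ereal (dual_norm nX us + nY v + e)"
    by (rule lip_leI[OF nX \<rho>(1) lip])
  ultimately show ?thesis using far unfolding eq by blast
qed

section \<open>The radii of subregularity\<close>

theorem corollary17:
  fixes nX :: "real^'n \<Rightarrow> real" and nY :: "real^'m \<Rightarrow> real"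
    and D :: "(real^'n) set" and K :: "(real^'m) set"
    and g :: "real^'n \<Rightarrow> real^'m" and xb :: "real^'n"
    and F :: "real^'n \<Rightarrow> (real^'m) set" and J :: "real^'n^'m"
  assumes "is_norm nX" and "is_norm nY"
    and "closed D" and "closed K"
    and "xb \<in> D" and "g xb \<in> K"
    and "dir_regular D xb \<or> dir_regular K (g xb)"
    and "C1_around g xb"
    and F_def: "\<And>x. F x = (if x \<in> D then (\<lambda>k. k - g x) ` K else {})"
    and J_def: "J = jacobian g (at xb)"
  shows "(Inf {ereal (max (dual_norm nX us) (nY v)) | us v u vs.
            us + transpose J *v vs \<in> dir_normal_cone D xb u \<and>
            - vs \<in> dir_normal_cone K (g xb) (v + J *v u) \<and>
            nX u = 1 \<and> dual_norm nY vs = 1}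
         \<le> rad_SR nX nY (F_Lip xb) F xb 0) \<and>
    (rad_SR nX nY (F_Lip xb) F xb 0
         \<le> Inf {ereal (dual_norm nX us + nY v) | us v u vs.
            us + transpose J *v vs \<in> dir_normal_cone D xb u \<and>
            - vs \<in> dir_normal_cone K (g xb) (v + J *v u) \<and>
            nX u = 1 \<and> dual_norm nY vs = 1}) \<and>
    (rad_SR nX nY (F_ss xb) F xb 0 = rad_SR nX nY (F_C1 xb) F xb 0) \<and>
    (rad_SR nX nY (F_C1 xb) F xb 0
         = Inf {ereal (op_norm nX nY B) | B u vs.
            transpose (B + J) *v vs \<in> dir_normal_cone D xb u \<and>
            - vs \<in> dir_normal_cone K (g xb) ((B + J) *v u) \<and>
            nX u = 1 \<and> dual_norm nY vs = 1})"
proof -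
  note nX = assms(1) and nY = assms(2) and cD = assms(3) and cK = assms(4) and xD = assms(5)
    and gK = assms(6) and reg = assms(7) and gC1 = assms(8)
  define bad where "bad h \<longleftrightarrow> nonsubregular D K (\<lambda>x. g x - h x) xb" for h
  have bad: "\<not> metrically_subregular nX nY (\<lambda>x. (\<lambda>y. y + h x) ` F x) xb 0 \<longleftrightarrow> bad h" if "h xb = 0" for h
    unfolding bad_def by (rule not_metrically_subregular_iff[where g = g and h = h and F = F, OF nX nY xD gK that F_def])
  have rad: "rad_SR nX nY C F xb 0 = (INF h\<in>{h\<in>C. bad h}. lip nX nY h xb)" if "\<And>h. h \<in> C \<Longrightarrow> h xb = 0" for C
  proof -
    have "{h \<in> C. \<not> metrically_subregular nX nY (\<lambda>x. (\<lambda>y. y + h x) ` F x) xb 0} = {h \<in> C. bad h}"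
      using bad that by auto
    then show ?thesis by (simp add: rad_SR_def)
  qed
  have radLip: "rad_SR nX nY (F_Lip xb) F xb 0 = (INF h\<in>{h\<in>F_Lip xb. bad h}. lip nX nY h xb)"
    and radss: "rad_SR nX nY (F_ss xb) F xb 0 = (INF h\<in>{h\<in>F_ss xb. bad h}. lip nX nY h xb)"
    and radC1: "rad_SR nX nY (F_C1 xb) F xb 0 = (INF h\<in>{h\<in>F_C1 xb. bad h}. lip nX nY h xb)"
    by (rule rad; simp add: F_Lip_def F_ss_def F_C1_def)+
  let ?S1 = "{ereal (max (dual_norm nX us) (nY v)) | us v u vs.
            us + transpose J *v vs \<in> dir_normal_cone D xb u \<and>
            - vs \<in> dir_normal_cone K (g xb) (v + J *v u) \<and>
            nX u = 1 \<and> dual_norm nY vs = 1}"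
  let ?S2 = "{ereal (dual_norm nX us + nY v) | us v u vs.
            us + transpose J *v vs \<in> dir_normal_cone D xb u \<and>
            - vs \<in> dir_normal_cone K (g xb) (v + J *v u) \<and>
            nX u = 1 \<and> dual_norm nY vs = 1}"
  let ?S3 = "{ereal (op_norm nX nY B) | B u vs.
            transpose (B + J) *v vs \<in> dir_normal_cone D xb u \<and>
            - vs \<in> dir_normal_cone K (g xb) ((B + J) *v u) \<and>
            nX u = 1 \<and> dual_norm nY vs = 1}"
  have 1: "Inf ?S1 \<le> rad_SR nX nY (F_Lip xb) F xb 0"
    unfolding radLip
  proof (rule INF_greatest)
    fix h assume "h \<in> {h \<in> F_Lip xb. bad h}"
    then obtain us v u vs where
      "us + transpose J *v vs \<in> dir_normal_cone D xb u" "- vs \<in> dir_normal_cone K (g xb) (v + J *v u)"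
      "nX u = 1" "dual_norm nY vs = 1" and le: "ereal (max (dual_norm nX us) (nY v)) \<le> lip nX nY h xb"
      using lipschitz_perturbation_lower_bound[OF nX nY cD cK xD gK gC1, of h] unfolding bad_def J_def by blast
    then have "ereal (max (dual_norm nX us) (nY v)) \<in> ?S1" by blast
    then show "Inf ?S1 \<le> lip nX nY h xb" using le by (rule Inf_lower2)
  qed
  have 2: "rad_SR nX nY (F_Lip xb) F xb 0 \<le> Inf ?S2"
  proof (rule Inf_greatest)
    fix y assume "y \<in> ?S2"
    then obtain us v u vs where y: "y = ereal (dual_norm nX us + nY v)" and
      *: "us + transpose (jacobian g (at xb)) *v vs \<in> dir_normal_cone D xb u"
      "- vs \<in> dir_normal_cone K (g xb) (v + jacobian g (at xb) *v u)" "nX u = 1" "dual_norm nY vs = 1"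
      unfolding J_def by blast
    show "rad_SR nX nY (F_Lip xb) F xb 0 \<le> y"
    proof (rule ereal_le_epsilon2)
      fix e :: real assume "0 < e"
      then obtain h where h: "h \<in> F_Lip xb" "bad h" "lip nX nY h xb \<le> ereal (dual_norm nX us + nY v + e)"
        using lipschitz_radius_upper_bound[OF nX nY gC1 reg *] unfolding bad_def by blast
      have "rad_SR nX nY (F_Lip xb) F xb 0 \<le> lip nX nY h xb"
        unfolding radLip using h(1,2) by (intro INF_lower) simp
      then show "rad_SR nX nY (F_Lip xb) F xb 0 \<le> y + ereal e" using h(3) by (simp add: y)
    qed
  qed
  have 3: "Inf ?S3 \<le> rad_SR nX nY (F_ss xb) F xb 0"
    unfolding radss
  proof (rule INF_greatest)
    fix h assume "h \<in> {h \<in> F_ss xb. bad h}"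
    then obtain B u vs where
      "transpose (B + J) *v vs \<in> dir_normal_cone D xb u" "- vs \<in> dir_normal_cone K (g xb) ((B + J) *v u)"
      "nX u = 1" "dual_norm nY vs = 1" and le: "ereal (op_norm nX nY B) \<le> lip nX nY h xb"
      using semismooth_perturbation_lower_bound[OF nX nY cD cK xD gK gC1, of h] unfolding bad_def J_def by blast
    then have "ereal (op_norm nX nY B) \<in> ?S3" by blast
    then show "Inf ?S3 \<le> lip nX nY h xb" using le by (rule Inf_lower2)
  qed
  have 4: "rad_SR nX nY (F_ss xb) F xb 0 \<le> rad_SR nX nY (F_C1 xb) F xb 0"
    unfolding radss radC1 by (rule INF_superset_mono) (auto simp: F_ss_def F_C1_def C1_imp_semismooth)
  have 5: "rad_SR nX nY (F_C1 xb) F xb 0 \<le> Inf ?S3"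
  proof (rule Inf_greatest)
    fix y assume "y \<in> ?S3"
    then obtain B u vs where y: "y = ereal (op_norm nX nY B)" and
      *: "transpose (B + jacobian g (at xb)) *v vs \<in> dir_normal_cone D xb u"
      "- vs \<in> dir_normal_cone K (g xb) ((B + jacobian g (at xb)) *v u)" and n: "nX u = 1" "dual_norm nY vs = 1"
      unfolding J_def by blast
    have "u \<noteq> 0" using n(1) is_norm_zero[OF nX] by auto
    moreover have "vs \<noteq> 0"
    proof
      assume "vs = 0"
      then have "dual_norm nY vs \<le> 0" by (intro dual_norm_least[OF nY]) auto
      then show False using n(2) by simp
    qed
    ultimately obtain h where h: "h \<in> F_C1 xb" "bad h" "lip nX nY h xb \<le> y"
      using C1_radius_upper_bound[OF nX nY gC1 reg *] unfolding bad_def y by blast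
    have "rad_SR nX nY (F_C1 xb) F xb 0 \<le> lip nX nY h xb"
      unfolding radC1 using h(1,2) by (intro INF_lower) simp
    then show "rad_SR nX nY (F_C1 xb) F xb 0 \<le> y" using h(3) by (rule order_trans)
  qed
  show ?thesis using 1 2 3 4 5 by (intro conjI antisym order_trans[OF 5 3] order_trans[OF 3 4]) auto
qed

end
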